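(* Under the standing assumptions of the context on $v$ and $\lambda_0$, let $(\Lambda_1,\Lambda_2)$ be a sufficiently small neighborhood of $\lambda_0$ and let $\lambda=\lambda(\hbar)\in(\Lambda_1,\Lambda_2)$ be an eigenvalue of the operator $H(\hbar)$. Then, as $\hbar\to0$, for at least one $\ell=\ell(\hbar)\in\{1,\ldots,L\}$ the estimate $$\cos\big(\hbar^{-1}\Phi_\ell(\lambda)\big)=O(\hbar)$$ is satisfied, and hence the quantization condition $$\Phi_\ell(\lambda)=\pi\Big(n+\frac12\Big)\hbar+O(\hbar^2)$$ holds with some integer $n=n_\ell(\hbar)$. (That is: there are constants $C,\hbar_0>0$ such that for every $\hbar\in(0,\hbar_0)$ and every eigenvalue $\lambda\in(\Lambda_1,\Lambda_2)$ of $H(\hbar)$ there are $\ell\in\{1,\ldots,L\}$ and $n\in\mathbb Z$ with $|\cos(\hbar^{-1}\Phi_\ell(\lambda))|\le C\hbar$ and $|\Phi_\ell(\lambda)-\pi(n+1/2)\hbar|\le C\hbar^2$.)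
   Context: Standing assumptions: $v\in C^2(\mathbb R)$ is real, $\lambda_0\in\mathbb R$; the equation $v(x)=\lambda_0$ has only a finite number of solutions, $v'(x)\ne0$ at each of them, and $v\in C^3$ in some neighborhoods of these points; $\liminf_{x\to\pm\infty}v(x)>\lambda_0$; and, for some $\rho_0>1$ and a fixed point $x_0$ with $v(x_0)=\lambda_0$, the function $$\big(|v(x)-\lambda_0|^{-3}v'(x)^2+|v(x)-\lambda_0|^{-2}|v''(x)|\big)\Big|\int_{x_0}^x|v(y)-\lambda_0|^{1/2}dy\Big|^{\rho_0}$$ is bounded as $|x|\to\infty$. $H(\hbar)=-\hbar^2\,d^2/dx^2+v(x)$ is the self-adjoint Schrödinger operator in $L^2(\mathbb R)$. For $\lambda$ in a sufficiently small neighborhood $(\Lambda_1,\Lambda_2)$ of $\lambda_0$, containing no critical values of $v$ and with closure below $\liminf_{|x|\to\infty}v$, the solutions of $v(x)=\lambda$ are enumerated as $x_{1,-}(\lambda)<x_{1,+}(\lambda)<x_{2,-}(\lambda)<x_{2,+}(\lambda)<\cdots<x_{L,-}(\lambda)<x_{L,+}(\lambda)$, with $v<\lambda$ exactly on the wells $X_\ell(\lambda)=(x_{\ell,-}(\lambda),x_{\ell,+}(\lambda))$, $\ell=1,\ldots,L$. Set $\Phi_\ell(\lambda)=\int_{x_{\ell,-}(\lambda)}^{x_{\ell,+}(\lambda)}(\lambda-v(x))^{1/2}dx$. *)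

theory Defs
  imports "HOL-Analysis.Analysis"
begin

text \<open>Intended for open \<^term>\<open>S\<close>, where \<^term>\<open>deriv\<close> is the honest (two-sided) derivative.\<close>

definition C_k_on :: "nat \<Rightarrow> (real \<Rightarrow> real) \<Rightarrow> real set \<Rightarrow> bool" where
  "C_k_on k f S \<longleftrightarrow>
     (\<forall>j<k. \<forall>x\<in>S. ((deriv ^^ j) f) differentiable (at x)) \<and> continuous_on S ((deriv ^^ k) f)"

definition in_L2 :: "(real \<Rightarrow> complex) \<Rightarrow> bool" where
  "in_L2 u \<longleftrightarrow> u \<in> borel_measurable lebesgue \<and> integrable lebesgue (\<lambda>x. (cmod (u x))\<^sup>2)"

text \<open>
  The graph of the operator \<open>- h^2 d^2/dx^2 + v\<close> on its maximal domain in \<open>L^2(R)\<close>: those \<open>u\<close> in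
  \<open>L^2\<close> such that \<open>u\<close> and \<open>u'\<close> are locally absolutely continuous and \<open>- h^2 u'' + v u\<close> is in \<open>L^2\<close>.
  Here \<open>u''\<close> is the almost everywhere derivative of \<open>u'\<close>, so local absolute continuity of \<open>u'\<close> is
  expressed by the fundamental theorem of calculus for a locally integrable \<open>w = u''\<close>; an element
  of \<open>L^2\<close> in the domain is represented by its continuously differentiable representative.
  For \<open>v\<close> continuous and bounded below (as it is when its lower limits at both ends exceed some
  real number) both ends are in the limit point case. Then this is the unique self-adjoint
  realization, namely the closure of the differential expression on compactly supported smooth
  functions.
\<close>

definition schrodinger_op ::
    "(real \<Rightarrow> real) \<Rightarrow> real \<Rightarrow> (real \<Rightarrow> complex) \<Rightarrow> (real \<Rightarrow> complex) \<Rightarrow> bool" where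
  "schrodinger_op v h u f \<longleftrightarrow>
     in_L2 u \<and> in_L2 f \<and>
     (\<exists>u' w. (\<forall>x. (u has_vector_derivative u' x) (at x)) \<and>
        (\<forall>a b. a \<le> b \<longrightarrow> w absolutely_integrable_on {a..b} \<and> (w has_integral u' b - u' a) {a..b}) \<and>
        (AE x in lebesgue. f x = - of_real (h\<^sup>2) * w x + of_real (v x) * u x))"

text \<open>Eigenvalues of an operator in \<open>L^2(R)\<close> given by its graph; eigenfunctions are nonzero in
  \<open>L^2\<close>, i.e. not almost everywhere zero.\<close>

definition eigenvalue_L2 :: "((real \<Rightarrow> complex) \<Rightarrow> (real \<Rightarrow> complex) \<Rightarrow> bool) \<Rightarrow> complex \<Rightarrow> bool" where
  "eigenvalue_L2 T \<mu> \<longleftrightarrow> (\<exists>u. T u (\<lambda>x. \<mu> * u x) \<and> \<not> (AE x in lebesgue. u x = 0))"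

text \<open>The turning points at energy \<^term>\<open>lam\<close> are \<open>xm 1 < xp 1 < xm 2 < \<dots> < xm L < xp L\<close>, and
  \<open>v < lam\<close> exactly on the wells \<open>(xm l, xp l)\<close>.\<close>

definition enumerates_wells ::
    "(real \<Rightarrow> real) \<Rightarrow> real \<Rightarrow> nat \<Rightarrow> (nat \<Rightarrow> real) \<Rightarrow> (nat \<Rightarrow> real) \<Rightarrow> bool" where
  "enumerates_wells v lam L xm xp \<longleftrightarrow>
     (\<forall>l\<in>{1..L}. xm l < xp l) \<and> (\<forall>l\<in>{1..<L}. xp l < xm (Suc l)) \<and>
     {x. v x = lam} = xm ` {1..L} \<union> xp ` {1..L} \<and>
     {x. v x < lam} = (\<Union>l\<in>{1..L}. {xm l<..<xp l})"

definition well_neighborhood ::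
    "(real \<Rightarrow> real) \<Rightarrow> real \<Rightarrow> real \<Rightarrow> nat \<Rightarrow> (nat \<Rightarrow> real \<Rightarrow> real) \<Rightarrow> (nat \<Rightarrow> real \<Rightarrow> real) \<Rightarrow> bool" where
  "well_neighborhood v \<Lambda>1 \<Lambda>2 L xm xp \<longleftrightarrow>
     (\<forall>x. v x \<in> {\<Lambda>1<..<\<Lambda>2} \<longrightarrow> deriv v x \<noteq> 0) \<and>
     ereal \<Lambda>2 < Liminf at_top (\<lambda>x. ereal (v x)) \<and>
     ereal \<Lambda>2 < Liminf at_bot (\<lambda>x. ereal (v x)) \<and>
     (\<forall>lam\<in>{\<Lambda>1<..<\<Lambda>2}. enumerates_wells v lam L (\<lambda>l. xm l lam) (\<lambda>l. xp l lam))"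

definition well_action :: "(real \<Rightarrow> real) \<Rightarrow> real \<Rightarrow> real \<Rightarrow> real \<Rightarrow> real" where
  "well_action v lam a b = (LBINT x=a..b. sqrt (lam - v x))"

end

theory Submission
  imports Defs
begin

text \<open>
Write \<open>W = \<lambda> - v\<close>. An eigenfunction yields a real solution \<open>y \<noteq> 0\<close> of \<open>h\<^sup>2 y'' = - W y\<close> in \<open>L\<^sup>2\<close>
whose flux \<open>y y'\<close> is nondecreasing wherever \<open>v \<ge> \<lambda>\<close>. Square integrability makes the flux
nonnegative to the left of all wells and nonpositive to the right of them
(\<open>L2_flux_nonneg_left\<close>, \<open>L2_flux_nonpos_right\<close>). Place one fixed point in every barrier. Some well
then has nonnegative flux at the barrier point on its left and nonpositive flux at the one on
its right, and for this well the condition \<open>cos (\<Phi> / h) = O(h)\<close> holds, whatever the other wells look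
like. This is \<open>single_well_quantization\<close>.

In the interior of a well the solution is described by the point
\<open>(h W\<^bsup>-1/4\<^esup> y', W\<^bsup>1/4\<^esup> y)\<close> of the plane, which rotates with angular velocity \<open>W\<^bsup>1/2\<^esup> / h\<close> up to \<open>O(h)\<close>
(\<open>wkb_transport\<close>). The claim for one half of a well is that nonnegative flux in the left barrier
forces the angle at an interior point \<open>m\<close> to be \<open>S / h + \<pi>/4 + O(h)\<close> modulo \<open>\<pi>\<close>, where \<open>S\<close> is the
integral of \<open>W\<^bsup>1/2\<^esup>\<close> from the turning point to \<open>m\<close> (\<open>half_well_phase\<close>). Reflection gives the angle
\<open>- (S' / h + \<pi>/4) + O(h)\<close> from the right half. As \<open>S + S' = \<Phi>\<close>, comparing the two angles gives
\<open>sin (\<Phi> / h + \<pi>/2) = O(h)\<close>.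

The passage through the turning point compares \<open>y\<close> with a function \<open>B = \<phi> A(\<zeta>)\<close>, where \<open>A\<close> solves Airy's
equation and \<open>\<zeta>\<close> is Langer's variable, \<open>\<zeta> \<zeta>'\<^sup>2 = W\<close>, \<open>\<phi> = \<zeta>'\<^bsup>-1/2\<^esup>\<close> (\<open>langer_map\<close>). The Wronskian of \<open>y\<close>
and \<open>B\<close> has derivative \<open>\<phi>'' y A(\<zeta>)\<close>, so it suffices to bound the \<open>L\<^sup>2\<close> masses of \<open>y\<close> and \<open>A\<close> near the
turning point by their amplitudes inside the well. These bounds come from the energy identity
\<open>(h\<^sup>2 y'\<^sup>2 + W y\<^sup>2)' = W' y\<^sup>2\<close>, since \<open>W'\<close> is positive there (\<open>airy_comparison\<close>). No asymptotics of the
Airy function enters: \<open>A\<close> is any solution that vanishes at \<open>\<zeta> = - c\<close>, and all that matters is that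
its phase at \<open>\<zeta> = c\<close> depends on \<open>c\<close> and \<open>h\<close> alone. Let \<open>\<theta>(c, h)\<close> be this phase minus the action.

To identify \<open>\<theta>(c, h)\<close>, apply the same comparison to the harmonic oscillator \<open>v = x\<^sup>2\<close> at the energy
\<open>h (2n + 1)\<close> nearest below 1. Its Hermite function has a known parity, so that its angle at \<open>0\<close> is a
multiple of \<open>\<pi>/2\<close>, and the action of the half well is exactly \<open>\<pi> h (2n + 1) / 4\<close>. Hence
\<open>\<theta>(c, h) = \<pi>/4 + O(h)\<close> modulo \<open>\<pi>\<close> (\<open>airy_phase_near_quarter_pi\<close>).
\<close>

section \<open>Phases and Liouville-Green transport\<close>

lemma nondecreasing_if_DERIV_nonneg:
  fixes f f' :: "real \<Rightarrow> real"
  assumes "a \<le> b" "\<And>x. a \<le> x \<Longrightarrow> x \<le> b \<Longrightarrow> (f has_real_derivative f' x) (at x)"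
    "\<And>x. a \<le> x \<Longrightarrow> x \<le> b \<Longrightarrow> 0 \<le> f' x"
  shows "f a \<le> f b"
  using assms by (intro DERIV_nonneg_imp_nondecreasing[of a b f]) auto

text \<open>The Liouville-Green amplitude \<open>w\<^bsup>-1/4\<^esup>\<close>. The powers of \<open>w\<close> in the approximation are integer powers of it, which keeps the algebra rational.\<close>

definition wkb_amp :: "real \<Rightarrow> real" where
  "wkb_amp w = exp (- ln w / 4)"

lemma wkb_amp_pos [simp]: "wkb_amp w > 0"
  by (simp add: wkb_amp_def)

lemma wkb_amp_power4: "w > 0 \<Longrightarrow> wkb_amp w ^ 4 * w = 1"
  by (simp add: wkb_amp_def exp_of_nat_mult [symmetric] exp_minus field_simps)

lemma sqrt_eq_amp: "w > 0 \<Longrightarrow> sqrt w = 1 / wkb_amp w ^ 2"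
proof -
  assume w: "w > 0"
  have "(1 / wkb_amp w ^ 2)\<^sup>2 = 1 / wkb_amp w ^ 4"
    by (simp add: power_divide)
  also have "\<dots> = w"
    using wkb_amp_power4[OF w] wkb_amp_pos[of w] by (intro divide_eq_imp) (auto simp: mult.commute)
  finally have "(1 / wkb_amp w ^ 2)\<^sup>2 = w" .
  moreover have "1 / wkb_amp w ^ 2 \<ge> 0" by simp
  ultimately show ?thesis by (metis real_sqrt_abs abs_of_nonneg)
qed

lemma wkb_amp_antimono: "0 < w \<Longrightarrow> w \<le> w' \<Longrightarrow> wkb_amp w' \<le> wkb_amp w"
  by (simp add: wkb_amp_def)

lemma DERIV_amp:
  assumes "(W has_real_derivative W1) (at x)" "W x > 0"
  shows "((\<lambda>x. wkb_amp (W x)) has_real_derivative (- W1 / 4 * wkb_amp (W x) ^ 5)) (at x)"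
proof -
  have e: "1 / W x = wkb_amp (W x) ^ 4"
    using wkb_amp_power4[OF assms(2)] assms(2) by (simp add: field_simps)
  have "((\<lambda>x. exp (- ln (W x) / 4)) has_real_derivative
         (exp (- ln (W x) / 4) * (- (1 / W x * W1) / 4))) (at x)"
    by (rule derivative_eq_intros assms refl | simp add: assms)+
  also have "exp (- ln (W x) / 4) * (- (1 / W x * W1) / 4) = - W1 / 4 * wkb_amp (W x) ^ 5"
    unfolding e wkb_amp_def[symmetric] by (simp add: eval_nat_numeral)
  finally show ?thesis by (simp add: wkb_amp_def)
qed

text \<open>The polar angle of the point \<open>(b, s)\<close> of the plane lies within about \<open>e\<close> of \<open>\<alpha>\<close> modulo \<open>\<pi>\<close>.
Working modulo \<open>\<pi>\<close> removes the arbitrary sign of a real solution, and the formulation by a linear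
form spares the choice of a branch of the angle.\<close>

definition phase_near :: "real \<Rightarrow> real \<Rightarrow> real \<Rightarrow> real \<Rightarrow> bool" where
  "phase_near e \<alpha> s b \<longleftrightarrow> \<bar>s * cos \<alpha> - b * sin \<alpha>\<bar> \<le> e * sqrt (s\<^sup>2 + b\<^sup>2)"

lemma abs_inner_cos_sin_le: "\<bar>s * cos \<alpha> + b * sin \<alpha>\<bar> \<le> sqrt (s\<^sup>2 + b\<^sup>2)" for s b \<alpha> :: real
proof (rule real_le_rsqrt)
  have "(s * c + b * d)\<^sup>2 + (s * d - b * c)\<^sup>2 = (s\<^sup>2 + b\<^sup>2) * (c\<^sup>2 + d\<^sup>2)" for c d :: real
    by (simp add: power2_eq_square algebra_simps)
  from this[of "cos \<alpha>" "sin \<alpha>"]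
  have "(s * cos \<alpha> + b * sin \<alpha>)\<^sup>2 + (s * sin \<alpha> - b * cos \<alpha>)\<^sup>2 = s\<^sup>2 + b\<^sup>2"
    by (simp only: sin_cos_squared_add2 mult_1_right)
  then have "(s * cos \<alpha> + b * sin \<alpha>)\<^sup>2 \<le> s\<^sup>2 + b\<^sup>2"
    using zero_le_power2[of "s * sin \<alpha> - b * cos \<alpha>"] by linarith
  then show "\<bar>s * cos \<alpha> + b * sin \<alpha>\<bar>\<^sup>2 \<le> s\<^sup>2 + b\<^sup>2" by simp
qed

text \<open>The difference of two linear forms that are small at the same nonzero vector is controlled by the
sine of the angle between them.\<close>

lemma phase_near_unique:
  assumes "phase_near e \<alpha> s b" "phase_near e' \<beta> s b" "s\<^sup>2 + b\<^sup>2 \<noteq> 0"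
  shows "\<bar>sin (\<alpha> - \<beta>)\<bar> \<le> e + e'"
proof -
  define \<rho> where "\<rho> = sqrt (s\<^sup>2 + b\<^sup>2)"
  have \<rho>: "\<rho> > 0" "\<rho>\<^sup>2 = s\<^sup>2 + b\<^sup>2"
    using assms(3) by (auto simp: \<rho>_def sum_power2_gt_zero_iff)
  define A where "A = s * cos \<alpha> - b * sin \<alpha>"
  define B where "B = s * cos \<beta> - b * sin \<beta>"
  have "\<rho>\<^sup>2 * sin (\<alpha> - \<beta>) = B * (s * sin \<alpha> + b * cos \<alpha>) - A * (s * sin \<beta> + b * cos \<beta>)"
  proof -
    have "B * (s * sin \<alpha> + b * cos \<alpha>) - A * (s * sin \<beta> + b * cos \<beta>)
      = (s\<^sup>2 + b\<^sup>2) * (sin \<alpha> * cos \<beta> - cos \<alpha> * sin \<beta>)"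
      unfolding A_def B_def by (simp add: algebra_simps power2_eq_square)
    then show ?thesis unfolding \<rho>(2) sin_diff by (rule sym)
  qed
  also have "\<bar>\<dots>\<bar> \<le> \<bar>B\<bar> * \<bar>s * sin \<alpha> + b * cos \<alpha>\<bar> + \<bar>A\<bar> * \<bar>s * sin \<beta> + b * cos \<beta>\<bar>"
    by (metis abs_mult abs_triangle_ineq4)
  also have "\<dots> \<le> (e' * \<rho>) * \<rho> + (e * \<rho>) * \<rho>"
  proof (intro add_mono mult_mono)
    show "\<bar>B\<bar> \<le> e' * \<rho>" "\<bar>A\<bar> \<le> e * \<rho>"
      using assms(1,2) by (auto simp: phase_near_def A_def B_def \<rho>_def)
    then show "0 \<le> e' * \<rho>" "0 \<le> e * \<rho>" by linarith+
    show "\<bar>s * sin \<alpha> + b * cos \<alpha>\<bar> \<le> \<rho>" "\<bar>s * sin \<beta> + b * cos \<beta>\<bar> \<le> \<rho>"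
      using abs_inner_cos_sin_le[of b \<alpha> s] abs_inner_cos_sin_le[of b \<beta> s]
      by (simp_all add: \<rho>_def add.commute)
  qed auto
  finally have "\<rho>\<^sup>2 * \<bar>sin (\<alpha> - \<beta>)\<bar> \<le> \<rho>\<^sup>2 * (e + e')"
    by (simp add: abs_mult algebra_simps power2_eq_square)
  then show ?thesis using \<rho>(1) by simp
qed

lemma phase_near_shift:
  assumes "phase_near e \<alpha> s b" "\<bar>sin (\<alpha> - \<beta>)\<bar> \<le> e'"
  shows "phase_near (e + e') \<beta> s b"
proof -
  define \<rho> where "\<rho> = sqrt (s\<^sup>2 + b\<^sup>2)"
  have "\<rho> \<ge> 0" by (simp add: \<rho>_def)
  have "s * cos \<beta> - b * sin \<beta> = (s * cos \<alpha> - b * sin \<alpha>) * cos (\<alpha> - \<beta>)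
      + (b * cos \<alpha> + s * sin \<alpha>) * sin (\<alpha> - \<beta>)"
  proof -
    have "cos \<beta> = cos \<alpha> * cos (\<alpha> - \<beta>) + sin \<alpha> * sin (\<alpha> - \<beta>)"
      "sin \<beta> = sin \<alpha> * cos (\<alpha> - \<beta>) - cos \<alpha> * sin (\<alpha> - \<beta>)"
      using cos_diff[of \<alpha> "\<alpha> - \<beta>"] sin_diff[of \<alpha> "\<alpha> - \<beta>"] by simp_all
    moreover have "s * (p * c + q * d) - b * (q * c - p * d) = (s * p - b * q) * c + (b * p + s * q) * d"
      for p q c d :: real by (simp add: algebra_simps)
    ultimately show ?thesis by metis
  qed
  also have "\<bar>\<dots>\<bar> \<le> \<bar>s * cos \<alpha> - b * sin \<alpha>\<bar> * \<bar>cos (\<alpha> - \<beta>)\<bar>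
      + \<bar>b * cos \<alpha> + s * sin \<alpha>\<bar> * \<bar>sin (\<alpha> - \<beta>)\<bar>"
    by (metis abs_mult abs_triangle_ineq)
  also have "\<dots> \<le> (e * \<rho>) * 1 + \<rho> * e'"
    using assms abs_inner_cos_sin_le[of b \<alpha> s] \<open>\<rho> \<ge> 0\<close>
    by (intro add_mono mult_mono) (auto simp: phase_near_def \<rho>_def add.commute)
  finally show ?thesis by (simp add: phase_near_def \<rho>_def algebra_simps)
qed

text \<open>With \<open>u = W\<^bsup>1/4\<^esup> y\<close> and \<open>b = h W\<^bsup>-1/2\<^esup> u'\<close>, the equation becomes a rotation
\<open>u' = b W\<^bsup>1/2\<^esup> / h\<close>, \<open>b' = - u W\<^bsup>1/2\<^esup> / h + h \<kappa> u\<close>, where \<open>\<kappa>\<close> is built from \<open>W\<close> and its first two derivatives.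
Using \<open>b\<close> instead of the simpler \<open>h W\<^bsup>-1/4\<^esup> y'\<close> makes the error term \<open>O(h)\<close> at once, without an
integration by parts.\<close>

lemma wkb_transport:
  fixes W W1 W2 S y y1 :: "real \<Rightarrow> real" and h :: real
  defines "u \<equiv> \<lambda>x. y x / wkb_amp (W x)"
    and "b \<equiv> \<lambda>x. h * (wkb_amp (W x) * y1 x + W1 x / 4 * wkb_amp (W x) ^ 5 * y x)"
  assumes pm: "p \<le> m" "m - p \<le> l" and h: "0 < h" "h \<le> 1" and K: "0 \<le> K" and C: "0 \<le> C"
    and Wpos: "\<And>x. x \<in> {p..m} \<Longrightarrow> W x > 0"
    and dW: "\<And>x. x \<in> {p..m} \<Longrightarrow> (W has_real_derivative W1 x) (at x)"
    and dW1: "\<And>x. x \<in> {p..m} \<Longrightarrow> (W1 has_real_derivative W2 x) (at x)"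
    and dS: "\<And>x. x \<in> {p..m} \<Longrightarrow> (S has_real_derivative sqrt (W x)) (at x)"
    and dy: "\<And>x. x \<in> {p..m} \<Longrightarrow> (y has_real_derivative y1 x) (at x)"
    and dy1: "\<And>x. x \<in> {p..m} \<Longrightarrow> (y1 has_real_derivative (- W x / h\<^sup>2 * y x)) (at x)"
    and K_bound: "\<And>x. x \<in> {p..m} \<Longrightarrow>
        \<bar>W2 x / 4 * wkb_amp (W x) ^ 6 - 5 / 16 * (W1 x)\<^sup>2 * wkb_amp (W x) ^ 10\<bar> \<le> K"
    and start: "phase_near (C * h) (S p / h + \<theta>) (u p) (b p)"
  shows "phase_near ((C + K * l) * exp (K * l / 2) * h) (S m / h + \<theta>) (u m) (b m)"
proof -
  define \<kappa> where "\<kappa> = (\<lambda>x. W2 x / 4 * wkb_amp (W x) ^ 6 - 5 / 16 * (W1 x)\<^sup>2 * wkb_amp (W x) ^ 10)"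
  define r where "r = (\<lambda>x. wkb_amp (W x))"
  have u_r: "u = (\<lambda>x. y x / r x)"
    and b_r: "b = (\<lambda>x. h * (r x * y1 x + W1 x / 4 * r x ^ 5 * y x))"
    and \<kappa>_r: "\<kappa> = (\<lambda>x. W2 x / 4 * r x ^ 6 - 5 / 16 * (W1 x)\<^sup>2 * r x ^ 10)"
    by (simp_all add: u_def b_def \<kappa>_def r_def)
  have rpos: "r x > 0" for x by (simp add: r_def)
  have r4: "r x ^ 4 * W x = 1" if "x \<in> {p..m}" for x
    using wkb_amp_power4[OF Wpos[OF that]] by (simp add: r_def)
  have dr: "(r has_real_derivative (- W1 x / 4 * r x ^ 5)) (at x)" if "x \<in> {p..m}" for x
    unfolding r_def by (rule DERIV_amp[OF dW[OF that] Wpos[OF that]])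
  have dS': "(S has_real_derivative (1 / r x ^ 2)) (at x)" if "x \<in> {p..m}" for x
    using dS[OF that] sqrt_eq_amp[OF Wpos[OF that]] by (simp add: r_def)
  have du: "(u has_real_derivative (b x / (h * r x ^ 2))) (at x)" if "x \<in> {p..m}" for x
  proof -
    have "(u has_real_derivative ((y1 x * r x - y x * (- W1 x / 4 * r x ^ 5)) / (r x * r x))) (at x)"
      unfolding u_r
      by (rule DERIV_divide[OF dy[OF that] dr[OF that]]) (use rpos[of x] in simp)
    also have "(y1 x * r x - y x * (- W1 x / 4 * r x ^ 5)) / (r x * r x) = b x / (h * r x ^ 2)"
    proof -
      have "(y1 x * r x - y x * (- W1 x / 4 * r x ^ 5)) * (h * r x ^ 2)
          = h * (r x * y1 x + W1 x / 4 * r x ^ 5 * y x) * (r x * r x)"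
        by (simp add: algebra_simps eval_nat_numeral)
      then show ?thesis unfolding b_r by (subst frac_eq_eq) (use h rpos[of x] in auto)
    qed
    finally show ?thesis .
  qed
  have db: "(b has_real_derivative (- u x / (h * r x ^ 2) + h * \<kappa> x * u x)) (at x)"
    if x: "x \<in> {p..m}" for x
  proof -
    have W: "W x = 1 / r x ^ 4" using r4[OF x] rpos[of x] by (simp add: field_simps)
    have "(b has_real_derivative (h * ((- W1 x / 4 * r x ^ 5) * y1 x + (- W x / h\<^sup>2 * y x) * r x
        + ((W2 x / 4 * r x ^ 5 + (5 * r x ^ 4 * (- W1 x / 4 * r x ^ 5)) * (W1 x / 4)) * y x
        + y1 x * (W1 x / 4 * r x ^ 5))))) (at x)"
      unfolding b_r
      by (auto intro!: derivative_eq_intros dy[OF x] dy1[OF x] dr[OF x] dW1[OF x] simp: field_simps)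
    also have "h * ((- W1 x / 4 * r x ^ 5) * y1 x + (- W x / h\<^sup>2 * y x) * r x
        + ((W2 x / 4 * r x ^ 5 + (5 * r x ^ 4 * (- W1 x / 4 * r x ^ 5)) * (W1 x / 4)) * y x
        + y1 x * (W1 x / 4 * r x ^ 5))) = - u x / (h * r x ^ 2) + h * \<kappa> x * u x"
    proof -
      have nz: "r x \<noteq> 0" "h \<noteq> 0" using h rpos[of x] by auto
      have e: "1 / r x^4 / h\<^sup>2 * y x * r x * h = y x/r x / (h * r x ^ 2)" using nz by (simp add: divide_simps eval_nat_numeral)
      have e2: "r x^6 * (y x/r x) = r x^5 * y x" "r x^10 * (y x/r x) = r x^9*y x" using nz by (simp_all add: divide_simps eval_nat_numeral)
      have "h * (W2 x / 4 * r x ^ 6 - 5 / 16 * (W1 x)\<^sup>2 * r x ^ 10) * (y x/r x) = h * (W2 x / 4 * (r x ^ 6 * (y x/r x)) - 5 / 16 * (W1 x)\<^sup>2 * (r x ^ 10 * (y x/r x)))"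
        by (simp only: algebra_simps)
      also have "\<dots> = h * (W2 x / 4 * (r x^5 * y x) - 5 / 16 * (W1 x)\<^sup>2 * (r x^9*y x))" unfolding e2 ..
      finally have e3: "h * (W2 x / 4 * r x ^ 6 - 5 / 16 * (W1 x)\<^sup>2 * r x ^ 10) * (y x/r x) = h * (W2 x / 4 * (r x^5 * y x) - 5 / 16 * (W1 x)\<^sup>2 * (r x^9*y x))" .
      have "h * ((- W1 x / 4 * r x ^ 5) * y1 x + (- (1 / r x^4) / h\<^sup>2 * y x) * r x
            + ((W2 x / 4 * r x ^ 5 + (5 * r x ^ 4 * (- W1 x / 4 * r x ^ 5)) * (W1 x / 4)) * y x
            + y1 x * (W1 x / 4 * r x ^ 5))) = - (1 / r x^4 / h\<^sup>2 * y x * r x * h) + h * (W2 x / 4 * (r x^5 * y x) - 5 / 16 * (W1 x)\<^sup>2 * (r x^9*y x))"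
        by (simp add: algebra_simps power2_eq_square eval_nat_numeral)
      then show ?thesis unfolding u_r \<kappa>_r W using e e3 by simp
    qed
    finally show ?thesis .
  qed
  define E where "E = (\<lambda>x. (u x)\<^sup>2 + (b x)\<^sup>2)"
  have dE: "(E has_real_derivative (2 * h * \<kappa> x * u x * b x)) (at x)" if x: "x \<in> {p..m}" for x
    unfolding E_def
    by (auto intro!: derivative_eq_intros du[OF x] db[OF x] simp: algebra_simps power2_eq_square)
  \<comment> \<open>The matrix of the system differs from a rotation by \<open>h \<kappa>\<close>, so the squared length changes at rate at most \<open>K\<close>.\<close>
  have E_le: "E x \<le> E m * exp (K * l)" if x: "x \<in> {p..m}" for x
  proof -
    have "E x * exp (K * x) \<le> E m * exp (K * m)"
    proof (rule nondecreasing_if_DERIV_nonneg[where f = "\<lambda>x. E x * exp (K * x)"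
          and f' = "\<lambda>t. (2 * h * \<kappa> t * u t * b t + K * E t) * exp (K * t)"])
      show "x \<le> m" using x by simp
      fix t assume t: "x \<le> t" "t \<le> m"
      then have t': "t \<in> {p..m}" using x by auto
      have "\<bar>2 * h * \<kappa> t * u t * b t\<bar> = h * \<bar>\<kappa> t\<bar> * \<bar>2 * u t * b t\<bar>"
        using h by (simp add: abs_mult)
      also have "\<dots> \<le> 1 * K * E t"
      proof (intro mult_mono)
        show "\<bar>2 * u t * b t\<bar> \<le> E t"
          using sum_squares_bound[of "\<bar>u t\<bar>" "\<bar>b t\<bar>"] by (simp add: E_def abs_mult)
      qed (use K_bound[OF t'] h K in \<open>auto simp: \<kappa>_def\<close>)
      finally have nn: "2 * h * \<kappa> t * u t * b t + K * E t \<ge> 0" by linarith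
      then show "0 \<le> (2 * h * \<kappa> t * u t * b t + K * E t) * exp (K * t)" by simp
      show "((\<lambda>x. E x * exp (K * x)) has_real_derivative
          ((2 * h * \<kappa> t * u t * b t + K * E t) * exp (K * t))) (at t)"
        by (auto intro!: derivative_eq_intros dE[OF t'] simp: algebra_simps)
    qed
    also have "exp (K * m) = exp (K * (m - x)) * exp (K * x)"
      by (simp add: exp_add[symmetric] algebra_simps)
    finally have "E x \<le> E m * exp (K * (m - x))" by (simp flip: mult.assoc)
    also have "\<dots> \<le> E m * exp (K * l)"
      using x pm K by (intro mult_left_mono) (auto simp: E_def intro!: mult_left_mono)
    finally show ?thesis .
  qed
  define \<rho> where "\<rho> = sqrt (E m)"
  have sq: "sqrt (E x) \<le> exp (K * l / 2) * \<rho>" if "x \<in> {p..m}" for x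
  proof -
    have "sqrt (E x) \<le> sqrt (E m * exp (K * l))" using E_le[OF that] by simp
    also have "\<dots> = exp (K * l / 2) * \<rho>"
    proof -
      have "exp (K * l) = (exp (K * l / 2))\<^sup>2" by (simp add: exp_double[symmetric])
      then show ?thesis by (simp add: real_sqrt_mult \<rho>_def)
    qed
    finally show ?thesis .
  qed
  define Q where "Q = (\<lambda>x. u x * cos (S x / h + \<theta>) - b x * sin (S x / h + \<theta>))"
  have dQ: "(Q has_real_derivative (- h * \<kappa> x * u x * sin (S x / h + \<theta>))) (at x)"
    if x: "x \<in> {p..m}" for x
    unfolding Q_def
    using h by (auto intro!: derivative_eq_intros du[OF x] db[OF x] dS'[OF x] simp: algebra_simps)
  have Qp: "\<bar>Q p\<bar> \<le> C * h * (exp (K * l / 2) * \<rho>)"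
  proof -
    have "\<bar>Q p\<bar> \<le> C * h * sqrt (E p)"
      using start by (simp add: phase_near_def Q_def E_def)
    also have "\<dots> \<le> C * h * (exp (K * l / 2) * \<rho>)"
      using sq[of p] pm C h by (intro mult_left_mono) auto
    finally show ?thesis .
  qed
  have "\<bar>Q m - Q p\<bar> \<le> l * (h * K * (exp (K * l / 2) * \<rho>))"
  proof (cases "p = m")
    case True
    have "0 \<le> l" using pm by linarith
    then show ?thesis using True h K by (auto simp: \<rho>_def E_def)
  next
    case False
    then have "p < m" using pm by simp
    then obtain z where z: "p < z" "z < m"
      "Q m - Q p = (m - p) * (- h * \<kappa> z * u z * sin (S z / h + \<theta>))"
      using MVT2[of p m Q "\<lambda>x. - h * \<kappa> x * u x * sin (S x / h + \<theta>)"] dQ by auto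
    have z': "z \<in> {p..m}" using z by auto
    define q where "q = \<bar>u z\<bar> * \<bar>sin (S z / h + \<theta>)\<bar>"
    have "q \<le> \<bar>u z\<bar>" by (simp add: q_def mult_left_le)
    also have "\<dots> \<le> sqrt (E z)" by (rule real_le_rsqrt) (simp add: E_def)
    also have "\<dots> \<le> exp (K * l / 2) * \<rho>" by (rule sq[OF z'])
    finally have q: "q \<le> exp (K * l / 2) * \<rho>" "q \<ge> 0" by (simp_all add: q_def)
    have \<kappa>z: "\<bar>\<kappa> z\<bar> \<le> K" using K_bound[OF z'] by (simp add: \<kappa>_def)
    have "\<bar>Q m - Q p\<bar> = (m - p) * (h * \<bar>\<kappa> z\<bar> * q)"
      unfolding z(3) q_def using h \<open>p < m\<close> by (simp add: abs_mult)
    also have "\<dots> \<le> l * (h * K * (exp (K * l / 2) * \<rho>))"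
      using h K pm q \<kappa>z \<open>p < m\<close> by (intro mult_mono) auto
    finally show ?thesis .
  qed
  with Qp have "\<bar>Q m\<bar> \<le> C * h * (exp (K * l / 2) * \<rho>) + l * (h * K * (exp (K * l / 2) * \<rho>))"
    by linarith
  also have "\<dots> = ((C + K * l) * exp (K * l / 2) * h) * \<rho>"
    by (simp add: algebra_simps)
  finally show ?thesis
    by (simp add: phase_near_def Q_def \<rho>_def E_def)
qed

section \<open>Langer's change of variable at a simple turning point\<close>

text \<open>For \<open>f = g\<close>, \<open>k = e = 2\<close> this is \<open>\<integral>\<^bsub>0\<^esub>\<^bsup>s\<^esup> \<sigma>\<^bsup>1/2\<^esup> g(\<sigma>) d\<sigma> / (2 s\<^bsup>3/2\<^esup>)\<close> after the substitution \<open>\<sigma> = s t\<^sup>2\<close>,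
which is smooth across \<open>s = 0\<close>. For \<open>k = 0\<close>, \<open>e = 1\<close> it is the mean of \<open>f\<close> over \<open>[0, s]\<close>.\<close>

definition avg :: "nat \<Rightarrow> nat \<Rightarrow> (real \<Rightarrow> real) \<Rightarrow> real \<Rightarrow> real" where
  "avg k e f s = integral {0..1} (\<lambda>t. t ^ k * f (s * t ^ e))"

lemma abs_mult_power_less:
  fixes s t d :: real
  assumes "\<bar>s\<bar> < d" "t \<in> {0..1}"
  shows "\<bar>s * t ^ e\<bar> < d"
proof -
  have "\<bar>t ^ e\<bar> \<le> 1" using assms by (auto simp: power_abs[symmetric] power_le_one)
  then have "\<bar>s * t ^ e\<bar> \<le> \<bar>s\<bar>" by (simp add: abs_mult mult_left_le)
  with assms show ?thesis by simp
qed

lemma continuous_on_avg_integrand: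
  fixes f :: "real \<Rightarrow> real"
  assumes "continuous_on {-d<..<d} f" "\<bar>s\<bar> < d"
  shows "continuous_on {0..1} (\<lambda>t. t ^ k * f (s * t ^ e))"
proof -
  have "(\<lambda>t. s * t ^ e) ` {0..1} \<subseteq> {-d<..<d}"
  proof
    fix z assume "z \<in> (\<lambda>t. s * t ^ e) ` {0..1}"
    then obtain t where "t \<in> {0..1}" "z = s * t ^ e" by auto
    then show "z \<in> {-d<..<d}" using abs_mult_power_less[OF assms(2), of t e] by (simp add: abs_less_iff)
  qed
  then show ?thesis
    by (intro continuous_intros continuous_on_compose2[OF assms(1)]) auto
qed

lemma continuous_on_avg_integrand_param:
  fixes f :: "real \<Rightarrow> real"
  assumes "continuous_on {-d<..<d} f"
  shows "continuous_on ({-d<..<d} \<times> cbox 0 1) (\<lambda>(s, t). t ^ k * f (s * t ^ e))"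
proof -
  have "(\<lambda>(x, t). x * t ^ e) ` ({-d<..<d} \<times> {0..1}) \<subseteq> {-d<..<d}"
  proof
    fix z assume "z \<in> (\<lambda>(x, t). x * t ^ e) ` ({-d<..<d} \<times> {0..1})"
    then obtain x t where "x \<in> {-d<..<d}" "t \<in> {0..1}" "z = x * t ^ e" by auto
    then show "z \<in> {-d<..<d}" using abs_mult_power_less[of x d t e] by (auto simp: abs_less_iff)
  qed
  then have "continuous_on ({-d<..<d} \<times> {0..1}) (\<lambda>z. f ((\<lambda>(x, t). x * t ^ e) z))"
    by (intro continuous_on_compose2[OF assms]) (auto intro!: continuous_intros simp: case_prod_unfold)
  then show ?thesis
    by (auto intro!: continuous_intros simp: case_prod_unfold)
qed

lemma continuous_on_avg:
  fixes f :: "real \<Rightarrow> real"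
  assumes "continuous_on {-d<..<d} f"
  shows "continuous_on {-d<..<d} (avg k e f)"
  using integral_continuous_on_param[OF continuous_on_avg_integrand_param[OF assms, of k e]]
  by (simp add: avg_def[abs_def])

lemma DERIV_avg:
  fixes f f' :: "real \<Rightarrow> real"
  assumes df: "\<And>x. \<bar>x\<bar> < d \<Longrightarrow> (f has_real_derivative f' x) (at x)"
    and cf': "continuous_on {-d<..<d} f'" and s: "\<bar>s\<bar> < d"
  shows "(avg k e f has_real_derivative avg (k + e) e f' s) (at s)"
proof -
  let ?U = "{-d<..<d}"
  have cf: "continuous_on ?U f"
    by (intro continuous_at_imp_continuous_on ballI DERIV_isCont[OF df]) auto
  have "((\<lambda>x. integral (cbox 0 1) (\<lambda>t. t ^ k * f (x * t ^ e))) has_field_derivative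
      integral (cbox 0 1) (\<lambda>t. t ^ (k + e) * f' (s * t ^ e))) (at s within ?U)"
  proof (rule leibniz_rule_field_derivative)
    fix x t assume xt: "x \<in> ?U" "t \<in> cbox (0::real) 1"
    then have "\<bar>x * t ^ e\<bar> < d" by (intro abs_mult_power_less) auto
    then have "((\<lambda>x. f (x * t ^ e)) has_field_derivative (f' (x * t ^ e) * t ^ e)) (at x)"
      by (intro DERIV_chain2[OF df]) (auto intro!: derivative_eq_intros)
    then have "((\<lambda>x. t ^ k * f (x * t ^ e)) has_field_derivative (t ^ k * (f' (x * t ^ e) * t ^ e))) (at x)"
      by (rule DERIV_cmult)
    then have "((\<lambda>x. t ^ k * f (x * t ^ e)) has_field_derivative (t ^ (k + e) * f' (x * t ^ e))) (at x)"
      by (simp add: power_add mult.assoc mult.left_commute mult.commute)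
    then show "((\<lambda>x. t ^ k * f (x * t ^ e)) has_field_derivative (t ^ (k + e) * f' (x * t ^ e))) (at x within ?U)"
      by (rule has_field_derivative_at_within)
  next
    fix x assume "x \<in> ?U"
    then show "(\<lambda>t. t ^ k * f (x * t ^ e)) integrable_on cbox 0 1"
      using continuous_on_avg_integrand[OF cf, of x k e]
      by (auto intro!: integrable_continuous_interval simp: abs_less_iff)
  next
    show "continuous_on (?U \<times> cbox 0 1) (\<lambda>(x, t). t ^ (k + e) * f' (x * t ^ e))"
      by (rule continuous_on_avg_integrand_param[OF cf'])
  qed (use s in auto)
  then show ?thesis
    using s by (simp add: avg_def[abs_def] at_within_open[of s ?U] abs_less_iff)
qed

lemma avg_bounds:
  fixes f :: "real \<Rightarrow> real"
  assumes "continuous_on {-d<..<d} f" "\<bar>s\<bar> < d" "\<And>x. \<bar>x\<bar> < d \<Longrightarrow> lo \<le> f x \<and> f x \<le> hi"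
  shows "lo / real (Suc k) \<le> avg k e f s" "avg k e f s \<le> hi / real (Suc k)"
proof -
  have int: "(\<lambda>t. t ^ k * f (s * t ^ e)) integrable_on {0..1}"
    using continuous_on_avg_integrand[OF assms(1,2)] by (intro integrable_continuous_interval)
  have pw: "((\<lambda>t. t ^ k * c) has_integral (c / real (Suc k))) {0..1}" for c :: real
  proof -
    define a where "a = c / real (Suc k)"
    have "((\<lambda>t. t ^ k * c) has_integral (1 ^ Suc k * a - 0 ^ Suc k * a)) {0..1}"
    proof (rule fundamental_theorem_of_calculus[where f = "\<lambda>t. t ^ Suc k * a"])
      fix t :: real assume "t \<in> {0..1}"
      have "((\<lambda>t. t ^ Suc k * a) has_real_derivative (real (Suc k) * t ^ (Suc k - Suc 0) * a)) (at t within {0..1})"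
        by (intro DERIV_cmult_right DERIV_pow)
      moreover have "real (Suc k) * t ^ (Suc k - Suc 0) * a = t ^ k * c" by (simp add: a_def)
      ultimately show "((\<lambda>t. t ^ Suc k * a) has_vector_derivative t ^ k * c) (at t within {0..1})"
        by (simp only: has_real_derivative_iff_has_vector_derivative)
    qed simp
    then show ?thesis by (simp add: a_def)
  qed
  have b: "t ^ k * lo \<le> t ^ k * f (s * t ^ e)" "t ^ k * f (s * t ^ e) \<le> t ^ k * hi" if "t \<in> {0..1}" for t
    using assms(3)[OF abs_mult_power_less[OF assms(2) that, of e]] that by (auto intro!: mult_left_mono)
  show "lo / real (Suc k) \<le> avg k e f s"
    unfolding avg_def using has_integral_le[OF pw[of lo] integrable_integral[OF int]] b(1) by blast
  show "avg k e f s \<le> hi / real (Suc k)"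
    unfolding avg_def using has_integral_le[OF integrable_integral[OF int] pw[of hi]] b(2) by blast
qed

lemma avg_abs_bound:
  fixes f :: "real \<Rightarrow> real"
  assumes "continuous_on {-d<..<d} f" "\<bar>s\<bar> < d" "\<And>x. \<bar>x\<bar> < d \<Longrightarrow> \<bar>f x\<bar> \<le> M"
  shows "\<bar>avg k e f s\<bar> \<le> M"
proof -
  have "0 \<le> M" using assms(2) assms(3)[of s] by linarith
  then have "M / real (Suc k) \<le> M" by (simp add: field_simps)
  moreover have "- M \<le> f x \<and> f x \<le> M" if "\<bar>x\<bar> < d" for x
    using assms(3)[OF that] by (simp add: abs_le_iff)
  from avg_bounds[where k = k and e = e, OF assms(1,2) this]
  have "- M / real (Suc k) \<le> avg k e f s" "avg k e f s \<le> M / real (Suc k)" by simp_all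
  ultimately show ?thesis by (simp add: abs_le_iff)
qed

lemma avg_0_1_antiderivative:
  fixes f f' :: "real \<Rightarrow> real"
  assumes df: "\<And>x. \<bar>x\<bar> < d \<Longrightarrow> (f has_real_derivative f' x) (at x)" and s: "\<bar>s\<bar> < d"
  shows "s * avg 0 1 f' s = f s - f 0"
proof -
  have "((\<lambda>t. s * f' (s * t)) has_integral (f (s * 1) - f (s * 0))) {0..1}"
  proof (rule fundamental_theorem_of_calculus[where f = "\<lambda>t. f (s * t)"])
    fix t assume "t \<in> {0..1::real}"
    then have "\<bar>s * t\<bar> < d" using abs_mult_power_less[OF s, of t 1] by simp
    then have "((\<lambda>t. f (s * t)) has_real_derivative (f' (s * t) * s)) (at t)"
      by (intro DERIV_chain2[OF df]) (auto intro!: derivative_eq_intros)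
    then have "((\<lambda>t. f (s * t)) has_real_derivative (s * f' (s * t))) (at t)"
      by (simp only: mult.commute)
    then show "((\<lambda>t. f (s * t)) has_vector_derivative (s * f' (s * t))) (at t within {0..1})"
      by (simp add: has_real_derivative_iff_has_vector_derivative has_vector_derivative_at_within)
  qed simp
  then have "integral {0..1} (\<lambda>t. s * f' (s * t)) = f s - f 0"
    by (intro integral_unique) simp
  also have "integral {0..1} (\<lambda>t. s * f' (s * t)) = s * integral {0..1} (\<lambda>t. f' (s * t))"
    by (rule integral_mult_right)
  finally show ?thesis by (simp add: avg_def)
qed

text \<open>This is the integral of the derivative of \<open>t\<^sup>3 g(s t\<^sup>2)\<close>. It replaces differentiation of
\<open>\<integral> \<sigma>\<^bsup>1/2\<^esup> g(\<sigma>) d\<sigma>\<close> with respect to the endpoint, and unlike the latter it is valid for \<open>s \<le> 0\<close> too.\<close>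

lemma avg_2_2_identity:
  fixes g g' :: "real \<Rightarrow> real"
  assumes dg: "\<And>x. \<bar>x\<bar> < d \<Longrightarrow> (g has_real_derivative g' x) (at x)"
    and cg': "continuous_on {-d<..<d} g'" and s: "\<bar>s\<bar> < d"
  shows "3 * avg 2 2 g s + 2 * s * avg 4 2 g' s = g s"
proof -
  have cg: "continuous_on {-d<..<d} g"
    by (intro continuous_at_imp_continuous_on ballI DERIV_isCont[OF dg]) auto
  have "((\<lambda>t. 3 * (t ^ 2 * g (s * t ^ 2)) + 2 * s * (t ^ 4 * g' (s * t ^ 2)))
      has_integral (1 ^ 3 * g (s * 1 ^ 2) - 0 ^ 3 * g (s * 0 ^ 2))) {0..1}"
  proof (rule fundamental_theorem_of_calculus[where f = "\<lambda>t. t ^ 3 * g (s * t ^ 2)"])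
    fix t assume "t \<in> {0..1::real}"
    then have "\<bar>s * t ^ 2\<bar> < d" using abs_mult_power_less[OF s, of t 2] by simp
    then have "((\<lambda>t. g (s * t ^ 2)) has_real_derivative (g' (s * t ^ 2) * (s * (2 * t)))) (at t)"
      by (intro DERIV_chain2[OF dg]) (auto intro!: derivative_eq_intros)
    then have "((\<lambda>t. t ^ 3 * g (s * t ^ 2)) has_real_derivative
        (3 * t ^ 2 * g (s * t ^ 2) + g' (s * t ^ 2) * (s * (2 * t)) * t ^ 3)) (at t)"
      by (intro DERIV_mult) (auto intro!: derivative_eq_intros)
    then have "((\<lambda>t. t ^ 3 * g (s * t ^ 2)) has_real_derivative
        (3 * (t ^ 2 * g (s * t ^ 2)) + 2 * s * (t ^ 4 * g' (s * t ^ 2)))) (at t)"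
      by (simp add: algebra_simps eval_nat_numeral)
    then show "((\<lambda>t. t ^ 3 * g (s * t ^ 2)) has_vector_derivative
        (3 * (t ^ 2 * g (s * t ^ 2)) + 2 * s * (t ^ 4 * g' (s * t ^ 2)))) (at t within {0..1})"
      by (simp add: has_real_derivative_iff_has_vector_derivative has_vector_derivative_at_within)
  qed simp
  then have 1: "((\<lambda>t. 3 * (t ^ 2 * g (s * t ^ 2)) + 2 * s * (t ^ 4 * g' (s * t ^ 2))) has_integral g s) {0..1}"
    by simp
  have "((\<lambda>t. 3 * (t ^ 2 * g (s * t ^ 2)) + 2 * s * (t ^ 4 * g' (s * t ^ 2)))
      has_integral (3 * avg 2 2 g s + 2 * s * avg 4 2 g' s)) {0..1}"
    unfolding avg_def
    by (intro has_integral_add has_integral_mult_right integrable_integral integrable_continuous_interval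
        continuous_on_avg_integrand[OF cg s] continuous_on_avg_integrand[OF cg' s])
  then show ?thesis
    using 1 by (rule has_integral_unique)
qed

text \<open>For \<open>W = s g(s)\<^sup>2\<close> Langer's variable satisfies \<open>(2/3) \<zeta>\<^bsup>3/2\<^esup> = \<integral>\<^bsub>0\<^esub>\<^bsup>s\<^esup> \<sigma>\<^bsup>1/2\<^esup> g(\<sigma>) d\<sigma>\<close>. Hence
\<open>\<zeta> = s J\<^bsup>2/3\<^esup>\<close>, where \<open>J(s) = \<integral>\<^bsub>0\<^esub>\<^bsup>1\<^esup> 3 t\<^sup>2 g(s t\<^sup>2) dt\<close> is as smooth as \<open>g\<close> and lies between the same positive
bounds, and \<open>\<phi> = \<zeta>'\<^bsup>-1/2\<^esup> = g\<^bsup>-1/2\<^esup> J\<^bsup>1/6\<^esup>\<close>. These formulas make sense on both sides of the turning point and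
give two derivatives of \<open>\<phi>\<close> from two derivatives of \<open>g\<close>.\<close>

lemma langer_map_of_sqrt:
  fixes g g1 g2 :: "real \<Rightarrow> real"
  assumes \<gamma>: "0 < \<gamma>" "\<gamma> \<le> \<Gamma>" and G: "0 \<le> G"
    and dg: "\<And>s. \<bar>s\<bar> < d \<Longrightarrow> (g has_real_derivative g1 s) (at s)"
    and dg1: "\<And>s. \<bar>s\<bar> < d \<Longrightarrow> (g1 has_real_derivative g2 s) (at s)"
    and cg2: "continuous_on {-d<..<d} g2"
    and gb: "\<And>s. \<bar>s\<bar> < d \<Longrightarrow> \<gamma> \<le> g s \<and> g s \<le> \<Gamma>"
    and g1b: "\<And>s. \<bar>s\<bar> < d \<Longrightarrow> \<bar>g1 s\<bar> \<le> G" and g2b: "\<And>s. \<bar>s\<bar> < d \<Longrightarrow> \<bar>g2 s\<bar> \<le> G"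
    and P: "P = G / \<gamma>" and P': "P' = (G * \<Gamma> + 2 * G\<^sup>2) / \<gamma>\<^sup>2"
    and lo: "lo = exp (- ln \<Gamma> / 2 + ln \<gamma> / 6)" and hi: "hi = exp (- ln \<gamma> / 2 + ln \<Gamma> / 6)"
  shows "\<exists>\<zeta> \<phi> \<phi>1 \<phi>2 :: real \<Rightarrow> real. \<zeta> 0 = 0 \<and> (\<forall>s. \<bar>s\<bar> < d \<longrightarrow>
      (\<zeta> has_real_derivative 1 / (\<phi> s)\<^sup>2) (at s) \<and> (\<phi> has_real_derivative \<phi>1 s) (at s) \<and>
      (\<phi>1 has_real_derivative \<phi>2 s) (at s) \<and> s * (g s)\<^sup>2 = \<zeta> s / \<phi> s ^ 4 \<and>
      lo \<le> \<phi> s \<and> \<phi> s \<le> hi \<and> \<bar>\<phi>1 s\<bar> \<le> hi * P \<and> \<bar>\<phi>2 s\<bar> \<le> hi * (P\<^sup>2 + P'))"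
proof -
  have cg: "continuous_on {-d<..<d} g" "continuous_on {-d<..<d} g1"
    by (intro continuous_at_imp_continuous_on ballI DERIV_isCont[OF dg] DERIV_isCont[OF dg1]; auto)+
  define J where "J = (\<lambda>s. 3 * avg 2 2 g s)"
  define J1 where "J1 = (\<lambda>s. 3 * avg 4 2 g1 s)"
  define J2 where "J2 = (\<lambda>s. 3 * avg 6 2 g2 s)"
  have dJ: "(J has_real_derivative J1 s) (at s)" if "\<bar>s\<bar> < d" for s
    unfolding J_def J1_def using DERIV_cmult[OF DERIV_avg[OF dg cg(2) that, of 2 2], of 3] by simp
  have dJ1: "(J1 has_real_derivative J2 s) (at s)" if "\<bar>s\<bar> < d" for s
    unfolding J1_def J2_def using DERIV_cmult[OF DERIV_avg[OF dg1 cg2 that, of 4 2], of 3] by simp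
  have Jb: "\<gamma> \<le> J s" "J s \<le> \<Gamma>" if "\<bar>s\<bar> < d" for s
    using avg_bounds[where k = 2 and e = 2, OF cg(1) that gb] by (simp_all add: J_def)
  have J1b: "\<bar>J1 s\<bar> \<le> 3 * G" "\<bar>J2 s\<bar> \<le> 3 * G" if "\<bar>s\<bar> < d" for s
    using avg_abs_bound[where k = 4 and e = 2, OF cg(2) that g1b]
      avg_abs_bound[where k = 6 and e = 2, OF cg2 that g2b] by (simp_all add: J1_def J2_def abs_mult)
  have Jg: "J s + 2 / 3 * (s * J1 s) = g s" if "\<bar>s\<bar> < d" for s
    using avg_2_2_identity[OF dg cg(2) that] by (simp add: J_def J1_def)
  have pos: "g s > 0" "J s > 0" if "\<bar>s\<bar> < d" for s
    using gb[OF that] Jb[OF that] \<gamma> by linarith+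
  define \<zeta> where "\<zeta> = (\<lambda>s. s * exp (2 / 3 * ln (J s)))"
  define \<phi> where "\<phi> = (\<lambda>s. exp (- ln (g s) / 2 + ln (J s) / 6))"
  define \<psi>1 where "\<psi>1 = (\<lambda>s. - g1 s / (2 * g s) + J1 s / (6 * J s))"
  define \<psi>2 where "\<psi>2 = (\<lambda>s. - (g2 s * g s - g1 s * g1 s) / (2 * (g s)\<^sup>2)
      + (J2 s * J s - J1 s * J1 s) / (6 * (J s)\<^sup>2))"
  have d\<zeta>: "(\<zeta> has_real_derivative 1 / (\<phi> s)\<^sup>2) (at s)" if s: "\<bar>s\<bar> < d" for s
  proof -
    have "(\<zeta> has_real_derivative (exp (2 / 3 * ln (J s)) + s * (exp (2 / 3 * ln (J s)) * (2 / 3 * (J1 s / J s))))) (at s)"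
      unfolding \<zeta>_def using pos[OF s] by (auto intro!: derivative_eq_intros dJ[OF s])
    also have "exp (2 / 3 * ln (J s)) + s * (exp (2 / 3 * ln (J s)) * (2 / 3 * (J1 s / J s)))
        = exp (2 / 3 * ln (J s)) / J s * (J s + 2 / 3 * (s * J1 s))"
      using pos[OF s] by (simp add: field_simps)
    also have "\<dots> = exp (2 / 3 * ln (J s)) / exp (ln (J s)) * exp (ln (g s))"
      unfolding Jg[OF s] using pos[OF s] by simp
    also have "\<dots> = exp (2 / 3 * ln (J s) - ln (J s) + ln (g s))"
      by (simp only: exp_add exp_diff)
    also have "\<dots> = exp (- (2 * (- ln (g s) / 2 + ln (J s) / 6)))"
      by (simp add: algebra_simps)
    also have "\<dots> = 1 / (\<phi> s)\<^sup>2"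
      unfolding \<phi>_def exp_minus exp_double by (simp add: inverse_eq_divide)
    finally show ?thesis .
  qed
  have d\<phi>: "(\<phi> has_real_derivative \<phi> s * \<psi>1 s) (at s)" if s: "\<bar>s\<bar> < d" for s
  proof -
    have "(\<phi> has_real_derivative (exp (- ln (g s) / 2 + ln (J s) / 6)
        * (- (g1 s / g s) / 2 + (J1 s / J s) / 6))) (at s)"
      unfolding \<phi>_def using pos[OF s] by (auto intro!: derivative_eq_intros dJ[OF s] dg[OF s])
    then show ?thesis by (simp add: \<phi>_def \<psi>1_def mult.commute)
  qed
  have d\<psi>1: "(\<psi>1 has_real_derivative \<psi>2 s) (at s)" if s: "\<bar>s\<bar> < d" for s
  proof -
    have "(\<psi>1 has_real_derivative
        (((- g2 s) * (2 * g s) - (- g1 s) * (2 * g1 s)) / ((2 * g s) * (2 * g s))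
        + (J2 s * (6 * J s) - J1 s * (6 * J1 s)) / ((6 * J s) * (6 * J s)))) (at s)"
      unfolding \<psi>1_def using pos[OF s]
      by (intro DERIV_add DERIV_divide DERIV_minus DERIV_cmult dJ dJ1 dg dg1 s) auto
    also have "((- g2 s) * (2 * g s) - (- g1 s) * (2 * g1 s)) / ((2 * g s) * (2 * g s))
        + (J2 s * (6 * J s) - J1 s * (6 * J1 s)) / ((6 * J s) * (6 * J s)) = \<psi>2 s"
    proof -
      have 1: "((- g2 s) * (2 * g s) - (- g1 s) * (2 * g1 s)) / ((2 * g s) * (2 * g s))
          = - (g2 s * g s - g1 s * g1 s) / (2 * (g s)\<^sup>2)"
        using pos[OF s] by (simp add: field_simps power2_eq_square)
      have 2: "(J2 s * (6 * J s) - J1 s * (6 * J1 s)) / ((6 * J s) * (6 * J s))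
          = (J2 s * J s - J1 s * J1 s) / (6 * (J s)\<^sup>2)"
        using pos[OF s] by (simp add: field_simps power2_eq_square)
      show ?thesis unfolding 1 2 \<psi>2_def ..
    qed
    finally show ?thesis .
  qed
  have d\<phi>1: "((\<lambda>s. \<phi> s * \<psi>1 s) has_real_derivative \<phi> s * ((\<psi>1 s)\<^sup>2 + \<psi>2 s)) (at s)" if s: "\<bar>s\<bar> < d" for s
    using DERIV_mult[OF d\<phi>[OF s] d\<psi>1[OF s]] by (simp add: algebra_simps power2_eq_square)
  have W: "s * (g s)\<^sup>2 = \<zeta> s / \<phi> s ^ 4" if s: "\<bar>s\<bar> < d" for s
  proof -
    have "\<phi> s ^ 4 = exp (2 / 3 * ln (J s)) / exp (2 * ln (g s))"
      by (simp add: \<phi>_def exp_of_nat_mult[symmetric] exp_diff[symmetric] algebra_simps)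
    also have "exp (2 * ln (g s)) = (g s)\<^sup>2"
      using pos[OF s] by (simp add: exp_double)
    finally show ?thesis by (simp add: \<zeta>_def)
  qed
  have \<phi>b: "lo \<le> \<phi> s" "\<phi> s \<le> hi" if s: "\<bar>s\<bar> < d" for s
  proof -
    have "ln \<gamma> \<le> ln (g s)" "ln (g s) \<le> ln \<Gamma>" "ln \<gamma> \<le> ln (J s)" "ln (J s) \<le> ln \<Gamma>"
      using gb[OF s] Jb[OF s] \<gamma> pos[OF s] by auto
    then show "lo \<le> \<phi> s" "\<phi> s \<le> hi" unfolding lo hi \<phi>_def by simp_all
  qed
  have sq: "\<gamma>\<^sup>2 \<le> (g s)\<^sup>2" "\<gamma>\<^sup>2 \<le> (J s)\<^sup>2" if s: "\<bar>s\<bar> < d" for s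
    using gb[OF s] Jb[OF s] \<gamma> by (auto intro: power_mono)
  have \<psi>1b: "\<bar>\<psi>1 s\<bar> \<le> P" if s: "\<bar>s\<bar> < d" for s
  proof -
    have "\<bar>- g1 s / (2 * g s)\<bar> \<le> G / (2 * \<gamma>)"
      unfolding abs_divide using g1b[OF s] gb[OF s] \<gamma> G by (intro frac_le) auto
    moreover have "\<bar>J1 s / (6 * J s)\<bar> \<le> 3 * G / (6 * \<gamma>)"
      unfolding abs_divide using J1b[OF s] Jb[OF s] \<gamma> G by (intro frac_le) auto
    ultimately have "\<bar>\<psi>1 s\<bar> \<le> G / (2 * \<gamma>) + 3 * G / (6 * \<gamma>)"
      unfolding \<psi>1_def by linarith
    also have "\<dots> = P" unfolding P using \<gamma> by (simp add: field_simps)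
    finally show ?thesis .
  qed
  have \<psi>2b: "\<bar>\<psi>2 s\<bar> \<le> P'" if s: "\<bar>s\<bar> < d" for s
  proof -
    have n1: "\<bar>- (g2 s * g s - g1 s * g1 s)\<bar> \<le> G * \<Gamma> + G * G"
    proof -
      have gs: "\<bar>g s\<bar> \<le> \<Gamma>" using gb[OF s] pos[OF s] by simp
      have "\<bar>g2 s * g s\<bar> \<le> G * \<Gamma>"
        unfolding abs_mult by (rule mult_mono[OF g2b[OF s] gs G abs_ge_zero])
      moreover have "\<bar>g1 s * g1 s\<bar> \<le> G * G"
        unfolding abs_mult by (rule mult_mono[OF g1b[OF s] g1b[OF s] G abs_ge_zero])
      ultimately show ?thesis by linarith
    qed
    have n2: "\<bar>J2 s * J s - J1 s * J1 s\<bar> \<le> 3 * G * \<Gamma> + (3 * G) * (3 * G)"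
    proof -
      have Js: "\<bar>J s\<bar> \<le> \<Gamma>" and G3: "0 \<le> 3 * G" using Jb[OF s] pos[OF s] G by simp_all
      have "\<bar>J2 s * J s\<bar> \<le> 3 * G * \<Gamma>"
        unfolding abs_mult by (rule mult_mono[OF J1b(2)[OF s] Js G3 abs_ge_zero])
      moreover have "\<bar>J1 s * J1 s\<bar> \<le> (3 * G) * (3 * G)"
        unfolding abs_mult by (rule mult_mono[OF J1b(1)[OF s] J1b(1)[OF s] G3 abs_ge_zero])
      ultimately show ?thesis by linarith
    qed
    have "\<bar>- (g2 s * g s - g1 s * g1 s) / (2 * (g s)\<^sup>2)\<bar> \<le> (G * \<Gamma> + G * G) / (2 * \<gamma>\<^sup>2)"
      unfolding abs_divide using n1 sq[OF s] \<gamma> G by (intro frac_le) auto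
    moreover have "\<bar>(J2 s * J s - J1 s * J1 s) / (6 * (J s)\<^sup>2)\<bar> \<le> (3 * G * \<Gamma> + (3 * G) * (3 * G)) / (6 * \<gamma>\<^sup>2)"
      unfolding abs_divide using n2 sq[OF s] \<gamma> G by (intro frac_le) auto
    ultimately have "\<bar>\<psi>2 s\<bar> \<le> (G * \<Gamma> + G * G) / (2 * \<gamma>\<^sup>2) + (3 * G * \<Gamma> + (3 * G) * (3 * G)) / (6 * \<gamma>\<^sup>2)"
      unfolding \<psi>2_def by linarith
    also have "\<dots> = P'" unfolding P' using \<gamma> by (simp add: field_simps power2_eq_square)
    finally show ?thesis .
  qed
  have hi0: "hi > 0" and P0: "0 \<le> P" by (use hi P G \<gamma> in auto)
  have \<phi>0: "\<phi> s > 0" for s by (simp add: \<phi>_def)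
  have \<phi>1b: "\<bar>\<phi> s * \<psi>1 s\<bar> \<le> hi * P" if s: "\<bar>s\<bar> < d" for s
    unfolding abs_mult using \<phi>b[OF s] \<psi>1b[OF s] hi0 \<phi>0[of s] by (intro mult_mono) auto
  have \<phi>2b: "\<bar>\<phi> s * ((\<psi>1 s)\<^sup>2 + \<psi>2 s)\<bar> \<le> hi * (P\<^sup>2 + P')" if s: "\<bar>s\<bar> < d" for s
  proof -
    have "\<bar>\<psi>1 s\<bar>\<^sup>2 \<le> P\<^sup>2" using \<psi>1b[OF s] by (intro power_mono) auto
    then have "(\<psi>1 s)\<^sup>2 \<le> P\<^sup>2" by simp
    then have "\<bar>(\<psi>1 s)\<^sup>2 + \<psi>2 s\<bar> \<le> P\<^sup>2 + P'"
      using \<psi>2b[OF s] zero_le_power2[of "\<psi>1 s"] by linarith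
    then show ?thesis
      unfolding abs_mult using \<phi>b[OF s] hi0 \<phi>0[of s] by (intro mult_mono) auto
  qed
  show ?thesis
    by (rule exI[of _ \<zeta>], rule exI[of _ \<phi>], rule exI[of _ "\<lambda>s. \<phi> s * \<psi>1 s"],
        rule exI[of _ "\<lambda>s. \<phi> s * ((\<psi>1 s)\<^sup>2 + \<psi>2 s)"], intro conjI allI impI)
      (simp add: \<zeta>_def, erule d\<zeta>, erule d\<phi>, erule d\<phi>1, erule W, erule \<phi>b, erule \<phi>b, erule \<phi>1b, erule \<phi>2b)
qed

definition simple_zero_bounds ::
    "(real \<Rightarrow> real) \<Rightarrow> (real \<Rightarrow> real) \<Rightarrow> (real \<Rightarrow> real) \<Rightarrow> (real \<Rightarrow> real) \<Rightarrow> real \<Rightarrow> real \<Rightarrow> real \<Rightarrow> bool" where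
  "simple_zero_bounds W W1 W2 W3 m0 M s \<longleftrightarrow> (W has_real_derivative W1 s) (at s) \<and> (W1 has_real_derivative W2 s) (at s) \<and>
     (W2 has_real_derivative W3 s) (at s) \<and> m0 \<le> W1 s \<and> W1 s \<le> M \<and> \<bar>W2 s\<bar> \<le> M \<and> \<bar>W3 s\<bar> \<le> M"

text \<open>Langer's variable \<open>\<zeta>\<close> for \<open>W\<close> with \<open>\<phi> = \<zeta>'\<^bsup>-1/2\<^esup>\<close>, in the form \<open>\<zeta>' = \<phi>\<^bsup>-2\<^esup>\<close>, \<open>W = \<zeta> \<zeta>'\<^sup>2\<close>.\<close>

definition langer_at ::
    "(real \<Rightarrow> real) \<Rightarrow> (real \<Rightarrow> real) \<Rightarrow> (real \<Rightarrow> real) \<Rightarrow> (real \<Rightarrow> real) \<Rightarrow> (real \<Rightarrow> real) \<Rightarrow> real \<Rightarrow> real \<Rightarrow> bool" where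
  "langer_at W \<zeta> \<phi> \<phi>1 \<phi>2 K s \<longleftrightarrow> (\<zeta> has_real_derivative 1 / (\<phi> s)\<^sup>2) (at s) \<and> (\<phi> has_real_derivative \<phi>1 s) (at s) \<and>
     (\<phi>1 has_real_derivative \<phi>2 s) (at s) \<and> W s = \<zeta> s / \<phi> s ^ 4 \<and>
     1 / K \<le> \<phi> s \<and> \<phi> s \<le> K \<and> \<bar>\<phi>1 s\<bar> \<le> K \<and> \<bar>\<phi>2 s\<bar> \<le> K"

text \<open>A simple zero of \<open>W\<close> of class \<open>C\<^sup>3\<close> can be divided out: \<open>W = s q(s)\<close> with \<open>q\<close> the mean of \<open>W'\<close> over \<open>[0, s]\<close>,
a positive function of class \<open>C\<^sup>2\<close>. Then \<open>g = q\<^bsup>1/2\<^esup>\<close> is admissible above. The constant \<open>K\<close> depends only on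
the bounds for \<open>W\<close>, which makes all later estimates uniform in the energy.\<close>

lemma langer_map:
  fixes m0 M :: real
  assumes m0: "0 < m0" "m0 \<le> M"
  shows "\<exists>K\<ge>1. \<forall>W W1 W2 W3 :: real \<Rightarrow> real. \<forall>d. W 0 = 0 \<and> continuous_on {-d<..<d} W3 \<and>
      (\<forall>s. \<bar>s\<bar> < d \<longrightarrow> simple_zero_bounds W W1 W2 W3 m0 M s) \<longrightarrow>
      (\<exists>\<zeta> \<phi> \<phi>1 \<phi>2 :: real \<Rightarrow> real. \<zeta> 0 = 0 \<and> (\<forall>s. \<bar>s\<bar> < d \<longrightarrow>
        langer_at W \<zeta> \<phi> \<phi>1 \<phi>2 K s))"
proof -
  define \<gamma> where "\<gamma> = sqrt m0"
  define \<Gamma> where "\<Gamma> = sqrt M"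
  define G where "G = max (M / (2 * \<gamma>)) ((M + 2 * (M / (2 * \<gamma>))\<^sup>2) / (2 * \<gamma>))"
  define P where "P = G / \<gamma>"
  define P' where "P' = (G * \<Gamma> + 2 * G\<^sup>2) / \<gamma>\<^sup>2"
  define lo where "lo = exp (- ln \<Gamma> / 2 + ln \<gamma> / 6)"
  define hi where "hi = exp (- ln \<gamma> / 2 + ln \<Gamma> / 6)"
  define K where "K = 1 + 1 / lo + hi + hi * P + hi * (P\<^sup>2 + P')"
  have \<gamma>: "0 < \<gamma>" "\<gamma> \<le> \<Gamma>" using m0 by (auto simp: \<gamma>_def \<Gamma>_def)
  have G: "0 \<le> G" unfolding G_def using \<gamma> m0 by (simp add: le_max_iff_disj)
  have PP: "0 \<le> P" "0 \<le> P'" unfolding P_def P'_def using \<gamma> G by auto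
  have lohi: "lo > 0" "hi > 0" by (simp_all add: lo_def hi_def)
  have hp: "0 \<le> hi * P" "0 \<le> hi * (P\<^sup>2 + P')" "0 < 1 / lo" using PP lohi by auto
  have K: "1 \<le> K" "1 / lo \<le> K" "hi \<le> K" "hi * P \<le> K" "hi * (P\<^sup>2 + P') \<le> K"
    using hp lohi(2) unfolding K_def by linarith+
  have K': "1 / K \<le> lo" using K(1,2) lohi by (simp add: field_simps)
  show ?thesis
  proof (intro exI[of _ K] conjI K(1) allI impI; elim conjE)
    fix W W1 W2 W3 :: "real \<Rightarrow> real" and d
    assume W0: "W 0 = 0" and cW3: "continuous_on {-d<..<d} W3"
      and H: "\<forall>s. \<bar>s\<bar> < d \<longrightarrow> simple_zero_bounds W W1 W2 W3 m0 M s"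
    have dW: "(W has_real_derivative W1 s) (at s)" "(W1 has_real_derivative W2 s) (at s)"
      "(W2 has_real_derivative W3 s) (at s)" if "\<bar>s\<bar> < d" for s using H that by (auto simp: simple_zero_bounds_def)
    have cW: "continuous_on {-d<..<d} W1" "continuous_on {-d<..<d} W2"
      by (intro continuous_at_imp_continuous_on ballI DERIV_isCont[OF dW(2)] DERIV_isCont[OF dW(3)]; auto)+
    define q where "q = avg 0 1 W1"
    define q1 where "q1 = avg 1 1 W2"
    define q2 where "q2 = avg 2 1 W3"
    have dq: "(q has_real_derivative q1 s) (at s)" "(q1 has_real_derivative q2 s) (at s)" if "\<bar>s\<bar> < d" for s
      using DERIV_avg[OF dW(2) cW(2) that, of 0 1] DERIV_avg[OF dW(3) cW3 that, of 1 1]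
      by (simp_all add: q_def q1_def q2_def numeral_2_eq_2)
    have qb: "m0 \<le> q s" "q s \<le> M" "\<bar>q1 s\<bar> \<le> M" "\<bar>q2 s\<bar> \<le> M" if "\<bar>s\<bar> < d" for s
      using H that avg_bounds[where k = 0 and e = 1 and lo = m0 and hi = M, OF cW(1) that]
        avg_abs_bound[where k = 1 and e = 1 and M = M, OF cW(2) that]
        avg_abs_bound[where k = 2 and e = 1 and M = M, OF cW3 that]
      by (simp_all add: q_def q1_def q2_def simple_zero_bounds_def)
    have cq2: "continuous_on {-d<..<d} q2"
      unfolding q2_def by (rule continuous_on_avg[OF cW3])
    have Wq: "s * q s = W s" if "\<bar>s\<bar> < d" for s
      using avg_0_1_antiderivative[OF dW(1) that] W0 by (simp add: q_def)
    define g where "g = (\<lambda>s. sqrt (q s))"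
    define g1 where "g1 = (\<lambda>s. q1 s / (2 * g s))"
    define g2 where "g2 = (\<lambda>s. (q2 s - 2 * (g1 s)\<^sup>2) / (2 * g s))"
    have gb: "\<gamma> \<le> g s \<and> g s \<le> \<Gamma>" if "\<bar>s\<bar> < d" for s
      using qb[OF that] by (simp add: \<gamma>_def \<Gamma>_def g_def)
    have gpos: "g s > 0" if "\<bar>s\<bar> < d" for s using gb[OF that] \<gamma> by linarith
    have dg: "(g has_real_derivative g1 s) (at s)" if "\<bar>s\<bar> < d" for s
    proof -
      have "q s > 0" using qb[OF that] m0 by linarith
      then have "(g has_real_derivative (inverse (sqrt (q s)) / 2 * q1 s)) (at s)"
        unfolding g_def by (intro DERIV_chain2[OF DERIV_real_sqrt] dq that)
      then show ?thesis by (simp add: g1_def g_def field_simps)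
    qed
    have dg1: "(g1 has_real_derivative g2 s) (at s)" if "\<bar>s\<bar> < d" for s
    proof -
      have "(g1 has_real_derivative ((q2 s * (2 * g s) - q1 s * (2 * g1 s)) / ((2 * g s) * (2 * g s)))) (at s)"
        unfolding g1_def using gpos[OF that]
        by (intro DERIV_divide DERIV_cmult dq that dg[unfolded g1_def]) auto
      also have "(q2 s * (2 * g s) - q1 s * (2 * g1 s)) / ((2 * g s) * (2 * g s)) = g2 s"
      proof -
        have "q1 s = 2 * g s * g1 s" using gpos[OF that] by (simp add: g1_def)
        then show ?thesis using gpos[OF that] unfolding g2_def by (simp add: field_simps power2_eq_square)
      qed
      finally show ?thesis .
    qed
    have cg: "continuous_on {-d<..<d} g" "continuous_on {-d<..<d} g1"
      by (intro continuous_at_imp_continuous_on ballI DERIV_isCont[OF dg] DERIV_isCont[OF dg1]; auto)+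
    have cg2: "continuous_on {-d<..<d} g2"
      unfolding g2_def by (intro continuous_intros cg cq2) (use gpos in \<open>force simp: abs_less_iff\<close>)
    have g1b': "\<bar>g1 s\<bar> \<le> M / (2 * \<gamma>)" if "\<bar>s\<bar> < d" for s
      unfolding g1_def abs_divide using qb[OF that] gb[OF that] \<gamma> m0 by (intro frac_le) auto
    have g1b: "\<bar>g1 s\<bar> \<le> G" if "\<bar>s\<bar> < d" for s
      using g1b'[OF that] by (simp add: G_def)
    have g2b: "\<bar>g2 s\<bar> \<le> G" if "\<bar>s\<bar> < d" for s
    proof -
      have "(g1 s)\<^sup>2 \<le> (M / (2 * \<gamma>))\<^sup>2"
        using g1b'[OF that] by (metis abs_ge_zero power2_abs power_mono)
      then have "\<bar>q2 s - 2 * (g1 s)\<^sup>2\<bar> \<le> M + 2 * (M / (2 * \<gamma>))\<^sup>2"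
        using qb[OF that] zero_le_power2[of "g1 s"] by linarith
      then have "\<bar>g2 s\<bar> \<le> (M + 2 * (M / (2 * \<gamma>))\<^sup>2) / (2 * \<gamma>)"
        unfolding g2_def abs_divide using gb[OF that] \<gamma> m0 by (intro frac_le) auto
      then show ?thesis by (simp add: G_def)
    qed
    have Wg: "s * (g s)\<^sup>2 = W s" if "\<bar>s\<bar> < d" for s
      using Wq[OF that] qb[OF that] m0 by (simp add: g_def)
    from langer_map_of_sqrt[OF \<gamma> G dg dg1 cg2 gb g1b g2b P_def P'_def lo_def hi_def]
    obtain \<zeta> \<phi> \<phi>1 \<phi>2 where Z: "\<zeta> 0 = 0" "\<And>s. \<bar>s\<bar> < d \<Longrightarrow>
      (\<zeta> has_real_derivative 1 / (\<phi> s)\<^sup>2) (at s) \<and> (\<phi> has_real_derivative \<phi>1 s) (at s) \<and>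
      (\<phi>1 has_real_derivative \<phi>2 s) (at s) \<and> s * (g s)\<^sup>2 = \<zeta> s / \<phi> s ^ 4 \<and>
      lo \<le> \<phi> s \<and> \<phi> s \<le> hi \<and> \<bar>\<phi>1 s\<bar> \<le> hi * P \<and> \<bar>\<phi>2 s\<bar> \<le> hi * (P\<^sup>2 + P')" by blast
    show "\<exists>\<zeta> \<phi> \<phi>1 \<phi>2 :: real \<Rightarrow> real. \<zeta> 0 = 0 \<and> (\<forall>s. \<bar>s\<bar> < d \<longrightarrow>
        langer_at W \<zeta> \<phi> \<phi>1 \<phi>2 K s)"
    proof (rule exI[of _ \<zeta>], rule exI[of _ \<phi>], rule exI[of _ \<phi>1], rule exI[of _ \<phi>2],
        intro conjI allI impI Z(1))
      fix s assume s: "\<bar>s\<bar> < d"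
      show "langer_at W \<zeta> \<phi> \<phi>1 \<phi>2 K s"
        using Z(2)[OF s] Wg[OF s] K K' unfolding langer_at_def by auto
    qed
  qed
qed

section \<open>Comparison with an Airy function across a turning point\<close>

text \<open>Passing from \<open>h W\<^bsup>-1/4\<^esup> y'\<close> to \<open>h W\<^bsup>-1/2\<^esup> (W\<^bsup>1/4\<^esup> y)'\<close> changes one coordinate by \<open>O(h)\<close> times the other.\<close>

lemma phase_near_perturb:
  assumes "phase_near (C * h) \<beta> u b0" "\<bar>b - b0\<bar> \<le> h * \<kappa> * \<bar>u\<bar>" "0 < h" "h \<le> 1" "0 \<le> C" "0 \<le> \<kappa>"
  shows "phase_near ((C * (1 + \<kappa>) + \<kappa>) * h) \<beta> u b"
proof -
  define R where "R = sqrt (u\<^sup>2 + b\<^sup>2)"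
  have uR: "\<bar>u\<bar> \<le> R" unfolding R_def by (rule real_le_rsqrt) simp
  have R0: "0 \<le> R" by (simp add: R_def)
  have d: "\<bar>b - b0\<bar> \<le> h * \<kappa> * R"
    using assms(2,3,6) mult_left_mono[OF uR, of "h * \<kappa>"] by (meson mult_nonneg_nonneg less_imp_le order_trans)
  have d': "h * \<kappa> * R \<le> \<kappa> * R"
    using assms(4) mult_right_mono[of h 1 "\<kappa> * R"] assms(6) R0 by (simp add: mult.assoc)
  have "sqrt (u\<^sup>2 + b0\<^sup>2) = norm (u, b0)" "R = norm (u, b)"
    by (simp_all add: R_def norm_prod_def)
  moreover have "norm (u, b0) \<le> norm (u, b) + norm (0::real, b0 - b)"
    using norm_triangle_ineq[of "(u, b)" "(0, b0 - b)"] by simp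
  ultimately have R': "sqrt (u\<^sup>2 + b0\<^sup>2) \<le> R + \<bar>b - b0\<bar>"
    by (simp add: norm_prod_def abs_minus_commute)
  have "u * cos \<beta> - b * sin \<beta> = (u * cos \<beta> - b0 * sin \<beta>) - (b - b0) * sin \<beta>"
    by (simp add: algebra_simps)
  also have "\<bar>\<dots>\<bar> \<le> \<bar>u * cos \<beta> - b0 * sin \<beta>\<bar> + \<bar>b - b0\<bar> * \<bar>sin \<beta>\<bar>"
    by (metis abs_mult abs_triangle_ineq4)
  also have "\<dots> \<le> C * h * sqrt (u\<^sup>2 + b0\<^sup>2) + \<bar>b - b0\<bar>"
    using assms(1) by (intro add_mono mult_left_le) (auto simp: phase_near_def)
  also have "\<dots> \<le> C * h * (R + \<kappa> * R) + h * \<kappa> * R"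
    using d d' R' assms(3,5) by (intro add_mono mult_left_mono) auto
  also have "\<dots> = (C * (1 + \<kappa>) + \<kappa>) * h * R" by (simp add: algebra_simps)
  finally show ?thesis by (simp add: phase_near_def R_def)
qed

text \<open>In a barrier \<open>(y y')' = y'\<^sup>2 + k y\<^sup>2 \<ge> 0\<close>. This sign is the only property of the barriers that links
neighbouring wells.\<close>

lemma barrier_flux_mono:
  fixes y y1 k :: "real \<Rightarrow> real"
  assumes "a \<le> b" and dy: "\<And>x. x \<in> {a..b} \<Longrightarrow> (y has_real_derivative y1 x) (at x)"
    and dy1: "\<And>x. x \<in> {a..b} \<Longrightarrow> (y1 has_real_derivative k x * y x) (at x)"
    and k: "\<And>x. x \<in> {a..b} \<Longrightarrow> 0 \<le> k x"
  shows "y a * y1 a \<le> y b * y1 b"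
proof (rule nondecreasing_if_DERIV_nonneg[where f = "\<lambda>x. y x * y1 x" and f' = "\<lambda>x. (y1 x)\<^sup>2 + k x * (y x)\<^sup>2"])
  fix x assume "a \<le> x" "x \<le> b"
  then have x: "x \<in> {a..b}" by simp
  show "((\<lambda>x. y x * y1 x) has_real_derivative (y1 x)\<^sup>2 + k x * (y x)\<^sup>2) (at x)"
    by (auto intro!: derivative_eq_intros dy[OF x] dy1[OF x] simp: power2_eq_square algebra_simps)
  show "0 \<le> (y1 x)\<^sup>2 + k x * (y x)\<^sup>2" using k[OF x] by simp
qed fact

lemma barrier_square_mono:
  fixes y y1 k :: "real \<Rightarrow> real"
  assumes "a \<le> b" and dy: "\<And>x. x \<in> {a..b} \<Longrightarrow> (y has_real_derivative y1 x) (at x)"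
    and dy1: "\<And>x. x \<in> {a..b} \<Longrightarrow> (y1 has_real_derivative k x * y x) (at x)"
    and k: "\<And>x. x \<in> {a..b} \<Longrightarrow> 0 \<le> k x" and "0 \<le> y a * y1 a"
  shows "(y a)\<^sup>2 \<le> (y b)\<^sup>2"
proof (rule nondecreasing_if_DERIV_nonneg[where f = "\<lambda>x. (y x)\<^sup>2" and f' = "\<lambda>x. 2 * (y x * y1 x)"])
  fix x assume ax: "a \<le> x" "x \<le> b"
  then have x: "x \<in> {a..b}" by simp
  show "((\<lambda>x. (y x)\<^sup>2) has_real_derivative 2 * (y x * y1 x)) (at x)"
    by (auto intro!: derivative_eq_intros dy[OF x])
  have "y a * y1 a \<le> y x * y1 x"
    by (rule barrier_flux_mono[where k = k]) (use ax dy dy1 k in auto)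
  then show "0 \<le> 2 * (y x * y1 x)" using assms(5) by simp
qed fact

text \<open>The energy \<open>E = h\<^sup>2 y'\<^sup>2 + W y\<^sup>2\<close> increases, but may start from a negative value
\<open>E(a) \<ge> - B y(a)\<^sup>2\<close>. Growth of \<open>y\<close> in the barrier compensates this: three integrations of the equation over
the barrier interval \<open>[a, a + l]\<close> show that \<open>E\<close> gains there a multiple of \<open>y(a)\<^sup>2 / h\<^sup>2\<close>.\<close>

lemma turning_point_energy_bound:
  fixes W W1 y y1 :: "real \<Rightarrow> real"
  assumes h: "0 < h" and m0: "0 < m0" and l: "0 < l" "a + 2 * l \<le> x0" and x0b: "x0 \<le> b"
    and dW: "\<And>x. x \<in> {a..b} \<Longrightarrow> (W has_real_derivative W1 x) (at x)"
    and W1: "\<And>x. x \<in> {a..b} \<Longrightarrow> m0 \<le> W1 x" and Wx0: "W x0 = 0" and Wa: "- W a \<le> B" and B: "0 \<le> B"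
    and dy: "\<And>x. x \<in> {a..b} \<Longrightarrow> (y has_real_derivative y1 x) (at x)"
    and dy1: "\<And>x. x \<in> {a..b} \<Longrightarrow> (y1 has_real_derivative (- W x / h\<^sup>2) * y x) (at x)"
    and flux: "0 \<le> y a * y1 a"
    and small: "6 * B * h\<^sup>2 \<le> m0\<^sup>2 * l ^ 4"
  defines "E \<equiv> \<lambda>x. h\<^sup>2 * (y1 x)\<^sup>2 + W x * (y x)\<^sup>2"
  shows "B * (y a)\<^sup>2 \<le> E b" "- E a \<le> E b"
proof -
  have dE: "(E has_real_derivative W1 x * (y x)\<^sup>2) (at x)" if x: "x \<in> {a..b}" for x
  proof -
    have "(E has_real_derivative (h\<^sup>2 * (2 * y1 x * ((- W x / h\<^sup>2) * y x)) + (W1 x * (y x)\<^sup>2 + (2 * y x * y1 x) * W x))) (at x)"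
      unfolding E_def
      by (auto intro!: derivative_eq_intros dy[OF x] dy1[OF x] dW[OF x])
    also have "h\<^sup>2 * (2 * y1 x * ((- W x / h\<^sup>2) * y x)) + (W1 x * (y x)\<^sup>2 + (2 * y x * y1 x) * W x) = W1 x * (y x)\<^sup>2"
      using h by simp
    finally show ?thesis .
  qed
  have Emono: "E s \<le> E t" if "a \<le> s" "s \<le> t" "t \<le> b" for s t
  proof (rule nondecreasing_if_DERIV_nonneg[OF that(2) dE])
    fix x assume x: "s \<le> x" "x \<le> t"
    with that show "x \<in> {a..b}" by auto
    then show "0 \<le> W1 x * (y x)\<^sup>2" using W1[of x] m0 by simp
  qed
  define k where "k = m0 * l / h\<^sup>2"
  have k0: "0 < k" using m0 l h by (simp add: k_def)
  have Wneg: "m0 * (x0 - x) \<le> - W x" if "a \<le> x" "x \<le> x0" for x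
  proof -
    have "m0 * x - W x \<ge> m0 * x0 - W x0"
    proof -
      have "W x - m0 * x \<le> W x0 - m0 * x0"
      proof (rule nondecreasing_if_DERIV_nonneg[where f = "\<lambda>x. W x - m0 * x" and f' = "\<lambda>x. W1 x - m0"])
        fix t assume t: "x \<le> t" "t \<le> x0"
        then have t': "t \<in> {a..b}" using that x0b by auto
        show "((\<lambda>x. W x - m0 * x) has_real_derivative W1 t - m0) (at t)"
          by (auto intro!: derivative_eq_intros dW[OF t'])
        show "0 \<le> W1 t - m0" using W1[OF t'] by simp
      qed fact
      then show ?thesis by simp
    qed
    then show ?thesis using Wx0 by (simp add: right_diff_distrib)
  qed
  have knn: "0 \<le> - W x / h\<^sup>2" if "x \<in> {a..a + l}" for x
  proof -
    have "0 \<le> m0 * (x0 - x)" using that l m0 by auto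
    also have "\<dots> \<le> - W x" using that l by (intro Wneg) auto
    finally show ?thesis by (intro divide_nonneg_nonneg) auto
  qed
  have klow: "k \<le> - W x / h\<^sup>2" if "x \<in> {a..a + l}" for x
  proof -
    have "m0 * l \<le> m0 * (x0 - x)" using that l m0 by (intro mult_left_mono) auto
    also have "\<dots> \<le> - W x" using that l by (intro Wneg) auto
    finally show ?thesis unfolding k_def by (rule divide_right_mono) simp
  qed
  have sub: "x \<in> {a..b}" if "x \<in> {a..a + l}" for x using that l x0b by auto
  have Ya: "(y a)\<^sup>2 \<le> (y x)\<^sup>2" if "x \<in> {a..a + l}" for x
    by (rule barrier_square_mono[where k = "\<lambda>x. - W x / h\<^sup>2"])
       (use that sub dy dy1 knn flux in auto)
  have F: "k * (y a)\<^sup>2 * (x - a) \<le> y x * y1 x" if x: "x \<in> {a..a + l}" for x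
  proof -
    have "y a * y1 a - k * (y a)\<^sup>2 * (a - a) \<le> y x * y1 x - k * (y a)\<^sup>2 * (x - a)"
    proof (rule nondecreasing_if_DERIV_nonneg[where f = "\<lambda>x. y x * y1 x - k * (y a)\<^sup>2 * (x - a)"
          and f' = "\<lambda>x. (y1 x)\<^sup>2 + (- W x / h\<^sup>2) * (y x)\<^sup>2 - k * (y a)\<^sup>2"])
      show "a \<le> x" using x by simp
      fix t assume t: "a \<le> t" "t \<le> x"
      then have t': "t \<in> {a..a + l}" using x by auto
      note tb = sub[OF t']
      show "((\<lambda>x. y x * y1 x - k * (y a)\<^sup>2 * (x - a)) has_real_derivative
          (y1 t)\<^sup>2 + (- W t / h\<^sup>2) * (y t)\<^sup>2 - k * (y a)\<^sup>2) (at t)"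
        by (auto intro!: derivative_eq_intros dy[OF tb] dy1[OF tb] simp: power2_eq_square algebra_simps)
      have "k * (y a)\<^sup>2 \<le> (- W t / h\<^sup>2) * (y t)\<^sup>2"
        using klow[OF t'] Ya[OF t'] k0 by (intro mult_mono) auto
      then show "0 \<le> (y1 t)\<^sup>2 + (- W t / h\<^sup>2) * (y t)\<^sup>2 - k * (y a)\<^sup>2"
        using zero_le_power2[of "y1 t"] by linarith
    qed
    then show ?thesis using flux by simp
  qed
  \<comment> \<open>First integration gives the flux, the second one \<open>y\<^sup>2\<close>, and the third one (below) the energy.\<close>
  have Ysq: "k * (y a)\<^sup>2 * (x - a)\<^sup>2 \<le> (y x)\<^sup>2" if x: "x \<in> {a..a + l}" for x
  proof -
    have "(y a)\<^sup>2 - k * (y a)\<^sup>2 * (a - a)\<^sup>2 \<le> (y x)\<^sup>2 - k * (y a)\<^sup>2 * (x - a)\<^sup>2"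
    proof (rule nondecreasing_if_DERIV_nonneg[where f = "\<lambda>x. (y x)\<^sup>2 - k * (y a)\<^sup>2 * (x - a)\<^sup>2"
          and f' = "\<lambda>x. 2 * (y x * y1 x - k * (y a)\<^sup>2 * (x - a))"])
      show "a \<le> x" using x by simp
      fix t assume t: "a \<le> t" "t \<le> x"
      then have t': "t \<in> {a..a + l}" using x by auto
      note tb = sub[OF t']
      show "((\<lambda>x. (y x)\<^sup>2 - k * (y a)\<^sup>2 * (x - a)\<^sup>2) has_real_derivative
          2 * (y t * y1 t - k * (y a)\<^sup>2 * (t - a))) (at t)"
        by (auto intro!: derivative_eq_intros dy[OF tb] simp: algebra_simps)
      show "0 \<le> 2 * (y t * y1 t - k * (y a)\<^sup>2 * (t - a))" using F[OF t'] by simp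
    qed
    then have "(y a)\<^sup>2 \<le> (y x)\<^sup>2 - k * (y a)\<^sup>2 * (x - a)\<^sup>2" by simp
    then show ?thesis using zero_le_power2[of "y a"] by linarith
  qed
  have gain: "m0 * k * (y a)\<^sup>2 * l ^ 3 / 3 \<le> E (a + l) - E a"
  proof -
    have "E a - m0 * k * (y a)\<^sup>2 * (a - a) ^ 3 / 3 \<le> E (a + l) - m0 * k * (y a)\<^sup>2 * (a + l - a) ^ 3 / 3"
    proof (rule nondecreasing_if_DERIV_nonneg[where f = "\<lambda>x. E x - m0 * k * (y a)\<^sup>2 * (x - a) ^ 3 / 3"
          and f' = "\<lambda>x. W1 x * (y x)\<^sup>2 - m0 * (k * (y a)\<^sup>2 * (x - a)\<^sup>2)"])
      show "a \<le> a + l" using l by simp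
      fix t assume t: "a \<le> t" "t \<le> a + l"
      then have t': "t \<in> {a..a + l}" by auto
      note tb = sub[OF t']
      show "((\<lambda>x. E x - m0 * k * (y a)\<^sup>2 * (x - a) ^ 3 / 3) has_real_derivative
          W1 t * (y t)\<^sup>2 - m0 * (k * (y a)\<^sup>2 * (t - a)\<^sup>2)) (at t)"
        by (auto intro!: derivative_eq_intros dE[OF tb] simp: algebra_simps)
      have "m0 * (k * (y a)\<^sup>2 * (t - a)\<^sup>2) \<le> W1 t * (y t)\<^sup>2"
        using W1[OF tb] Ysq[OF t'] m0 k0 by (intro mult_mono) auto
      then show "0 \<le> W1 t * (y t)\<^sup>2 - m0 * (k * (y a)\<^sup>2 * (t - a)\<^sup>2)" by simp
    qed
    then show ?thesis by simp
  qed
  have "2 * B \<le> m0 * k * l ^ 3 / 3"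
    using small h by (simp add: k_def field_simps eval_nat_numeral)
  then have "2 * B * (y a)\<^sup>2 \<le> m0 * k * l ^ 3 / 3 * (y a)\<^sup>2"
    by (rule mult_right_mono) simp
  also have "\<dots> \<le> E (a + l) - E a" using gain by (simp add: algebra_simps)
  also have "\<dots> \<le> E b - E a" using Emono[of "a + l" b] l x0b by simp
  finally have 1: "2 * B * (y a)\<^sup>2 \<le> E b - E a" .
  have "- E a \<le> - W a * (y a)\<^sup>2"
    by (simp add: E_def)
  also have "\<dots> \<le> B * (y a)\<^sup>2" using Wa by (intro mult_right_mono) auto
  finally have 2: "- E a \<le> B * (y a)\<^sup>2" .
  show 3: "B * (y a)\<^sup>2 \<le> E b" using 1 2 by (simp add: mult.assoc)
  show "- E a \<le> E b" using 2 3 by linarith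
qed

text \<open>The solution \<open>A\<close> is convex on \<open>[- c, 0]\<close>, hence \<open>A\<^sup>2 \<ge> (z + c)\<^sup>2\<close> there, and the energy
\<open>h\<^sup>2 A'\<^sup>2 + z A\<^sup>2\<close> has derivative \<open>A\<^sup>2\<close>. So the initial slope 1 is bounded by the amplitude at \<open>c\<close>.\<close>

lemma airy_amplitude_lower_bound:
  fixes A A1 :: "real \<Rightarrow> real"
  assumes c: "0 < c" and h: "0 < h"
    and dA: "\<And>z. (A has_real_derivative A1 z) (at z)"
    and dA1: "\<And>z. (A1 has_real_derivative (- z / h\<^sup>2) * A z) (at z)"
    and init: "A (- c) = 0" "A1 (- c) = 1"
  shows "c ^ 3 / 3 \<le> h\<^sup>2 * (A1 c)\<^sup>2 + c * (A c)\<^sup>2"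
proof -
  define E where "E = (\<lambda>x. h\<^sup>2 * (A1 x)\<^sup>2 + x * (A x)\<^sup>2)"
  have dE: "(E has_real_derivative (A x)\<^sup>2) (at x)" for x
  proof -
    have "(E has_real_derivative (h\<^sup>2 * (2 * A1 x * ((- x / h\<^sup>2) * A x)) + ((A x)\<^sup>2 + (2 * A x * A1 x) * x))) (at x)"
      unfolding E_def by (auto intro!: derivative_eq_intros dA dA1)
    also have "h\<^sup>2 * (2 * A1 x * ((- x / h\<^sup>2) * A x)) + ((A x)\<^sup>2 + (2 * A x * A1 x) * x) = (A x)\<^sup>2"
      using h by simp
    finally show ?thesis .
  qed
  have flux: "0 \<le> A x * A1 x" if "- c \<le> x" "x \<le> 0" for x
  proof -
    have "A (- c) * A1 (- c) \<le> A x * A1 x"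
      by (rule barrier_flux_mono[where k = "\<lambda>z. - z / h\<^sup>2"])
        (use that dA dA1 in \<open>auto intro!: divide_nonpos_nonneg\<close>)
    then show ?thesis using init by simp
  qed
  have sq1: "1 \<le> (A1 x)\<^sup>2" if x: "- c \<le> x" "x \<le> 0" for x
  proof -
    have "(A1 (- c))\<^sup>2 \<le> (A1 x)\<^sup>2"
    proof (rule nondecreasing_if_DERIV_nonneg[where f = "\<lambda>x. (A1 x)\<^sup>2" and f' = "\<lambda>x. 2 * ((- x / h\<^sup>2) * (A x * A1 x))"])
      fix t assume t: "- c \<le> t" "t \<le> x"
      show "((\<lambda>x. (A1 x)\<^sup>2) has_real_derivative 2 * ((- t / h\<^sup>2) * (A t * A1 t))) (at t)"
        by (auto intro!: derivative_eq_intros dA1)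
      have "0 \<le> - t / h\<^sup>2" using t x by (intro divide_nonneg_nonneg) auto
      then show "0 \<le> 2 * ((- t / h\<^sup>2) * (A t * A1 t))" 
        using mult_nonneg_nonneg[OF _ flux[of t], of "- t / h\<^sup>2"] t x by linarith
    qed fact
    then show ?thesis using init by simp
  qed
  have flux1: "x + c \<le> A x * A1 x" if x: "- c \<le> x" "x \<le> 0" for x
  proof -
    have "A (- c) * A1 (- c) - (- c + c) \<le> A x * A1 x - (x + c)"
    proof (rule nondecreasing_if_DERIV_nonneg[where f = "\<lambda>x. A x * A1 x - (x + c)"
          and f' = "\<lambda>x. (A1 x)\<^sup>2 + (- x / h\<^sup>2) * (A x)\<^sup>2 - 1"])
      fix t assume t: "- c \<le> t" "t \<le> x"
      show "((\<lambda>x. A x * A1 x - (x + c)) has_real_derivative (A1 t)\<^sup>2 + (- t / h\<^sup>2) * (A t)\<^sup>2 - 1) (at t)"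
        by (auto intro!: derivative_eq_intros dA dA1 simp: power2_eq_square algebra_simps)
      have "0 \<le> (- t / h\<^sup>2) * (A t)\<^sup>2"
        using t x by (intro mult_nonneg_nonneg divide_nonneg_nonneg) auto
      then show "0 \<le> (A1 t)\<^sup>2 + (- t / h\<^sup>2) * (A t)\<^sup>2 - 1" using sq1[of t] t x by linarith
    qed fact
    then show ?thesis using init by simp
  qed
  have sqA: "(x + c)\<^sup>2 \<le> (A x)\<^sup>2" if x: "- c \<le> x" "x \<le> 0" for x
  proof -
    have "(A (- c))\<^sup>2 - (- c + c)\<^sup>2 \<le> (A x)\<^sup>2 - (x + c)\<^sup>2"
    proof (rule nondecreasing_if_DERIV_nonneg[where f = "\<lambda>x. (A x)\<^sup>2 - (x + c)\<^sup>2"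
          and f' = "\<lambda>x. 2 * (A x * A1 x - (x + c))"])
      fix t assume t: "- c \<le> t" "t \<le> x"
      show "((\<lambda>x. (A x)\<^sup>2 - (x + c)\<^sup>2) has_real_derivative 2 * (A t * A1 t - (t + c))) (at t)"
        by (auto intro!: derivative_eq_intros dA)
      show "0 \<le> 2 * (A t * A1 t - (t + c))" using flux1[of t] t x by simp
    qed fact
    then show ?thesis using init by simp
  qed
  have "E (- c) - (- c + c) ^ 3 / 3 \<le> E 0 - (0 + c) ^ 3 / 3"
  proof (rule nondecreasing_if_DERIV_nonneg[where f = "\<lambda>x. E x - (x + c) ^ 3 / 3"
        and f' = "\<lambda>x. (A x)\<^sup>2 - (x + c)\<^sup>2"])
    fix t assume t: "- c \<le> t" "t \<le> 0"
    show "((\<lambda>x. E x - (x + c) ^ 3 / 3) has_real_derivative (A t)\<^sup>2 - (t + c)\<^sup>2) (at t)"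
      by (auto intro!: derivative_eq_intros dE)
    show "0 \<le> (A t)\<^sup>2 - (t + c)\<^sup>2" using sqA[OF t] by simp
  qed (use c in simp)
  moreover have "0 \<le> E (- c)" by (simp add: E_def init)
  moreover have "E 0 \<le> E c"
    by (rule nondecreasing_if_DERIV_nonneg[OF _ dE]) (use c in auto)
  ultimately show ?thesis by (simp add: E_def)
qed

text \<open>The choice \<open>t = (b / a)\<^bsup>1/2\<^esup>\<close> equalizes the two terms.\<close>

lemma scaled_bound_imp_geometric_bound:
  fixes q a b C :: real
  assumes "\<And>t. 0 < t \<Longrightarrow> \<bar>q\<bar> \<le> C * (t * a + b / t)" "0 < a" "0 < b"
  shows "\<bar>q\<bar> \<le> 2 * C * sqrt (a * b)"
proof -
  define t where "t = sqrt b / sqrt a"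
  have "0 < t" using assms(2,3) by (simp add: t_def)
  have "t * a = sqrt b * (a / sqrt a)" "b / t = b / sqrt b * sqrt a" by (simp_all add: t_def)
  then have "t * a = sqrt (a * b)" "b / t = sqrt (a * b)"
    using assms(2,3) by (simp_all add: real_div_sqrt real_sqrt_mult mult.commute)
  then show ?thesis using assms(1)[OF \<open>0 < t\<close>] by simp
qed

text \<open>The left side is, up to the term \<open>y \<phi>' A\<close>, the Wronskian \<open>q = y B' - y' B\<close> of \<open>y\<close> and \<open>B = \<phi> A(\<zeta>)\<close>. Since
\<open>h\<^sup>2 B'' = - W B + h\<^sup>2 \<phi>'' A(\<zeta>)\<close>, one has \<open>q' = \<phi>'' y A(\<zeta>)\<close>, and the energies of \<open>y\<close> and \<open>A\<close> control the integrals of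
\<open>y\<^sup>2\<close> and \<open>A(\<zeta>)\<^sup>2\<close>. The bound carries no factor \<open>1 / h\<close>, while a Wronskian of two solutions with
unrelated phases has size \<open>1 / h\<close> in these units. That is the gain of one power of \<open>h\<close>.\<close>

lemma airy_comparison:
  fixes W W1 y y1 \<zeta> \<phi> \<phi>1 \<phi>2 A A1 :: "real \<Rightarrow> real"
  assumes h: "0 < h" and m0: "0 < m0" and c: "0 < c" and K: "1 \<le> K" and ord: "s1 < 0" "0 < s2"
    and dW: "\<And>x. x \<in> {s1..s2} \<Longrightarrow> (W has_real_derivative W1 x) (at x)"
    and W1: "\<And>x. x \<in> {s1..s2} \<Longrightarrow> m0 \<le> W1 x"
    and d\<zeta>: "\<And>x. x \<in> {s1..s2} \<Longrightarrow> (\<zeta> has_real_derivative 1 / (\<phi> x)\<^sup>2) (at x)"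
    and d\<phi>: "\<And>x. x \<in> {s1..s2} \<Longrightarrow> (\<phi> has_real_derivative \<phi>1 x) (at x)"
    and d\<phi>1: "\<And>x. x \<in> {s1..s2} \<Longrightarrow> (\<phi>1 has_real_derivative \<phi>2 x) (at x)"
    and W\<zeta>: "\<And>x. x \<in> {s1..s2} \<Longrightarrow> W x = \<zeta> x / \<phi> x ^ 4"
    and \<phi>b: "\<And>x. x \<in> {s1..s2} \<Longrightarrow> 1 / K \<le> \<phi> x \<and> \<phi> x \<le> K \<and> \<bar>\<phi>1 x\<bar> \<le> K \<and> \<bar>\<phi>2 x\<bar> \<le> K"
    and \<zeta>: "\<zeta> s1 = - c" "\<zeta> 0 = 0" "\<zeta> s2 = c"
    and dy: "\<And>x. x \<in> {s1..s2} \<Longrightarrow> (y has_real_derivative y1 x) (at x)"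
    and dy1: "\<And>x. x \<in> {s1..s2} \<Longrightarrow> (y1 has_real_derivative (- W x / h\<^sup>2) * y x) (at x)"
    and flux: "0 \<le> y s1 * y1 s1"
    and dA: "\<And>z. (A has_real_derivative A1 z) (at z)"
    and dA1: "\<And>z. (A1 has_real_derivative (- z / h\<^sup>2) * A z) (at z)"
    and init: "A (- c) = 0" "A1 (- c) = 1"
    and small: "6 * (c * K ^ 4) * h\<^sup>2 \<le> m0\<^sup>2 * (c / (2 * K\<^sup>2)) ^ 4"
  shows "\<bar>y s2 * A1 c / \<phi> s2 - y1 s2 * \<phi> s2 * A c\<bar>
     \<le> K * (2 / m0 + 1 / (c * K ^ 4) + K ^ 4 / c + K\<^sup>2 + 3 / c ^ 3 + 1 / c) *
       sqrt ((h\<^sup>2 * (y1 s2)\<^sup>2 + W s2 * (y s2)\<^sup>2) * (h\<^sup>2 * (A1 c)\<^sup>2 + c * (A c)\<^sup>2))"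
proof -
  define Ey where "Ey = (\<lambda>x. h\<^sup>2 * (y1 x)\<^sup>2 + W x * (y x)\<^sup>2)"
  define EA where "EA = (\<lambda>z. h\<^sup>2 * (A1 z)\<^sup>2 + z * (A z)\<^sup>2)"
  define D where "D = K / 2 * (2 / m0 + 1 / (c * K ^ 4) + K ^ 4 / c + K\<^sup>2 + 3 / c ^ 3 + 1 / c)"
  have s12: "s1 \<in> {s1..s2}" "s2 \<in> {s1..s2}" "0 \<in> {s1..s2}" using ord by auto
  have \<phi>pos: "0 < \<phi> x" if "x \<in> {s1..s2}" for x
    using \<phi>b[OF that] K by (smt (verit) divide_pos_pos)
  have \<phi>inv: "1 / \<phi> x \<le> K" if "x \<in> {s1..s2}" for x
    using \<phi>b[OF that] \<phi>pos[OF that] K by (simp add: field_simps)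
  have \<phi>4: "\<phi> x ^ 4 \<le> K ^ 4" "1 / \<phi> x ^ 4 \<le> K ^ 4" "1 / (\<phi> x)\<^sup>2 \<le> K\<^sup>2" "1 / K\<^sup>2 \<le> 1 / (\<phi> x)\<^sup>2"
    if "x \<in> {s1..s2}" for x
  proof -
    have 0: "0 \<le> \<phi> x" "0 \<le> 1 / \<phi> x" using \<phi>pos[OF that] by auto
    have le: "\<phi> x \<le> K" using \<phi>b[OF that] by simp
    show "\<phi> x ^ 4 \<le> K ^ 4" using power_mono[OF le 0(1)] .
    show "1 / \<phi> x ^ 4 \<le> K ^ 4" "1 / (\<phi> x)\<^sup>2 \<le> K\<^sup>2"
      using power_mono[OF \<phi>inv[OF that] 0(2)] by (simp_all add: power_one_over)
    show "1 / K\<^sup>2 \<le> 1 / (\<phi> x)\<^sup>2"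
      using power_mono[OF le 0(1), of 2] \<phi>pos[OF that] K by (intro divide_left_mono) auto
  qed
  have Ws2: "c / K ^ 4 \<le> W s2"
    unfolding W\<zeta>[OF s12(2)] \<zeta> using \<phi>4(1)[OF s12(2)] \<phi>pos[OF s12(2)] c K by (intro divide_left_mono) auto
  have Ws1: "- W s1 \<le> c * K ^ 4"
    using mult_left_mono[OF \<phi>4(2)[OF s12(1)], of c] c by (simp add: W\<zeta>[OF s12(1)] \<zeta>)
  have Ws2pos: "0 < W s2" using Ws2 c K by (smt (verit) divide_pos_pos zero_less_power)
  have s1: "s1 + 2 * (c / (2 * K\<^sup>2)) \<le> 0"
  proof -
    have "\<zeta> 0 - K\<^sup>2 * 0 \<le> \<zeta> s1 - K\<^sup>2 * s1"
    proof -
      have "K\<^sup>2 * s1 - \<zeta> s1 \<le> K\<^sup>2 * 0 - \<zeta> 0"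
      proof (rule nondecreasing_if_DERIV_nonneg[where f = "\<lambda>x. K\<^sup>2 * x - \<zeta> x" and f' = "\<lambda>x. K\<^sup>2 - 1 / (\<phi> x)\<^sup>2"])
        fix t assume "s1 \<le> t" "t \<le> 0"
        then have t: "t \<in> {s1..s2}" using ord by auto
        show "((\<lambda>x. K\<^sup>2 * x - \<zeta> x) has_real_derivative K\<^sup>2 - 1 / (\<phi> t)\<^sup>2) (at t)"
          by (auto intro!: derivative_eq_intros d\<zeta>[OF t])
        show "0 \<le> K\<^sup>2 - 1 / (\<phi> t)\<^sup>2" using \<phi>4(3)[OF t] by simp
      qed (use ord in simp)
      then show ?thesis by simp
    qed
    then have "K\<^sup>2 * s1 \<le> - c" using \<zeta> by simp
    then show ?thesis using K by (simp add: field_simps)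
  qed
  have W0: "W 0 = 0" using W\<zeta>[OF s12(3)] \<zeta> by simp
  have B0: "0 \<le> c * K ^ 4" and l0: "0 < c / (2 * K\<^sup>2)" using c K by auto
  have eb: "c * K ^ 4 * (y s1)\<^sup>2 \<le> Ey s2" "- Ey s1 \<le> Ey s2"
    unfolding Ey_def
    by (rule turning_point_energy_bound[OF h m0 l0 s1 less_imp_le[OF ord(2)] dW W1 W0 Ws1 B0 dy dy1 flux small];
        assumption)+
  have NA: "c ^ 3 / 3 \<le> EA c"
    unfolding EA_def by (rule airy_amplitude_lower_bound[OF c h dA dA1 init])
  have EA0: "0 \<le> EA (- c)" by (simp add: EA_def init)
  have dEA: "(EA has_real_derivative (A z)\<^sup>2) (at z)" for z
  proof -
    have "(EA has_real_derivative (h\<^sup>2 * (2 * A1 z * ((- z / h\<^sup>2) * A z)) + ((A z)\<^sup>2 + (2 * A z * A1 z) * z))) (at z)"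
      unfolding EA_def by (auto intro!: derivative_eq_intros dA dA1)
    also have "h\<^sup>2 * (2 * A1 z * ((- z / h\<^sup>2) * A z)) + ((A z)\<^sup>2 + (2 * A z * A1 z) * z) = (A z)\<^sup>2"
      using h by simp
    finally show ?thesis .
  qed
  have dEy: "(Ey has_real_derivative W1 x * (y x)\<^sup>2) (at x)" if x: "x \<in> {s1..s2}" for x
  proof -
    have "(Ey has_real_derivative (h\<^sup>2 * (2 * y1 x * ((- W x / h\<^sup>2) * y x)) + (W1 x * (y x)\<^sup>2 + (2 * y x * y1 x) * W x))) (at x)"
      unfolding Ey_def
      by (auto intro!: derivative_eq_intros dy[OF x] dy1[OF x] dW[OF x])
    also have "h\<^sup>2 * (2 * y1 x * ((- W x / h\<^sup>2) * y x)) + (W1 x * (y x)\<^sup>2 + (2 * y x * y1 x) * W x) = W1 x * (y x)\<^sup>2"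
      using h by simp
    finally show ?thesis .
  qed
  define q where "q = (\<lambda>x. y x * (\<phi>1 x * A (\<zeta> x) + A1 (\<zeta> x) / \<phi> x) - y1 x * (\<phi> x * A (\<zeta> x)))"
  have dq: "(q has_real_derivative \<phi>2 x * (y x * A (\<zeta> x))) (at x)" if x: "x \<in> {s1..s2}" for x
  proof -
    have nz: "\<phi> x \<noteq> 0" using \<phi>pos[OF x] by simp
    have dAz: "((\<lambda>x. A (\<zeta> x)) has_real_derivative A1 (\<zeta> x) * (1 / (\<phi> x)\<^sup>2)) (at x)"
      by (rule DERIV_chain2[OF dA d\<zeta>[OF x]])
    have dA1z: "((\<lambda>x. A1 (\<zeta> x)) has_real_derivative (- \<zeta> x / h\<^sup>2) * A (\<zeta> x) * (1 / (\<phi> x)\<^sup>2)) (at x)"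
      by (rule DERIV_chain2[OF dA1 d\<zeta>[OF x]])
    have dB: "((\<lambda>x. \<phi> x * A (\<zeta> x)) has_real_derivative \<phi>1 x * A (\<zeta> x) + A1 (\<zeta> x) * (1 / (\<phi> x)\<^sup>2) * \<phi> x) (at x)"
      by (rule DERIV_mult[OF d\<phi>[OF x] dAz])
    have dB1: "((\<lambda>x. \<phi>1 x * A (\<zeta> x) + A1 (\<zeta> x) / \<phi> x) has_real_derivative
        (\<phi>2 x * A (\<zeta> x) + A1 (\<zeta> x) * (1 / (\<phi> x)\<^sup>2) * \<phi>1 x)
        + ((- \<zeta> x / h\<^sup>2) * A (\<zeta> x) * (1 / (\<phi> x)\<^sup>2) * \<phi> x - A1 (\<zeta> x) * \<phi>1 x) / (\<phi> x * \<phi> x)) (at x)"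
      by (rule DERIV_add[OF DERIV_mult[OF d\<phi>1[OF x] dAz] DERIV_divide[OF dA1z d\<phi>[OF x] nz]])
    have "(q has_real_derivative
        (y1 x * (\<phi>1 x * A (\<zeta> x) + A1 (\<zeta> x) / \<phi> x) + ((\<phi>2 x * A (\<zeta> x) + A1 (\<zeta> x) * (1 / (\<phi> x)\<^sup>2) * \<phi>1 x)
        + ((- \<zeta> x / h\<^sup>2) * A (\<zeta> x) * (1 / (\<phi> x)\<^sup>2) * \<phi> x - A1 (\<zeta> x) * \<phi>1 x) / (\<phi> x * \<phi> x)) * y x)
        - ((- W x / h\<^sup>2) * y x * (\<phi> x * A (\<zeta> x)) + (\<phi>1 x * A (\<zeta> x) + A1 (\<zeta> x) * (1 / (\<phi> x)\<^sup>2) * \<phi> x) * y1 x)) (at x)"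
      unfolding q_def
      by (rule DERIV_diff[OF DERIV_mult[OF dy[OF x] dB1] DERIV_mult[OF dy1[OF x] dB]])
    also have "(y1 x * (\<phi>1 x * A (\<zeta> x) + A1 (\<zeta> x) / \<phi> x) + ((\<phi>2 x * A (\<zeta> x) + A1 (\<zeta> x) * (1 / (\<phi> x)\<^sup>2) * \<phi>1 x)
        + ((- \<zeta> x / h\<^sup>2) * A (\<zeta> x) * (1 / (\<phi> x)\<^sup>2) * \<phi> x - A1 (\<zeta> x) * \<phi>1 x) / (\<phi> x * \<phi> x)) * y x)
        - ((- W x / h\<^sup>2) * y x * (\<phi> x * A (\<zeta> x)) + (\<phi>1 x * A (\<zeta> x) + A1 (\<zeta> x) * (1 / (\<phi> x)\<^sup>2) * \<phi> x) * y1 x)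
        = \<phi>2 x * (y x * A (\<zeta> x))"
    proof -
      have e1: "A1 (\<zeta> x) * (1 / (\<phi> x)\<^sup>2) * \<phi> x = A1 (\<zeta> x) / \<phi> x"
        using nz by (simp add: power2_eq_square)
      have e2: "((- \<zeta> x / h\<^sup>2) * A (\<zeta> x) * (1 / (\<phi> x)\<^sup>2) * \<phi> x - A1 (\<zeta> x) * \<phi>1 x) / (\<phi> x * \<phi> x)
          = - (W x / h\<^sup>2) * \<phi> x * A (\<zeta> x) - A1 (\<zeta> x) * (1 / (\<phi> x)\<^sup>2) * \<phi>1 x"
        unfolding W\<zeta>[OF x] using nz h by (simp add: field_simps eval_nat_numeral)
      show ?thesis unfolding e1 e2 by (simp add: algebra_simps)
    qed
    finally show ?thesis .
  qed
  have key: "\<bar>y s2 * A1 c / \<phi> s2 - y1 s2 * \<phi> s2 * A c\<bar> \<le> D * (t * Ey s2 + EA c / t)" if t: "0 < t" for t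
  proof -
    have amgm: "\<bar>a * b\<bar> \<le> (t * a\<^sup>2 + b\<^sup>2 / t) / 2" for a b :: real
    proof -
      have "0 \<le> (t * \<bar>a\<bar> - \<bar>b\<bar>)\<^sup>2 / t" using t by simp
      also have "\<dots> = t * a\<^sup>2 + b\<^sup>2 / t - 2 * \<bar>a * b\<bar>"
        using t by (simp add: power2_diff field_simps abs_mult power2_eq_square)
      finally show ?thesis by simp
    qed
    \<comment> \<open>The two energies are primitives for \<open>y\<^sup>2\<close> and \<open>A(\<zeta>)\<^sup>2\<close>, so \<open>H'\<close> dominates \<open>\<bar>q'\<bar>\<close> by the inequality of means.\<close>
    define H where "H = (\<lambda>x. K / 2 * (t / m0 * Ey x + K\<^sup>2 / t * EA (\<zeta> x)))"
    have dH: "(H has_real_derivative K / 2 * (t / m0 * (W1 x * (y x)\<^sup>2) + K\<^sup>2 / t * ((A (\<zeta> x))\<^sup>2 * (1 / (\<phi> x)\<^sup>2)))) (at x)"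
      if x: "x \<in> {s1..s2}" for x
      unfolding H_def by (intro DERIV_cmult DERIV_add dEy x DERIV_chain2[OF dEA d\<zeta>])
    have q'H': "\<bar>\<phi>2 x * (y x * A (\<zeta> x))\<bar> \<le> K / 2 * (t / m0 * (W1 x * (y x)\<^sup>2) + K\<^sup>2 / t * ((A (\<zeta> x))\<^sup>2 * (1 / (\<phi> x)\<^sup>2)))"
      if x: "x \<in> {s1..s2}" for x
    proof -
      have "\<bar>\<phi>2 x * (y x * A (\<zeta> x))\<bar> \<le> K * ((t * (y x)\<^sup>2 + (A (\<zeta> x))\<^sup>2 / t) / 2)"
        unfolding abs_mult[of "\<phi>2 x"] using \<phi>b[OF x] amgm[of "y x" "A (\<zeta> x)"] K by (intro mult_mono) auto
      also have "\<dots> = K / 2 * (t * (y x)\<^sup>2 + (A (\<zeta> x))\<^sup>2 / t)" by simp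
      also have "\<dots> \<le> K / 2 * (t / m0 * (W1 x * (y x)\<^sup>2) + K\<^sup>2 / t * ((A (\<zeta> x))\<^sup>2 * (1 / (\<phi> x)\<^sup>2)))"
      proof (intro mult_left_mono add_mono)
        have "t / m0 * (m0 * (y x)\<^sup>2) \<le> t / m0 * (W1 x * (y x)\<^sup>2)"
          using W1[OF x] t m0 by (intro mult_left_mono mult_right_mono) auto
        then show "t * (y x)\<^sup>2 \<le> t / m0 * (W1 x * (y x)\<^sup>2)" using m0 by simp
        have "K\<^sup>2 / t * ((A (\<zeta> x))\<^sup>2 * (1 / K\<^sup>2)) \<le> K\<^sup>2 / t * ((A (\<zeta> x))\<^sup>2 * (1 / (\<phi> x)\<^sup>2))"
          using \<phi>4(4)[OF x] t by (intro mult_left_mono) auto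
        then show "(A (\<zeta> x))\<^sup>2 / t \<le> K\<^sup>2 / t * ((A (\<zeta> x))\<^sup>2 * (1 / (\<phi> x)\<^sup>2))" using K by simp
      qed (use K in auto)
      finally show ?thesis .
    qed
    have "q s2 - q s1 \<le> H s2 - H s1"
    proof -
      have "H s1 - q s1 \<le> H s2 - q s2"
      proof (rule nondecreasing_if_DERIV_nonneg[OF _ DERIV_diff[OF dH dq]])
        fix x assume "s1 \<le> x" "x \<le> s2"
        then have x: "x \<in> {s1..s2}" by simp
        then show "x \<in> {s1..s2}" "x \<in> {s1..s2}" by simp_all
        show "0 \<le> K / 2 * (t / m0 * (W1 x * (y x)\<^sup>2) + K\<^sup>2 / t * ((A (\<zeta> x))\<^sup>2 * (1 / (\<phi> x)\<^sup>2)))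
            - \<phi>2 x * (y x * A (\<zeta> x))"
          using abs_le_D1[OF q'H'[OF x]] abs_le_D2[OF q'H'[OF x]] by linarith
      qed (use ord in simp)
      then show ?thesis by simp
    qed
    moreover have "- (q s2 - q s1) \<le> H s2 - H s1"
    proof -
      have "H s1 + q s1 \<le> H s2 + q s2"
      proof (rule nondecreasing_if_DERIV_nonneg[OF _ DERIV_add[OF dH dq]])
        fix x assume "s1 \<le> x" "x \<le> s2"
        then have x: "x \<in> {s1..s2}" by simp
        then show "x \<in> {s1..s2}" "x \<in> {s1..s2}" by simp_all
        show "0 \<le> K / 2 * (t / m0 * (W1 x * (y x)\<^sup>2) + K\<^sup>2 / t * ((A (\<zeta> x))\<^sup>2 * (1 / (\<phi> x)\<^sup>2)))
            + \<phi>2 x * (y x * A (\<zeta> x))"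
          using abs_le_D1[OF q'H'[OF x]] abs_le_D2[OF q'H'[OF x]] by linarith
      qed (use ord in simp)
      then show ?thesis by simp
    qed
    ultimately have 1: "\<bar>q s2 - q s1\<bar> \<le> H s2 - H s1" by linarith
    have 2: "H s2 - H s1 \<le> K / 2 * (t / m0 * (2 * Ey s2) + K\<^sup>2 / t * EA c)"
    proof -
      have "H s2 - H s1 = K / 2 * (t / m0 * (Ey s2 - Ey s1) + K\<^sup>2 / t * (EA c - EA (- c)))"
        unfolding H_def \<zeta> by (simp only: right_diff_distrib distrib_left)
      also have "\<dots> \<le> K / 2 * (t / m0 * (2 * Ey s2) + K\<^sup>2 / t * EA c)"
        using eb(2) EA0 K t m0 by (intro mult_left_mono add_mono) auto
      finally show ?thesis .
    qed
    have 3: "\<bar>q s1\<bar> \<le> K / 2 * (t * (Ey s2 / (c * K ^ 4)) + (3 / c ^ 3) * EA c / t)"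
    proof -
      have "\<bar>q s1\<bar> = 1 / \<phi> s1 * \<bar>y s1 * 1\<bar>"
        using \<phi>pos[OF s12(1)] by (simp add: q_def \<zeta> init)
      also have "\<dots> \<le> K * ((t * (y s1)\<^sup>2 + 1\<^sup>2 / t) / 2)"
        using \<phi>inv[OF s12(1)] amgm[of "y s1" 1] K by (intro mult_mono) auto
      also have "\<dots> = K / 2 * (t * (y s1)\<^sup>2 + 1 / t)" by simp
      also have "\<dots> \<le> K / 2 * (t * (Ey s2 / (c * K ^ 4)) + (3 / c ^ 3) * EA c / t)"
      proof (intro mult_left_mono add_mono divide_right_mono)
        show "(y s1)\<^sup>2 \<le> Ey s2 / (c * K ^ 4)"
          using eb(1) c K by (simp add: pos_le_divide_eq mult.commute)
        show "1 \<le> (3 / c ^ 3) * EA c"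
          using mult_left_mono[OF NA, of "3 / c ^ 3"] c by simp
      qed (use K t in auto)
      finally show ?thesis .
    qed
    have 4: "\<bar>y s2 * \<phi>1 s2 * A c\<bar> \<le> K / 2 * (t * (K ^ 4 / c * Ey s2) + (1 / c) * EA c / t)"
    proof -
      have "\<bar>y s2 * \<phi>1 s2 * A c\<bar> = \<bar>\<phi>1 s2\<bar> * \<bar>y s2 * A c\<bar>" by (simp add: abs_mult)
      also have "\<dots> \<le> K * ((t * (y s2)\<^sup>2 + (A c)\<^sup>2 / t) / 2)"
        using \<phi>b[OF s12(2)] amgm[of "y s2" "A c"] K by (intro mult_mono) auto
      also have "\<dots> = K / 2 * (t * (y s2)\<^sup>2 + (A c)\<^sup>2 / t)" by simp
      also have "\<dots> \<le> K / 2 * (t * (K ^ 4 / c * Ey s2) + (1 / c) * EA c / t)"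
      proof (intro mult_left_mono add_mono divide_right_mono)
        have "c / K ^ 4 * (y s2)\<^sup>2 \<le> W s2 * (y s2)\<^sup>2" using Ws2 by (intro mult_right_mono) auto
        also have "\<dots> \<le> Ey s2" by (simp add: Ey_def)
        finally have "K ^ 4 / c * (c / K ^ 4 * (y s2)\<^sup>2) \<le> K ^ 4 / c * Ey s2"
          using c K by (intro mult_left_mono) auto
        then show "(y s2)\<^sup>2 \<le> K ^ 4 / c * Ey s2" using c K by simp
        have "c * (A c)\<^sup>2 \<le> EA c" by (simp add: EA_def)
        then show "(A c)\<^sup>2 \<le> (1 / c) * EA c" using c by (simp add: field_simps)
      qed (use K t in auto)
      finally show ?thesis .
    qed
    have "y s2 * A1 c / \<phi> s2 - y1 s2 * \<phi> s2 * A c = (q s2 - q s1) + q s1 - y s2 * \<phi>1 s2 * A c"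
      by (simp add: q_def \<zeta> algebra_simps)
    also have "\<bar>\<dots>\<bar> \<le> K / 2 * (t / m0 * (2 * Ey s2) + K\<^sup>2 / t * EA c)
      + K / 2 * (t * (Ey s2 / (c * K ^ 4)) + (3 / c ^ 3) * EA c / t)
      + K / 2 * (t * (K ^ 4 / c * Ey s2) + (1 / c) * EA c / t)"
      using 1 2 3 4 by linarith
    also have "\<dots> = K / 2 * ((2 / m0 + 1 / (c * K ^ 4) + K ^ 4 / c) * (t * Ey s2) + (K\<^sup>2 + 3 / c ^ 3 + 1 / c) * (EA c / t))"
      by (simp add: algebra_simps)
    also have "\<dots> \<le> D * (t * Ey s2 + EA c / t)"
    proof -
      have E0: "0 \<le> t * Ey s2" "0 \<le> EA c / t"
        using t Ws2pos c by (auto simp: Ey_def EA_def)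
      define \<alpha> where "\<alpha> = 2 / m0 + 1 / (c * K ^ 4) + K ^ 4 / c"
      define \<beta> where "\<beta> = K\<^sup>2 + 3 / c ^ 3 + 1 / c"
      have \<alpha>\<beta>: "0 \<le> \<alpha>" "0 \<le> \<beta>" using m0 c K by (auto simp: \<alpha>_def \<beta>_def)
      have D\<alpha>\<beta>: "D = K / 2 * (\<alpha> + \<beta>)" by (simp add: D_def \<alpha>_def \<beta>_def)
      have le: "\<alpha> * (t * Ey s2) + \<beta> * (EA c / t) \<le> (\<alpha> + \<beta>) * (t * Ey s2 + EA c / t)"
        unfolding distrib_left distrib_right
        using mult_nonneg_nonneg[OF \<alpha>\<beta>(1) E0(2)] mult_nonneg_nonneg[OF \<alpha>\<beta>(2) E0(1)] by linarith
      have "K / 2 * (\<alpha> * (t * Ey s2) + \<beta> * (EA c / t)) \<le> K / 2 * ((\<alpha> + \<beta>) * (t * Ey s2 + EA c / t))"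
        by (rule mult_left_mono[OF le]) (use K in simp)
      also have "\<dots> = D * (t * Ey s2 + EA c / t)" unfolding D\<alpha>\<beta> by (simp only: mult.assoc)
      finally show ?thesis unfolding \<alpha>_def \<beta>_def .
    qed
    finally show ?thesis .
  qed
  show ?thesis
  proof (cases "Ey s2 = 0")
    case True
    have "h\<^sup>2 * (y1 s2)\<^sup>2 \<ge> 0" "W s2 * (y s2)\<^sup>2 \<ge> 0" using Ws2pos by auto
    then have "h\<^sup>2 * (y1 s2)\<^sup>2 = 0" "W s2 * (y s2)\<^sup>2 = 0"
      using True unfolding Ey_def by linarith+
    then have "y1 s2 = 0" "y s2 = 0" using h Ws2pos by auto
    then show ?thesis by simp
  next
    case False
    have "0 \<le> Ey s2" using Ws2pos by (simp add: Ey_def)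
    with False have Epos: "0 < Ey s2" by simp
    have "0 < EA c" using NA c by (smt (verit) divide_pos_pos zero_less_power)
    from scaled_bound_imp_geometric_bound[OF key Epos this]
    show ?thesis by (simp add: D_def Ey_def EA_def)
  qed
qed

text \<open>Coefficients of the power series solution of \<open>k f'' = - z f\<close> with \<open>f(0) = p\<close>, \<open>f'(0) = q\<close>.\<close>

fun airy_coeff :: "real \<Rightarrow> real \<Rightarrow> real \<Rightarrow> nat \<Rightarrow> real" where
  "airy_coeff k p q 0 = p"
| "airy_coeff k p q (Suc 0) = q"
| "airy_coeff k p q (Suc (Suc 0)) = 0"
| "airy_coeff k p q (Suc (Suc (Suc n))) = - airy_coeff k p q n / (k * (real n + 3) * (real n + 2))"

lemma summable_airy_coeff:
  assumes k: "0 < k"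
  shows "summable (\<lambda>n. airy_coeff k p q n * x ^ n)"
proof -
  define t where "t = (\<lambda>n. airy_coeff k p q n * x ^ n)"
  obtain N :: nat where N: "8 * \<bar>x\<bar> ^ 3 / k \<le> real N" using real_arch_simple by blast
  have step: "\<bar>t (Suc (Suc (Suc n)))\<bar> \<le> \<bar>t n\<bar> / 8" if n: "N \<le> n" for n
  proof -
    have "8 * \<bar>x\<bar> ^ 3 / k \<le> real n" using N n by linarith
    also have "\<dots> \<le> (real n + 3) * (real n + 2)" by (simp add: algebra_simps)
    finally have le: "8 * \<bar>x\<bar> ^ 3 \<le> k * (real n + 3) * (real n + 2)"
      using k by (simp add: field_simps)
    have pos: "0 < k * (real n + 3) * (real n + 2)" using k by simp
    have "\<bar>t (Suc (Suc (Suc n)))\<bar> = \<bar>t n\<bar> * (\<bar>x\<bar> ^ 3 / (k * (real n + 3) * (real n + 2)))"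
      using pos k by (simp add: t_def abs_mult power_abs eval_nat_numeral)
    also have "\<dots> \<le> \<bar>t n\<bar> * (1 / 8)"
      using le pos by (intro mult_left_mono) (auto simp: divide_le_eq)
    finally show ?thesis by simp
  qed
  define B where "B = (\<Sum>i<N + 3. \<bar>t i\<bar> * 2 ^ i)"
  have bound: "\<bar>t n\<bar> \<le> B * (1 / 2) ^ n" for n
  proof (induction n rule: less_induct)
    case (less n)
    show ?case
    proof (cases "n < N + 3")
      case True
      then have "\<bar>t n\<bar> * 2 ^ n \<le> B" unfolding B_def by (intro member_le_sum) auto
      then show ?thesis by (simp add: power_one_over field_simps)
    next
      case False
      define m where "m = n - 3"
      have m: "n = Suc (Suc (Suc m))" "N \<le> m" using False unfolding m_def by arith+
      have "\<bar>t n\<bar> \<le> \<bar>t m\<bar> / 8" using step[OF m(2)] m(1) by simp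
      also have "\<dots> \<le> B * (1 / 2) ^ m / 8" using less[of m] m(1) by simp
      finally show ?thesis by (simp add: m(1) power_one_over field_simps)
    qed
  qed
  have "summable t"
    by (rule summable_comparison_test'[where g = "\<lambda>n. B * (1 / 2) ^ n" and N = 0])
      (use bound in \<open>auto intro!: summable_mult summable_geometric\<close>)
  then show ?thesis by (simp add: t_def)
qed

lemma airy_solution_with_initial_values:
  assumes k: "0 < k"
  shows "\<exists>f f1 :: real \<Rightarrow> real. (\<forall>z. (f has_real_derivative f1 z) (at z)) \<and>
    (\<forall>z. (f1 has_real_derivative (- z / k) * f z) (at z)) \<and> f 0 = p \<and> f1 0 = q"
proof -
  define a where "a = airy_coeff k p q"
  have sa: "summable (\<lambda>n. a n * x ^ n)" for x
    unfolding a_def by (rule summable_airy_coeff[OF k])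
  have sd: "summable (\<lambda>n. diffs a n * x ^ n)" for x
    by (rule termdiff_converges_all[OF sa])
  have sdd: "summable (\<lambda>n. diffs (diffs a) n * x ^ n)" for x
    by (rule termdiff_converges_all[OF sd])
  define f where "f = (\<lambda>x. \<Sum>n. a n * x ^ n)"
  define f1 where "f1 = (\<lambda>x. \<Sum>n. diffs a n * x ^ n)"
  have df: "(f has_real_derivative f1 z) (at z)" for z
    unfolding f_def f1_def by (rule termdiffs_strong_converges_everywhere[OF sa])
  have "(f1 has_real_derivative (\<Sum>n. diffs (diffs a) n * z ^ n)) (at z)" for z
    unfolding f1_def by (rule termdiffs_strong_converges_everywhere[OF sd])
  moreover have "(\<Sum>n. diffs (diffs a) n * z ^ n) = (- z / k) * f z" for z
  proof -
    have "diffs (diffs a) (Suc n) * z ^ Suc n = (- z / k) * (a n * z ^ n)" for n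
    proof -
      have "diffs (diffs a) (Suc n) = (real n + 2) * ((real n + 3) * a (Suc (Suc (Suc n))))"
        by (simp add: diffs_def add.commute)
      also have "\<dots> = - a n / k * ((real n + 2) * (real n + 3) / ((real n + 3) * (real n + 2)))"
        by (simp add: a_def)
      also have "\<dots> = - a n / k" by (simp add: mult.commute)
      finally show ?thesis by simp
    qed
    then have "(\<Sum>n. diffs (diffs a) (Suc n) * z ^ Suc n) = (- z / k) * f z"
      unfolding f_def using suminf_mult[OF sa[of z], of "- z / k"] by simp
    moreover have "diffs (diffs a) 0 * z ^ 0 = 0"
      by (simp add: diffs_def a_def numeral_2_eq_2)
    ultimately show ?thesis
      using suminf_split_head[OF sdd[of z]] by simp
  qed
  ultimately have df1: "(f1 has_real_derivative (- z / k) * f z) (at z)" for z by simp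
  have "f 0 = p" "f1 0 = q"
    using powser_zero[of a] powser_zero[of "diffs a"] by (simp_all add: f_def f1_def a_def diffs_def)
  with df df1 show ?thesis by blast
qed

text \<open>A solution of \<open>h\<^sup>2 A'' = - z A\<close> together with its derivative. Vanishing at \<open>- c\<close>, deep in the
barrier, replaces decay at \<open>- \<infinity>\<close>: together with the slope 1 it fixes the solution, and the flux is
nonnegative from there on.\<close>

definition airy_pair :: "real \<Rightarrow> real \<Rightarrow> (real \<Rightarrow> real) \<Rightarrow> (real \<Rightarrow> real) \<Rightarrow> bool" where
  "airy_pair c h A A1 \<longleftrightarrow> (\<forall>z. (A has_real_derivative A1 z) (at z)) \<and>
     (\<forall>z. (A1 has_real_derivative (- z / h\<^sup>2) * A z) (at z)) \<and> A (- c) = 0 \<and> A1 (- c) = 1"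

lemma airy_pair_exists:
  assumes h: "0 < h"
  shows "\<exists>A A1. airy_pair c h A A1"
proof -
  have k: "0 < h\<^sup>2" using h by simp
  obtain f f1 where f: "\<And>z. (f has_real_derivative f1 z) (at z)"
    "\<And>z. (f1 has_real_derivative (- z / h\<^sup>2) * f z) (at z)" "f 0 = 1" "f1 0 = 0"
    using airy_solution_with_initial_values[OF k, of 1 0] by blast
  obtain g g1 where g: "\<And>z. (g has_real_derivative g1 z) (at z)"
    "\<And>z. (g1 has_real_derivative (- z / h\<^sup>2) * g z) (at z)" "g 0 = 0" "g1 0 = 1"
    using airy_solution_with_initial_values[OF k, of 0 1] by blast
  have "((\<lambda>z. f z * g1 z - f1 z * g z) has_real_derivative 0) (at z)" for z
    using DERIV_diff[OF DERIV_mult[OF f(1) g(2)] DERIV_mult[OF f(2) g(1)], of z]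
    by (simp add: algebra_simps)
  then have "f (- c) * g1 (- c) - f1 (- c) * g (- c) = f 0 * g1 0 - f1 0 * g 0"
    using DERIV_isconst_all[of "\<lambda>z. f z * g1 z - f1 z * g z"] by blast
  then have wr: "f (- c) * g1 (- c) - g (- c) * f1 (- c) = 1" using f g by (simp add: mult.commute)
  show ?thesis unfolding airy_pair_def
  proof (intro exI conjI allI)
    fix z
    show "((\<lambda>z. f (- c) * g z - g (- c) * f z) has_real_derivative f (- c) * g1 z - g (- c) * f1 z) (at z)"
      by (intro DERIV_diff DERIV_cmult f g)
    have "((\<lambda>z. f (- c) * g1 z - g (- c) * f1 z) has_real_derivative
        f (- c) * ((- z / h\<^sup>2) * g z) - g (- c) * ((- z / h\<^sup>2) * f z)) (at z)"
      by (intro DERIV_diff DERIV_cmult f g)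
    then show "((\<lambda>z. f (- c) * g1 z - g (- c) * f1 z) has_real_derivative
        (- z / h\<^sup>2) * (f (- c) * g z - g (- c) * f z)) (at z)"
      by (simp add: algebra_simps)
  qed (use wr in \<open>auto simp: mult.commute\<close>)
qed

text \<open>The phase of the solution at \<open>z = c\<close> after subtraction of the action \<open>(2/3) c\<^bsup>3/2\<^esup> / h\<close>. It is determined
modulo \<open>2 \<pi>\<close> only, whence the choice.\<close>

definition airy_phase :: "real \<Rightarrow> real \<Rightarrow> real" where
  "airy_phase c h = (SOME \<theta>. \<exists>A A1 R. airy_pair c h A A1 \<and> 0 < R \<and>
     A c / wkb_amp c = R * sin (2 / 3 * (c * sqrt c) / h + \<theta>) \<and>
     h * wkb_amp c * A1 c = R * cos (2 / 3 * (c * sqrt c) / h + \<theta>))"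

lemma polar_coordinates:
  fixes s b :: real
  assumes "s\<^sup>2 + b\<^sup>2 \<noteq> 0"
  obtains R \<beta> where "0 < R" "s = R * sin \<beta>" "b = R * cos \<beta>"
proof -
  define R where "R = sqrt (s\<^sup>2 + b\<^sup>2)"
  have R: "0 < R" "R\<^sup>2 = s\<^sup>2 + b\<^sup>2" using assms by (auto simp: R_def sum_power2_gt_zero_iff)
  have "(b / R)\<^sup>2 + (s / R)\<^sup>2 = 1"
    unfolding power_divide R(2) add_divide_distrib[symmetric] using assms by (simp add: add.commute)
  then obtain t where "b / R = cos t" "s / R = sin t" using sincos_total_2pi by metis
  with R(1) have "s = R * sin t" "b = R * cos t" by (auto simp: field_simps)
  with R(1) show ?thesis by (rule that)
qed

lemma airy_phase:
  assumes "0 < c" "0 < h"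
  shows "\<exists>A A1 R. airy_pair c h A A1 \<and> 0 < R \<and>
     A c / wkb_amp c = R * sin (2 / 3 * (c * sqrt c) / h + airy_phase c h) \<and>
     h * wkb_amp c * A1 c = R * cos (2 / 3 * (c * sqrt c) / h + airy_phase c h)"
proof -
  obtain A A1 where A: "airy_pair c h A A1" using airy_pair_exists[OF assms(2)] by blast
  have "c ^ 3 / 3 \<le> h\<^sup>2 * (A1 c)\<^sup>2 + c * (A c)\<^sup>2"
    using A unfolding airy_pair_def by (intro airy_amplitude_lower_bound[OF assms]) auto
  moreover have "0 < c ^ 3 / 3" using assms by simp
  ultimately have "A c \<noteq> 0 \<or> A1 c \<noteq> 0" by auto
  then have "(A c / wkb_amp c)\<^sup>2 + (h * wkb_amp c * A1 c)\<^sup>2 \<noteq> 0"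
    using wkb_amp_pos[of c] assms(2) by (simp add: sum_power2_eq_zero_iff less_imp_neq[THEN not_sym])
  then obtain R \<beta> where R: "0 < R" "A c / wkb_amp c = R * sin \<beta>" "h * wkb_amp c * A1 c = R * cos \<beta>"
    by (rule polar_coordinates)
  have "\<exists>\<theta>. \<exists>A A1 R. airy_pair c h A A1 \<and> 0 < R \<and>
     A c / wkb_amp c = R * sin (2 / 3 * (c * sqrt c) / h + \<theta>) \<and>
     h * wkb_amp c * A1 c = R * cos (2 / 3 * (c * sqrt c) / h + \<theta>)"
    by (rule exI[of _ "\<beta> - 2 / 3 * (c * sqrt c) / h"]) (use A R in auto)
  from someI_ex[OF this] show ?thesis unfolding airy_phase_def .
qed

lemma wkb_amp_langer: "0 < c \<Longrightarrow> 0 < p \<Longrightarrow> wkb_amp (c / p ^ 4) = p * wkb_amp c"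
proof -
  assume c: "0 < c" and p: "0 < p"
  have "- ln (c / p ^ 4) / 4 = ln p + - ln c / 4"
    using c p by (simp add: ln_div ln_realpow)
  then show ?thesis unfolding wkb_amp_def using p by (simp only: exp_add exp_ln)
qed

text \<open>The bound on the Wronskian, read as a statement about phases: the Wronskian of two solutions is the product
of their amplitudes times the sine of the difference of their angles, divided by \<open>h\<close>.\<close>

lemma turning_point_phase:
  fixes W W1 y y1 \<zeta> \<phi> \<phi>1 \<phi>2 :: "real \<Rightarrow> real"
  assumes h: "0 < h" "h \<le> 1" and m0: "0 < m0" and c: "0 < c" and K: "1 \<le> K" and ord: "s1 < 0" "0 < s2"
    and dW: "\<And>x. x \<in> {s1..s2} \<Longrightarrow> (W has_real_derivative W1 x) (at x)"
    and W1: "\<And>x. x \<in> {s1..s2} \<Longrightarrow> m0 \<le> W1 x \<and> W1 x \<le> M"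
    and langer: "\<And>x. x \<in> {s1..s2} \<Longrightarrow> langer_at W \<zeta> \<phi> \<phi>1 \<phi>2 K x"
    and \<zeta>: "\<zeta> s1 = - c" "\<zeta> 0 = 0" "\<zeta> s2 = c"
    and dy: "\<And>x. x \<in> {s1..s2} \<Longrightarrow> (y has_real_derivative y1 x) (at x)"
    and dy1: "\<And>x. x \<in> {s1..s2} \<Longrightarrow> (y1 has_real_derivative (- W x / h\<^sup>2) * y x) (at x)"
    and flux: "0 \<le> y s1 * y1 s1"
    and small: "6 * (c * K ^ 4) * h\<^sup>2 \<le> m0\<^sup>2 * (c / (2 * K\<^sup>2)) ^ 4"
    and D: "D = K * (2 / m0 + 1 / (c * K ^ 4) + K ^ 4 / c + K\<^sup>2 + 3 / c ^ 3 + 1 / c)"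
    and \<kappa>: "\<kappa> = M / 4 * (K * wkb_amp c) ^ 6"
  shows "phase_near ((D * K / (wkb_amp c)\<^sup>2 * (1 + \<kappa>) + \<kappa>) * h) (2 / 3 * (c * sqrt c) / h + airy_phase c h)
      (y s2 / wkb_amp (W s2)) (h * (wkb_amp (W s2) * y1 s2 + W1 s2 / 4 * wkb_amp (W s2) ^ 5 * y s2))"
proof -
  define \<beta> where "\<beta> = 2 / 3 * (c * sqrt c) / h + airy_phase c h"
  obtain A A1 R where A: "airy_pair c h A A1" and R: "0 < R" "A c / wkb_amp c = R * sin \<beta>"
    "h * wkb_amp c * A1 c = R * cos \<beta>"
    using airy_phase[OF c h(1)] unfolding \<beta>_def by blast
  have s2: "s2 \<in> {s1..s2}" using ord by auto
  define \<phi>s where "\<phi>s = \<phi> s2"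
  have \<phi>: "0 < \<phi>s" "\<phi>s \<le> K" "1 / \<phi>s \<le> K" "W s2 = c / \<phi>s ^ 4"
  proof -
    have 1: "1 / K \<le> \<phi>s" using langer[OF s2] by (simp add: \<phi>s_def langer_at_def)
    then show "0 < \<phi>s" using K by (smt (verit) divide_pos_pos)
    then show "1 / \<phi>s \<le> K" using 1 K by (simp add: field_simps)
  qed (use langer[OF s2] \<zeta> in \<open>auto simp: \<phi>s_def langer_at_def\<close>)
  define ra where "ra = wkb_amp c"
  define r where "r = wkb_amp (W s2)"
  have ra: "0 < ra" "ra ^ 4 * c = 1" using wkb_amp_power4[OF c] by (simp_all add: ra_def)
  have r: "r = \<phi>s * ra" unfolding r_def \<phi>(4) ra_def by (rule wkb_amp_langer[OF c \<phi>(1)])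
  have rpos: "0 < r" by (simp add: r_def)
  have Wpos: "0 < W s2" unfolding \<phi>(4) using c \<phi>(1) by simp
  have rW: "r ^ 4 * W s2 = 1" unfolding r_def by (rule wkb_amp_power4[OF Wpos])
  define Ny where "Ny = h\<^sup>2 * (y1 s2)\<^sup>2 + W s2 * (y s2)\<^sup>2"
  define NA where "NA = h\<^sup>2 * (A1 c)\<^sup>2 + c * (A c)\<^sup>2"
  note A' = A[unfolded airy_pair_def, THEN conjunct1, rule_format]
    A[unfolded airy_pair_def, THEN conjunct2, THEN conjunct1, rule_format]
    A[unfolded airy_pair_def, THEN conjunct2, THEN conjunct2, THEN conjunct1]
    A[unfolded airy_pair_def, THEN conjunct2, THEN conjunct2, THEN conjunct2]
  have W1': "m0 \<le> W1 x" if "x \<in> {s1..s2}" for x using W1[OF that] by simp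
  have lg: "(\<zeta> has_real_derivative 1 / (\<phi> x)\<^sup>2) (at x)" "(\<phi> has_real_derivative \<phi>1 x) (at x)"
    "(\<phi>1 has_real_derivative \<phi>2 x) (at x)" "W x = \<zeta> x / \<phi> x ^ 4"
    "1 / K \<le> \<phi> x \<and> \<phi> x \<le> K \<and> \<bar>\<phi>1 x\<bar> \<le> K \<and> \<bar>\<phi>2 x\<bar> \<le> K" if "x \<in> {s1..s2}" for x
    using langer[OF that] unfolding langer_at_def by auto
  have cmp: "\<bar>y s2 * A1 c / \<phi>s - y1 s2 * \<phi>s * A c\<bar> \<le> D * sqrt (Ny * NA)"
    unfolding Ny_def NA_def D \<phi>s_def
    by (rule airy_comparison[OF h(1) m0 c K ord dW W1' lg \<zeta> dy dy1 flux A' small]; assumption)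
  define u where "u = y s2 / r"
  define b0 where "b0 = h * r * y1 s2"
  have norm_y: "u\<^sup>2 + b0\<^sup>2 = r\<^sup>2 * Ny"
  proof -
    have "r ^ 3 * W s2 * y s2 * r = (r ^ 4 * W s2) * y s2"
      by (simp add: eval_nat_numeral mult_ac)
    then have "u = r ^ 3 * W s2 * y s2"
      unfolding rW u_def using rpos by (intro divide_eq_imp) auto
    then have "u\<^sup>2 = (r ^ 4 * W s2) * (r\<^sup>2 * (W s2 * (y s2)\<^sup>2))"
      by (simp add: eval_nat_numeral mult_ac)
    then show ?thesis unfolding rW Ny_def b0_def by (simp add: power_mult_distrib algebra_simps)
  qed
  have norm_A: "R\<^sup>2 = ra\<^sup>2 * NA"
  proof -
    have "R\<^sup>2 = (A c / ra)\<^sup>2 + (h * ra * A1 c)\<^sup>2"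
      unfolding ra_def R(2,3) by (simp add: power_mult_distrib distrib_left[symmetric])
    moreover have "A c / ra = ra ^ 3 * c * A c"
    proof (rule divide_eq_imp)
      have "ra ^ 3 * c * A c * ra = (ra ^ 4 * c) * A c"
        by (simp add: eval_nat_numeral mult_ac)
      then show "A c = ra ^ 3 * c * A c * ra" unfolding ra(2) by simp
    qed (use ra(1) in simp)
    ultimately have "R\<^sup>2 = (ra ^ 4 * c) * (ra\<^sup>2 * (c * (A c)\<^sup>2)) + (h * ra * A1 c)\<^sup>2"
      by (simp add: eval_nat_numeral mult_ac)
    then show ?thesis unfolding ra(2) NA_def by (simp add: power_mult_distrib algebra_simps)
  qed
  have near0: "phase_near (D * K / ra\<^sup>2 * h) \<beta> u b0"
  proof -
    have "R * (u * cos \<beta> - b0 * sin \<beta>) = u * (R * cos \<beta>) - b0 * (R * sin \<beta>)"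
      by (simp add: algebra_simps)
    also have "\<dots> = u * (h * ra * A1 c) - b0 * (A c / ra)"
      using R(2,3) by (simp add: ra_def)
    also have "\<dots> = h * (y s2 * A1 c / \<phi>s - y1 s2 * \<phi>s * A c)"
      unfolding u_def b0_def r using ra(1) by (simp add: right_diff_distrib)
    also have "\<bar>\<dots>\<bar> \<le> h * (D * sqrt (Ny * NA))"
      unfolding abs_mult using cmp h by (intro mult_mono) auto
    also have "sqrt (Ny * NA) = R * sqrt (u\<^sup>2 + b0\<^sup>2) / (r * ra)"
    proof -
      have "R = ra * sqrt NA"
        using arg_cong[OF norm_A, of sqrt] R(1) ra(1) by (simp add: real_sqrt_mult)
      moreover have "sqrt (u\<^sup>2 + b0\<^sup>2) = r * sqrt Ny"
        unfolding norm_y using rpos by (simp add: real_sqrt_mult)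
      ultimately show ?thesis using ra(1) rpos by (simp add: real_sqrt_mult)
    qed
    also have "h * (D * (R * sqrt (u\<^sup>2 + b0\<^sup>2) / (r * ra))) = R * ((D / (r * ra)) * (h * sqrt (u\<^sup>2 + b0\<^sup>2)))"
      by simp
    finally have "R * \<bar>u * cos \<beta> - b0 * sin \<beta>\<bar> \<le> R * ((D / (r * ra)) * (h * sqrt (u\<^sup>2 + b0\<^sup>2)))"
      using R(1) by (simp only: abs_mult abs_of_pos)
    then have "\<bar>u * cos \<beta> - b0 * sin \<beta>\<bar> \<le> (D / (r * ra)) * (h * sqrt (u\<^sup>2 + b0\<^sup>2))"
      using R(1) by (rule mult_left_le_imp_le)
    also have "\<dots> \<le> (D * K / ra\<^sup>2) * (h * sqrt (u\<^sup>2 + b0\<^sup>2))"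
    proof (intro mult_right_mono)
      have "D \<ge> 0" unfolding D using K m0 c by simp
      have "D / (r * ra) = D / ra\<^sup>2 * (1 / \<phi>s)" by (simp add: r power2_eq_square)
      also have "\<dots> \<le> D / ra\<^sup>2 * K" using \<phi>(3) \<open>D \<ge> 0\<close> by (intro mult_left_mono) auto
      finally show "D / (r * ra) \<le> D * K / ra\<^sup>2" by simp
    qed (use h in auto)
    finally show ?thesis by (simp add: phase_near_def mult.assoc)
  qed
  define b where "b = h * (r * y1 s2 + W1 s2 / 4 * r ^ 5 * y s2)"
  have M0: "0 \<le> M" using W1[OF s2] m0 by linarith
  have db: "\<bar>b - b0\<bar> \<le> h * \<kappa> * \<bar>u\<bar>"
  proof -
    have "b - b0 = h * (W1 s2 / 4 * r ^ 6) * u"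
    proof -
      have "r ^ 6 * u = r ^ 5 * y s2" unfolding u_def using rpos by (simp add: eval_nat_numeral)
      then have "h * (W1 s2 / 4 * r ^ 6) * u = h * (W1 s2 / 4 * (r ^ 5 * y s2))" by (simp only: mult.assoc)
      moreover have "b - b0 = h * (W1 s2 / 4 * (r ^ 5 * y s2))" unfolding b_def b0_def by (simp add: algebra_simps)
      ultimately show ?thesis by (simp only:)
    qed
    also have "\<bar>\<dots>\<bar> = h * \<bar>W1 s2 / 4 * r ^ 6\<bar> * \<bar>u\<bar>"
      using h by (simp add: abs_mult)
    also have "\<dots> \<le> h * \<kappa> * \<bar>u\<bar>"
    proof (intro mult_right_mono mult_left_mono)
      have "r ^ 6 \<le> (K * ra) ^ 6" unfolding r using \<phi> ra by (intro power_mono mult_right_mono) auto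
      then have "W1 s2 / 4 * r ^ 6 \<le> M / 4 * (K * ra) ^ 6"
        using W1[OF s2] m0 rpos M0 by (intro mult_mono) auto
      then show "\<bar>W1 s2 / 4 * r ^ 6\<bar> \<le> \<kappa>" using W1[OF s2] m0 rpos by (simp add: \<kappa> ra_def)
    qed (use h in auto)
    finally show ?thesis .
  qed
  have "0 \<le> \<kappa>" unfolding \<kappa> using M0 K by simp
  moreover have "0 \<le> D * K / ra\<^sup>2" unfolding D using K m0 c by simp
  ultimately have "phase_near ((D * K / ra\<^sup>2 * (1 + \<kappa>) + \<kappa>) * h) \<beta> u b"
    by (intro phase_near_perturb[OF near0 db h])
  then show ?thesis unfolding \<beta>_def u_def b_def r_def ra_def .
qed

section \<open>Half a well, up to a universal phase\<close>

text \<open>Real solutions of \<open>- h\<^sup>2 y'' + v y = lam y\<close> on the line, paired with their derivatives.\<close>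

definition stationary :: "(real \<Rightarrow> real) \<Rightarrow> real \<Rightarrow> real \<Rightarrow> (real \<Rightarrow> real) \<Rightarrow> (real \<Rightarrow> real) \<Rightarrow> bool" where
  "stationary v lam h y y1 \<longleftrightarrow> (\<forall>x. (y has_real_derivative y1 x) (at x) \<and>
     (y1 has_real_derivative ((v x - lam) / h\<^sup>2 * y x)) (at x))"

text \<open>The coordinates \<open>W\<^bsup>1/4\<^esup> y\<close> and \<open>h W\<^bsup>-1/2\<^esup> (W\<^bsup>1/4\<^esup> y)'\<close> of the rotating point, for \<open>W = lam - v\<close>. The second one
changes sign under reflection of the line.\<close>

definition wkb_s :: "(real \<Rightarrow> real) \<Rightarrow> real \<Rightarrow> (real \<Rightarrow> real) \<Rightarrow> real \<Rightarrow> real" where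
  "wkb_s v lam y x = y x / wkb_amp (lam - v x)"

definition wkb_c :: "(real \<Rightarrow> real) \<Rightarrow> (real \<Rightarrow> real) \<Rightarrow> real \<Rightarrow> real \<Rightarrow> (real \<Rightarrow> real) \<Rightarrow> (real \<Rightarrow> real) \<Rightarrow> real \<Rightarrow> real" where
  "wkb_c v v1 lam h y y1 x = h * (wkb_amp (lam - v x) * y1 x - v1 x / 4 * wkb_amp (lam - v x) ^ 5 * y x)"

text \<open>The angle at \<open>m\<close> of every solution with nonnegative flux at \<open>a\<close> is the action plus \<open>\<theta>(h)\<close>, up to \<open>C h\<close> and modulo
\<open>\<pi>\<close>, uniformly for energies near \<open>lam0\<close>. The turning point is \<open>xr\<close>.\<close>

definition half_well_estimate ::
    "(real \<Rightarrow> real) \<Rightarrow> (real \<Rightarrow> real) \<Rightarrow> real \<Rightarrow> real \<Rightarrow> real \<Rightarrow> (real \<Rightarrow> real) \<Rightarrow> real \<Rightarrow> real \<Rightarrow> real \<Rightarrow> bool" where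
  "half_well_estimate v v1 lam0 a m \<theta> e C h0 \<longleftrightarrow> (\<forall>lam h y y1 xr.
      \<bar>lam - lam0\<bar> < e \<and> 0 < h \<and> h < h0 \<and> stationary v lam h y y1 \<and> 0 \<le> y a * y1 a \<and>
      xr \<in> {a<..<m} \<and> v xr = lam \<longrightarrow>
      phase_near (C * h) (integral {xr..m} (\<lambda>t. sqrt (lam - v t)) / h + \<theta> h)
        (wkb_s v lam y m) (wkb_c v v1 lam h y y1 m))"

lemma continuous_on_interval_abs_bound:
  fixes f :: "real \<Rightarrow> real"
  assumes "continuous_on {a..b} f"
  shows "\<exists>M>0. \<forall>x\<in>{a..b}. \<bar>f x\<bar> \<le> M"
proof -
  have "bounded (f ` {a..b})"
    by (intro compact_imp_bounded compact_continuous_image assms compact_Icc)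
  then show ?thesis unfolding bounded_pos by auto
qed

lemma continuous_positive_gap:
  fixes f :: "real \<Rightarrow> real"
  assumes "continuous_on {a..b} f" "\<And>x. x \<in> {a..b} \<Longrightarrow> 0 < f x"
  shows "\<exists>e>0. \<forall>x\<in>{a..b}. e \<le> f x"
proof (cases "{a..b} = {}")
  case False
  then obtain t where "t \<in> {a..b}" "\<forall>x\<in>{a..b}. f t \<le> f x"
    using continuous_attains_inf[OF compact_Icc False assms(1)] by blast
  then show ?thesis using assms(2) by blast
qed (auto intro: exI[of _ 1])

text \<open>A quantitative form of a simple downward crossing of the level \<open>lam0\<close> at \<open>z\<close>: \<open>v\<close> has slope at most \<open>- m0\<close> on
the window of radius \<open>2 d\<close>, and differs from \<open>lam0\<close> by at least \<open>e\<close> outside the window of radius \<open>d\<close>. For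
levels within \<open>e\<close> of \<open>lam0\<close> the crossing point stays in the smaller window, so a neighbourhood of radius \<open>d\<close>
around it is contained in the larger one.\<close>

definition crossing_window :: "(real \<Rightarrow> real) \<Rightarrow> (real \<Rightarrow> real) \<Rightarrow> real \<Rightarrow> real \<Rightarrow> real \<Rightarrow> real \<Rightarrow> real \<Rightarrow> real \<Rightarrow> real \<Rightarrow> bool" where
  "crossing_window v v1 lam0 a z m d m0 e \<longleftrightarrow> 0 < d \<and> 0 < m0 \<and> 0 < e \<and> a < z - 2 * d \<and> z + 2 * d < m \<and>
     (\<forall>x. \<bar>x - z\<bar> \<le> 2 * d \<longrightarrow> v1 x \<le> - m0) \<and>
     (\<forall>x\<in>{a..z - d}. lam0 + e \<le> v x) \<and> (\<forall>x\<in>{z + d..m}. v x \<le> lam0 - e)"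

lemma crossing_window_exists:
  fixes v v1 :: "real \<Rightarrow> real"
  assumes dv: "\<And>x. (v has_real_derivative v1 x) (at x)" and cv1: "isCont v1 z"
    and az: "a < z" "z < m" and vz: "v1 z < 0"
    and above: "\<And>x. a \<le> x \<Longrightarrow> x < z \<Longrightarrow> lam0 < v x" and below: "\<And>x. z < x \<Longrightarrow> x \<le> m \<Longrightarrow> v x < lam0"
    and \<delta>: "0 < \<delta>"
  shows "\<exists>d m0 e. 2 * d < \<delta> \<and> crossing_window v v1 lam0 a z m d m0 e"
proof -
  have cv: "continuous_on S v" for S
    by (intro continuous_at_imp_continuous_on ballI DERIV_isCont[OF dv])
  obtain r where r: "0 < r" "\<And>x. \<bar>x - z\<bar> < r \<Longrightarrow> \<bar>v1 x - v1 z\<bar> < - v1 z / 2"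
    using cv1[unfolded continuous_at_eps_delta, rule_format, of "- v1 z / 2"] vz by (auto simp: dist_real_def)
  define d where "d = Min {r, \<delta>, z - a, m - z} / 4"
  have d: "0 < d" "2 * d < r" "2 * d < \<delta>" "2 * d < z - a" "2 * d < m - z"
    using r(1) \<delta> az unfolding d_def by (auto simp: min_def)
  have "\<exists>e1>0. \<forall>x\<in>{a..z - d}. e1 \<le> v x - lam0"
    by (rule continuous_positive_gap) (use above d(1) cv in \<open>auto intro!: continuous_intros\<close>)
  then obtain e1 where e1: "0 < e1" "\<forall>x\<in>{a..z - d}. e1 \<le> v x - lam0" by blast
  have "\<exists>e2>0. \<forall>x\<in>{z + d..m}. e2 \<le> lam0 - v x"
    by (rule continuous_positive_gap) (use below d(1) cv in \<open>auto intro!: continuous_intros\<close>)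
  then obtain e2 where e2: "0 < e2" "\<forall>x\<in>{z + d..m}. e2 \<le> lam0 - v x" by blast
  have "crossing_window v v1 lam0 a z m d (- v1 z / 2) (min e1 e2)"
    unfolding crossing_window_def
  proof (intro conjI allI impI ballI)
    fix x assume "\<bar>x - z\<bar> \<le> 2 * d"
    then have "\<bar>v1 x - v1 z\<bar> < - v1 z / 2" using r(2)[of x] d(2) by linarith
    then show "v1 x \<le> - (- v1 z / 2)" by linarith
  next
    fix x assume "x \<in> {a..z - d}"
    then show "lam0 + min e1 e2 \<le> v x" using e1 by (force simp: min_le_iff_disj)
  next
    fix x assume "x \<in> {z + d..m}"
    then show "v x \<le> lam0 - min e1 e2" using e2 by (force simp: min_le_iff_disj)
  qed (use d vz e1 e2 in auto)
  with d(3) show ?thesis by blast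
qed

lemma crossing_window_strict:
  fixes v v1 :: "real \<Rightarrow> real"
  assumes dv: "\<And>x. (v has_real_derivative v1 x) (at x)" and cw: "crossing_window v v1 lam0 a z m d m0 e"
    and "s \<le> t" "\<bar>s - z\<bar> \<le> 2 * d" "\<bar>t - z\<bar> \<le> 2 * d"
  shows "v t + m0 * (t - s) \<le> v s"
proof -
  have "- v s - m0 * s \<le> - v t - m0 * t"
  proof (rule nondecreasing_if_DERIV_nonneg[where f = "\<lambda>x. - v x - m0 * x" and f' = "\<lambda>x. - v1 x - m0"])
    fix x assume "s \<le> x" "x \<le> t"
    then have "\<bar>x - z\<bar> \<le> 2 * d" using assms(4,5) by (simp add: abs_le_iff)
    then show "0 \<le> - v1 x - m0" using cw by (force simp: crossing_window_def)
    show "((\<lambda>x. - v x - m0 * x) has_real_derivative - v1 x - m0) (at x)"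
      by (auto intro!: derivative_eq_intros dv)
  qed fact
  then show ?thesis by (simp add: algebra_simps)
qed

lemma crossing_window_root:
  fixes v v1 :: "real \<Rightarrow> real"
  assumes dv: "\<And>x. (v has_real_derivative v1 x) (at x)" and cw: "crossing_window v v1 lam0 a z m d m0 e"
    and lam: "\<bar>lam - lam0\<bar> < e" and x: "x \<in> {a..m}" "v x = lam"
  shows "\<bar>x - z\<bar> < d" "\<And>t. a \<le> t \<Longrightarrow> t < x \<Longrightarrow> lam < v t" "\<And>t. x < t \<Longrightarrow> t \<le> m \<Longrightarrow> v t < lam"
proof -
  note c = cw[unfolded crossing_window_def]
  show xz: "\<bar>x - z\<bar> < d"
  proof (rule ccontr)
    assume "\<not> \<bar>x - z\<bar> < d"
    then have "x \<in> {a..z - d} \<or> x \<in> {z + d..m}" using x by auto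
    then show False using c lam x by fastforce
  qed
  have d: "0 < d" "0 < m0" using c by auto
  show "lam < v t" if t: "a \<le> t" "t < x" for t
  proof (cases "t \<le> z - d")
    case True
    then have "lam0 + e \<le> v t" using c t by auto
    then show ?thesis using lam by linarith
  next
    case False
    have "v x + m0 * (x - t) \<le> v t"
      using t xz False d by (intro crossing_window_strict[OF dv cw]) auto
    moreover have "0 < m0 * (x - t)" using t d by simp
    ultimately show ?thesis using x by linarith
  qed
  show "v t < lam" if t: "x < t" "t \<le> m" for t
  proof (cases "z + d \<le> t")
    case True
    then have "v t \<le> lam0 - e" using c t by auto
    then show ?thesis using lam by linarith
  next
    case False
    have "v t + m0 * (t - x) \<le> v x"
      using t xz False d by (intro crossing_window_strict[OF dv cw]) auto
    moreover have "0 < m0 * (t - x)" using t d by simp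
    ultimately show ?thesis using x by linarith
  qed
qed

lemma crossing_window_root_exists:
  fixes v v1 :: "real \<Rightarrow> real"
  assumes dv: "\<And>x. (v has_real_derivative v1 x) (at x)" and cw: "crossing_window v v1 lam0 a z m d m0 e"
    and lam: "\<bar>lam - lam0\<bar> < e"
  shows "\<exists>x\<in>{a<..<m}. v x = lam"
proof -
  note c = cw[unfolded crossing_window_def]
  have "z - d \<in> {a..z - d}" "z + d \<in> {z + d..m}" using c by auto
  then have "lam0 + e \<le> v (z - d)" "v (z + d) \<le> lam0 - e" using c by blast+
  then have "lam \<le> v (z - d)" "v (z + d) \<le> lam"
    using lam by linarith+
  then have "\<exists>x\<ge>z - d. x \<le> z + d \<and> v x = lam"
    using c by (intro IVT2) (auto intro: DERIV_isCont[OF dv])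
  then obtain x where "z - d \<le> x" "x \<le> z + d" "v x = lam" by blast
  moreover have "a < z - d" "z + d < m" using c by auto
  ultimately show ?thesis by (intro bexI[of _ x]) auto
qed

text \<open>Since \<open>W\<^bsup>1/2\<^esup> = \<zeta>\<^bsup>1/2\<^esup> \<zeta>'\<close>, the action is the same in the variable \<open>\<zeta>\<close> as in the original one.\<close>

lemma integral_sqrt_langer:
  fixes W \<zeta> \<phi> :: "real \<Rightarrow> real"
  assumes b: "a \<le> b" and cW: "continuous_on {a..b} W"
    and d\<zeta>: "\<And>s. s \<in> {a..b} \<Longrightarrow> (\<zeta> has_real_derivative 1 / (\<phi> s)\<^sup>2) (at s)"
    and \<phi>: "\<And>s. s \<in> {a..b} \<Longrightarrow> 0 < \<phi> s \<and> W s = \<zeta> s / \<phi> s ^ 4"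
    and \<zeta>0: "\<zeta> a = 0"
  shows "((\<lambda>s. sqrt (W s)) has_integral 2 / 3 * (\<zeta> b * sqrt (\<zeta> b))) {a..b}"
proof -
  have pos: "0 < \<zeta> s" if "a < s" "s \<le> b" for s
  proof -
    have "\<zeta> a < \<zeta> s"
    proof (rule DERIV_pos_imp_increasing[OF that(1)])
      fix x assume "a \<le> x" "x \<le> s"
      with that have "x \<in> {a..b}" by auto
      then show "\<exists>y. (\<zeta> has_real_derivative y) (at x) \<and> 0 < y"
        using d\<zeta>[of x] \<phi>[of x] by (intro exI[of _ "1 / (\<phi> x)\<^sup>2"]) auto
    qed
    then show ?thesis using \<zeta>0 by simp
  qed
  have c\<zeta>: "continuous_on {a..b} \<zeta>"
    by (intro continuous_at_imp_continuous_on ballI DERIV_isCont[OF d\<zeta>])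
  have "((\<lambda>s. sqrt (W s)) has_integral 2 / 3 * (\<zeta> b * sqrt (\<zeta> b)) - 2 / 3 * (\<zeta> a * sqrt (\<zeta> a))) {a..b}"
  proof (rule fundamental_theorem_of_calculus_interior[where f = "\<lambda>s. 2 / 3 * (\<zeta> s * sqrt (\<zeta> s))", OF b])
    show "continuous_on {a..b} (\<lambda>s. 2 / 3 * (\<zeta> s * sqrt (\<zeta> s)))"
      by (intro continuous_intros c\<zeta>)
    fix s assume s: "s \<in> {a<..<b}"
    then have s': "s \<in> {a..b}" by auto
    have p: "0 < \<zeta> s" "0 < \<phi> s" using pos[of s] s \<phi>[OF s'] by auto
    have dsq: "((\<lambda>s. sqrt (\<zeta> s)) has_real_derivative (inverse (sqrt (\<zeta> s)) / 2 * (1 / (\<phi> s)\<^sup>2))) (at s)"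
      by (rule DERIV_chain2[OF DERIV_real_sqrt[OF p(1)] d\<zeta>[OF s']])
    have "((\<lambda>s. 2 / 3 * (\<zeta> s * sqrt (\<zeta> s))) has_real_derivative
        2 / 3 * (1 / (\<phi> s)\<^sup>2 * sqrt (\<zeta> s) + (inverse (sqrt (\<zeta> s)) / 2 * (1 / (\<phi> s)\<^sup>2)) * \<zeta> s)) (at s)"
      by (intro DERIV_cmult DERIV_mult d\<zeta>[OF s'] dsq)
    moreover have "2 / 3 * (1 / (\<phi> s)\<^sup>2 * sqrt (\<zeta> s) + (inverse (sqrt (\<zeta> s)) / 2 * (1 / (\<phi> s)\<^sup>2)) * \<zeta> s) = sqrt (W s)"
    proof -
      have "\<zeta> s * inverse (sqrt (\<zeta> s)) = sqrt (\<zeta> s)"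
        using p(1) real_div_sqrt[of "\<zeta> s"] by (simp add: divide_inverse)
      then have "2 / 3 * (1 / (\<phi> s)\<^sup>2 * sqrt (\<zeta> s) + (inverse (sqrt (\<zeta> s)) / 2 * (1 / (\<phi> s)\<^sup>2)) * \<zeta> s)
        = 2 / 3 * (1 / (\<phi> s)\<^sup>2 * sqrt (\<zeta> s) + sqrt (\<zeta> s) / 2 * (1 / (\<phi> s)\<^sup>2))"
        by (simp add: mult_ac)
      also have "\<dots> = sqrt (\<zeta> s) / (\<phi> s)\<^sup>2" by (simp add: field_simps)
      also have "\<dots> = sqrt (W s)"
      proof -
        have "sqrt (\<phi> s ^ 4) = (\<phi> s)\<^sup>2"
          using real_sqrt_abs[of "(\<phi> s)\<^sup>2"] by (simp add: power_mult[symmetric])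
        then show ?thesis using \<phi>[OF s'] by (simp add: real_sqrt_divide)
      qed
      finally show ?thesis .
    qed
    ultimately show "((\<lambda>s. 2 / 3 * (\<zeta> s * sqrt (\<zeta> s))) has_vector_derivative sqrt (W s)) (at s)"
      by (simp add: has_real_derivative_iff_has_vector_derivative)
  qed
  then show ?thesis by (simp add: \<zeta>0)
qed

text \<open>The turning point is passed by comparison with the Airy solution up to \<open>\<zeta> = c\<close>, and the rest of the
half well by Liouville-Green transport. The size of \<open>c\<close> is limited by the window on which \<open>v\<close> is of
class \<open>C\<^sup>3\<close>. All admissible \<open>c\<close> are kept, so that two different potentials can be compared through
the same Airy solution.\<close>

lemma half_well_airy_phase:
  fixes v v1 v2 v3 :: "real \<Rightarrow> real"
  assumes dv: "\<And>x. (v has_real_derivative v1 x) (at x)"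
    and dv1: "\<And>x. (v1 has_real_derivative v2 x) (at x)"
    and cv2: "continuous_on UNIV v2"
    and \<delta>: "0 < \<delta>" and dv2: "\<And>x. \<bar>x - z\<bar> < \<delta> \<Longrightarrow> (v2 has_real_derivative v3 x) (at x)"
    and cv3: "continuous_on {z - \<delta><..<z + \<delta>} v3"
    and az: "a < z" "z < m" and vz: "v1 z < 0"
    and above: "\<And>x. a \<le> x \<Longrightarrow> x < z \<Longrightarrow> lam0 < v x" and below: "\<And>x. z < x \<Longrightarrow> x \<le> m \<Longrightarrow> v x < lam0"
  shows "\<exists>c0>0. \<forall>c. 0 < c \<and> c \<le> c0 \<longrightarrow> (\<exists>e>0. \<exists>C\<ge>0. \<exists>h0>0. half_well_estimate v v1 lam0 a m (airy_phase c) e C h0)"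
proof -
  obtain d m0 e where d\<delta>: "2 * d < \<delta>" and cw: "crossing_window v v1 lam0 a z m d m0 e"
    using crossing_window_exists[OF dv DERIV_isCont[OF dv1] az vz above below \<delta>] by blast
  note c' = cw[unfolded crossing_window_def]
  have pos: "0 < d" "0 < m0" "0 < e" and win: "a < z - 2 * d" "z + 2 * d < m" using c' by auto
  have cont: "continuous_on S v" "continuous_on S v1" "continuous_on S v2" for S
    by (auto intro!: continuous_at_imp_continuous_on DERIV_isCont[OF dv] DERIV_isCont[OF dv1])
      (use cv2 in \<open>simp add: continuous_on_eq_continuous_at\<close>)
  obtain M1 where M1: "0 < M1" "\<forall>x\<in>{a..m}. \<bar>v1 x\<bar> \<le> M1"
    using continuous_on_interval_abs_bound[OF cont(2)] by blast
  obtain M2 where M2: "0 < M2" "\<forall>x\<in>{a..m}. \<bar>v2 x\<bar> \<le> M2"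
    using continuous_on_interval_abs_bound[OF cont(3)] by blast
  have "continuous_on {z - 2 * d..z + 2 * d} v3"
    by (rule continuous_on_subset[OF cv3]) (use d\<delta> in auto)
  then obtain M3 where M3: "0 < M3" "\<forall>x\<in>{z - 2 * d..z + 2 * d}. \<bar>v3 x\<bar> \<le> M3"
    using continuous_on_interval_abs_bound by blast
  define M where "M = m0 + M1 + M2 + M3"
  have M: "m0 \<le> M" "M1 \<le> M" "M2 \<le> M" "M3 \<le> M" "0 < M" using M1 M2 M3 pos by (auto simp: M_def)
  obtain K where K: "1 \<le> K" and langer: "\<forall>W W1 W2 W3 :: real \<Rightarrow> real. \<forall>d. W 0 = 0 \<and> continuous_on {-d<..<d} W3 \<and>
      (\<forall>s. \<bar>s\<bar> < d \<longrightarrow> simple_zero_bounds W W1 W2 W3 m0 M s) \<longrightarrow>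
      (\<exists>\<zeta> \<phi> \<phi>1 \<phi>2 :: real \<Rightarrow> real. \<zeta> 0 = 0 \<and> (\<forall>s. \<bar>s\<bar> < d \<longrightarrow>
        langer_at W \<zeta> \<phi> \<phi>1 \<phi>2 K s))"
    using langer_map[OF pos(2) M(1)] by blast
  \<comment> \<open>Since \<open>\<zeta>' \<ge> K\<^bsup>-2\<^esup>\<close>, the values \<open>\<plusminus> c\<close> of \<open>\<zeta>\<close> are attained at distance at most \<open>d / 2\<close> for \<open>c \<le> c0\<close>.\<close>
  define c0 where "c0 = d / 2 / K\<^sup>2"
  have "0 < c0" using pos K by (simp add: c0_def)
  moreover have "\<exists>e>0. \<exists>C\<ge>0. \<exists>h0>0. half_well_estimate v v1 lam0 a m (airy_phase c) e C h0" if c: "0 < c" "c \<le> c0" for c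
  proof -
    \<comment> \<open>A lower bound for \<open>W\<close> beyond \<open>\<zeta> = c\<close>: the slope inside the window, the gap \<open>e / 2\<close> outside.\<close>
    define w0 where "w0 = min (m0 * (c / K\<^sup>2)) (e / 2)"
    have w0: "0 < w0" using pos c K by (simp add: w0_def)
    define KK where "KK = M / 4 * wkb_amp w0 ^ 6 + 5 / 16 * M\<^sup>2 * wkb_amp w0 ^ 10"
    have KK: "0 \<le> KK" using M by (simp add: KK_def)
    define \<kappa> where "\<kappa> = M / 4 * (K * wkb_amp c) ^ 6"
    define D where "D = K * (2 / m0 + 1 / (c * K ^ 4) + K ^ 4 / c + K\<^sup>2 + 3 / c ^ 3 + 1 / c)"
    define Ct where "Ct = D * K / (wkb_amp c)\<^sup>2 * (1 + \<kappa>) + \<kappa>"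
    have Ct: "0 \<le> Ct" unfolding Ct_def D_def \<kappa>_def using K M pos c by simp
    define C where "C = (Ct + KK * (m - a)) * exp (KK * (m - a) / 2)"
    have C: "0 \<le> C" using Ct KK az by (simp add: C_def)
    define X where "X = m0\<^sup>2 * (c / (2 * K\<^sup>2)) ^ 4"
    \<comment> \<open>For \<open>h \<le> 1\<close> the smallness condition on \<open>h\<^sup>2\<close> follows from the same condition on \<open>h\<close>.\<close>
    define h0 where "h0 = min 1 (X / (6 * (c * K ^ 4)))"
    have X: "0 < X" using pos c K by (simp add: X_def)
    have h0: "0 < h0" using X c K by (simp add: h0_def)
    have "phase_near (C * h) (integral {xr..m} (\<lambda>t. sqrt (lam - v t)) / h + airy_phase c h)
        (wkb_s v lam y m) (wkb_c v v1 lam h y y1 m)"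
      if lam: "\<bar>lam - lam0\<bar> < e / 2" and h: "0 < h" "h < h0" and st: "stationary v lam h y y1"
        and fl: "0 \<le> y a * y1 a" and xr: "xr \<in> {a<..<m}" "v xr = lam" for lam h y y1 xr
    proof -
      have h1: "h \<le> 1" using h by (simp add: h0_def)
      have small: "6 * (c * K ^ 4) * h\<^sup>2 \<le> X"
      proof -
        have "h\<^sup>2 \<le> h" using h(1) h1 by (simp add: power2_eq_square mult_left_le)
        also have "\<dots> \<le> X / (6 * (c * K ^ 4))" using h(2) by (simp add: h0_def)
        finally show ?thesis using c K by (simp add: field_simps)
      qed
      have lame: "\<bar>lam - lam0\<bar> < e" using lam pos by linarith
      have xr': "xr \<in> {a..m}" using xr by auto
      note root = crossing_window_root[OF dv cw lame xr' xr(2)]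
      have dy: "(y has_real_derivative y1 x) (at x)" and dy1: "(y1 has_real_derivative ((v x - lam) / h\<^sup>2 * y x)) (at x)"
        for x using st by (auto simp: stationary_def)
      define W where "W = (\<lambda>s. lam - v (xr + s))"
      define W1 where "W1 = (\<lambda>s. - v1 (xr + s))"
      define W2 where "W2 = (\<lambda>s. - v2 (xr + s))"
      define W3 where "W3 = (\<lambda>s. - v3 (xr + s))"
      have sh: "((\<lambda>s. f (xr + s)) has_real_derivative f' (xr + s)) (at s)"
        if "(f has_real_derivative f' (xr + s)) (at (xr + s))" for f f' :: "real \<Rightarrow> real" and s
      proof -
        have "((\<lambda>s. xr + s) has_real_derivative 1) (at s)" by (auto intro!: derivative_eq_intros)
        from DERIV_chain2[where f = f and g = "\<lambda>s. xr + s", OF that this] show ?thesis by simp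
      qed
      have dW: "(W has_real_derivative W1 s) (at s)" for s
        unfolding W_def W1_def using DERIV_diff[OF DERIV_const sh[of v v1 s, OF dv], of lam] by simp
      have dW1: "(W1 has_real_derivative W2 s) (at s)" for s
        unfolding W1_def W2_def using DERIV_minus[OF sh[of v1 v2 s, OF dv1]] by simp
      have winx: "\<bar>xr + s - z\<bar> < 2 * d" if "\<bar>s\<bar> < d" for s using root(1) that by linarith
      have "W 0 = 0 \<and> continuous_on {-d<..<d} W3 \<and>
        (\<forall>s. \<bar>s\<bar> < d \<longrightarrow> simple_zero_bounds W W1 W2 W3 m0 M s)"
        unfolding simple_zero_bounds_def
      proof (intro conjI allI impI dW dW1)
        show "W 0 = 0" using xr by (simp add: W_def)
        show "continuous_on {-d<..<d} W3"
          unfolding W3_def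
          by (intro continuous_intros continuous_on_compose2[OF cv3])
            (use winx d\<delta> in \<open>force simp: abs_less_iff\<close>)
        fix s assume s: "\<bar>s\<bar> < d"
        note ws = winx[OF s]
        then have "\<bar>xr + s - z\<bar> < \<delta>" using d\<delta> by linarith
        then show "(W2 has_real_derivative W3 s) (at s)"
          unfolding W2_def W3_def using DERIV_minus[OF sh[of v2 v3 s, OF dv2]] by simp
        have ins: "xr + s \<in> {a..m}" "xr + s \<in> {z - 2 * d..z + 2 * d}" using ws win by (auto simp: abs_less_iff)
        have "v1 (xr + s) \<le> - m0" using c' ws by (meson less_imp_le)
        then show "m0 \<le> W1 s" by (simp add: W1_def)
        have "\<bar>v1 (xr + s)\<bar> \<le> M1" "\<bar>v2 (xr + s)\<bar> \<le> M2" "\<bar>v3 (xr + s)\<bar> \<le> M3"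
          using M1 M2 M3 ins by auto
        then show "W1 s \<le> M" "\<bar>W2 s\<bar> \<le> M" "\<bar>W3 s\<bar> \<le> M"
          using M unfolding W1_def W2_def W3_def by linarith+
      qed
      with langer obtain \<zeta> \<phi> \<phi>1 \<phi>2 :: "real \<Rightarrow> real" where \<zeta>0: "\<zeta> 0 = 0" and lg: "\<And>s. \<bar>s\<bar> < d \<Longrightarrow>
        langer_at W \<zeta> \<phi> \<phi>1 \<phi>2 K s" by blast
      note lg' = lg[unfolded langer_at_def]
      have \<phi>pos: "0 < \<phi> s" if "\<bar>s\<bar> < d" for s
        using lg'[OF that] K by (smt (verit) divide_pos_pos)
      have slope: "1 / K\<^sup>2 \<le> 1 / (\<phi> s)\<^sup>2" "1 / (\<phi> s)\<^sup>2 \<le> K\<^sup>2" if "\<bar>s\<bar> < d" for s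
      proof -
        have "(\<phi> s)\<^sup>2 \<le> K\<^sup>2" using lg'[OF that] \<phi>pos[OF that] by (intro power_mono) auto
        then show "1 / K\<^sup>2 \<le> 1 / (\<phi> s)\<^sup>2" using \<phi>pos[OF that] K by (intro divide_left_mono) auto
        have "1 / \<phi> s \<le> K" using lg'[OF that] \<phi>pos[OF that] K by (auto simp: field_simps)
        then have "(1 / \<phi> s)\<^sup>2 \<le> K\<^sup>2" using \<phi>pos[OF that] by (intro power_mono) auto
        then show "1 / (\<phi> s)\<^sup>2 \<le> K\<^sup>2" by (simp add: power_one_over)
      qed
      have growth: "(t - s) / K\<^sup>2 \<le> \<zeta> t - \<zeta> s" "\<zeta> t - \<zeta> s \<le> K\<^sup>2 * (t - s)"
        if "s \<le> t" "\<bar>s\<bar> < d" "\<bar>t\<bar> < d" for s t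
      proof -
        have in_d: "\<bar>x\<bar> < d" if "s \<le> x" "x \<le> t" for x using that \<open>\<bar>s\<bar> < d\<close> \<open>\<bar>t\<bar> < d\<close> by linarith
        have "\<zeta> s - s / K\<^sup>2 \<le> \<zeta> t - t / K\<^sup>2"
        proof (rule nondecreasing_if_DERIV_nonneg[where f = "\<lambda>x. \<zeta> x - x / K\<^sup>2" and f' = "\<lambda>x. 1 / (\<phi> x)\<^sup>2 - 1 / K\<^sup>2"])
          fix x assume "s \<le> x" "x \<le> t"
          note x = in_d[OF this]
          then have "(\<zeta> has_real_derivative 1 / (\<phi> x)\<^sup>2) (at x)" using lg' by blast
          then show "((\<lambda>x. \<zeta> x - x / K\<^sup>2) has_real_derivative 1 / (\<phi> x)\<^sup>2 - 1 / K\<^sup>2) (at x)"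
            by (intro DERIV_diff DERIV_cdivide DERIV_ident)
          show "0 \<le> 1 / (\<phi> x)\<^sup>2 - 1 / K\<^sup>2" using slope[OF x] by simp
        qed fact
        then show "(t - s) / K\<^sup>2 \<le> \<zeta> t - \<zeta> s" by (simp add: diff_divide_distrib)
        have "K\<^sup>2 * s - \<zeta> s \<le> K\<^sup>2 * t - \<zeta> t"
        proof (rule nondecreasing_if_DERIV_nonneg[where f = "\<lambda>x. K\<^sup>2 * x - \<zeta> x" and f' = "\<lambda>x. K\<^sup>2 - 1 / (\<phi> x)\<^sup>2"])
          fix x assume "s \<le> x" "x \<le> t"
          note x = in_d[OF this]
          then have "(\<zeta> has_real_derivative 1 / (\<phi> x)\<^sup>2) (at x)" using lg' by blast
          then show "((\<lambda>x. K\<^sup>2 * x - \<zeta> x) has_real_derivative K\<^sup>2 - 1 / (\<phi> x)\<^sup>2) (at x)"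
            by (auto intro!: derivative_eq_intros)
          show "0 \<le> K\<^sup>2 - 1 / (\<phi> x)\<^sup>2" using slope[OF x] by simp
        qed fact
        then show "\<zeta> t - \<zeta> s \<le> K\<^sup>2 * (t - s)" by (simp add: right_diff_distrib)
      qed
      have \<zeta>cont: "isCont \<zeta> s" if "\<bar>s\<bar> < d" for s using lg'[OF that] DERIV_isCont by blast
      have "c \<le> \<zeta> (d / 2)" using growth(1)[of 0 "d / 2"] \<zeta>0 pos c by (simp add: c0_def)
      then have "\<exists>s\<ge>0. s \<le> d / 2 \<and> \<zeta> s = c"
        using \<zeta>0 c pos by (intro IVT) (auto intro!: \<zeta>cont)
      then obtain s2 where s2: "0 \<le> s2" "s2 \<le> d / 2" "\<zeta> s2 = c" by blast
      have "\<zeta> (- (d / 2)) \<le> - c" using growth(1)[of "- (d / 2)" 0] \<zeta>0 pos c by (simp add: c0_def)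
      then have "\<exists>s\<ge>- (d / 2). s \<le> 0 \<and> \<zeta> s = - c"
        using \<zeta>0 c pos by (intro IVT) (auto intro!: \<zeta>cont)
      then obtain s1 where s1: "- (d / 2) \<le> s1" "s1 \<le> 0" "\<zeta> s1 = - c" by blast
      have ord: "s1 < 0" "0 < s2" using s1 s2 \<zeta>0 c by (auto simp: less_le)
      have in_d: "\<bar>s\<bar> < d" if "s \<in> {s1..s2}" for s using that s1 s2 pos by (auto simp: abs_less_iff)
      have s2low: "c / K\<^sup>2 \<le> s2"
        using growth(2)[of 0 s2] s2 \<zeta>0 pos K by (simp add: divide_le_eq mult.commute)
      define p where "p = xr + s2"
      have xrd: "\<bar>xr - z\<bar> < d" by (rule root(1))
      have p: "xr < p" "p < m" using ord s2 win xrd pos by (auto simp: p_def abs_less_iff)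
      have start: "phase_near (Ct * h) (2 / 3 * (c * sqrt c) / h + airy_phase c h)
        (y p / wkb_amp (lam - v p)) (h * (wkb_amp (lam - v p) * y1 p + (- v1 p) / 4 * wkb_amp (lam - v p) ^ 5 * y p))"
      proof -
        have "phase_near ((D * K / (wkb_amp c)\<^sup>2 * (1 + \<kappa>) + \<kappa>) * h) (2 / 3 * (c * sqrt c) / h + airy_phase c h)
          (y (xr + s2) / wkb_amp (W s2)) (h * (wkb_amp (W s2) * y1 (xr + s2) + W1 s2 / 4 * wkb_amp (W s2) ^ 5 * y (xr + s2)))"
        proof (rule turning_point_phase[OF h(1) h1 pos(2) c(1) K ord dW _ _ s1(3) \<zeta>0 s2(3)])
          fix s assume s: "s \<in> {s1..s2}"
          note sd = in_d[OF s]
          show "m0 \<le> W1 s \<and> W1 s \<le> M"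
          proof -
            have "v1 (xr + s) \<le> - m0" using c' winx[OF sd] by (meson less_imp_le)
            moreover have "xr + s \<in> {a..m}" using winx[OF sd] win by (auto simp: abs_less_iff)
            then have "\<bar>v1 (xr + s)\<bar> \<le> M" using M1 M by force
            ultimately show ?thesis by (auto simp: W1_def)
          qed
          show "langer_at W \<zeta> \<phi> \<phi>1 \<phi>2 K s" by (rule lg[OF sd])
          show "((\<lambda>s. y (xr + s)) has_real_derivative y1 (xr + s)) (at s)" by (rule sh[of y y1 s, OF dy])
          have "((\<lambda>s. y1 (xr + s)) has_real_derivative (v (xr + s) - lam) / h\<^sup>2 * y (xr + s)) (at s)"
            by (rule sh[of y1 "\<lambda>x. (v x - lam) / h\<^sup>2 * y x" s, OF dy1])
          then show "((\<lambda>s. y1 (xr + s)) has_real_derivative - W s / h\<^sup>2 * y (xr + s)) (at s)"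
            by (simp add: W_def)
        next
          have "y a * y1 a \<le> y (xr + s1) * y1 (xr + s1)"
          proof (rule barrier_flux_mono[where k = "\<lambda>x. (v x - lam) / h\<^sup>2", OF _ dy dy1])
            show "a \<le> xr + s1" using xrd win s1 pos by (auto simp: abs_less_iff)
            fix x assume "x \<in> {a..xr + s1}"
            then have "lam < v x" using root(2)[of x] ord by auto
            then show "0 \<le> (v x - lam) / h\<^sup>2" by simp
          qed
          then show "0 \<le> y (xr + s1) * y1 (xr + s1)" using fl by linarith
        qed (use small D_def \<kappa>_def in \<open>simp_all add: X_def\<close>)
        then show ?thesis by (simp add: Ct_def W_def W1_def p_def)
      qed
      define S where "S = (\<lambda>x. integral {xr..x} (\<lambda>t. sqrt (lam - v t)))"
      have csq: "continuous_on T (\<lambda>t. sqrt (lam - v t))" for T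
        by (intro continuous_intros cont)
      have Sp: "S p = 2 / 3 * (c * sqrt c)"
      proof -
        have "((\<lambda>x. sqrt (lam - v x)) has_integral 2 / 3 * (\<zeta> (p - xr) * sqrt (\<zeta> (p - xr)))) {xr..p}"
        proof (rule integral_sqrt_langer[where \<zeta> = "\<lambda>x. \<zeta> (x - xr)" and \<phi> = "\<lambda>x. \<phi> (x - xr)"])
          show "continuous_on {xr..p} (\<lambda>x. lam - v x)" by (intro continuous_intros cont)
          fix x assume "x \<in> {xr..p}"
          then have x: "\<bar>x - xr\<bar> < d" using in_d[of "x - xr"] ord by (auto simp: p_def)
          have "((\<lambda>x. \<zeta> (x - xr)) has_real_derivative 1 / (\<phi> (x - xr))\<^sup>2 * 1) (at x)"
            using lg'[OF x] by (intro DERIV_chain2[of \<zeta>]) (auto intro!: derivative_eq_intros)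
          then show "((\<lambda>x. \<zeta> (x - xr)) has_real_derivative 1 / (\<phi> (x - xr))\<^sup>2) (at x)" by simp
          show "0 < \<phi> (x - xr) \<and> lam - v x = \<zeta> (x - xr) / \<phi> (x - xr) ^ 4"
            using lg'[OF x] \<phi>pos[OF x] by (simp add: W_def)
        qed (use p \<zeta>0 in auto)
        then show ?thesis unfolding S_def by (simp add: integral_unique p_def s2)
      qed
      have Wlow: "w0 \<le> lam - v x" if x: "x \<in> {p..m}" for x
      proof (cases "x \<le> z + d")
        case True
        have "v x + m0 * (x - xr) \<le> v xr"
          using x True p xrd pos by (intro crossing_window_strict[OF dv cw]) (auto simp: abs_less_iff abs_le_iff)
        moreover have "m0 * (c / K\<^sup>2) \<le> m0 * (x - xr)"
          using s2low x pos by (intro mult_left_mono) (auto simp: p_def)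
        ultimately show ?thesis using xr by (simp add: w0_def)
      next
        case False
        then have "v x \<le> lam0 - e" using c' x by auto
        moreover have "w0 \<le> e / 2" unfolding w0_def by (rule min.cobounded2)
        ultimately show ?thesis using lam by linarith
      qed
      have pa: "x \<in> {a..m}" if "x \<in> {p..m}" for x using that p xr by auto
      have "phase_near ((Ct + KK * (m - a)) * exp (KK * (m - a) / 2) * h) (S m / h + airy_phase c h)
        (y m / wkb_amp (lam - v m)) (h * (wkb_amp (lam - v m) * y1 m + (- v1 m) / 4 * wkb_amp (lam - v m) ^ 5 * y m))"
      proof (rule wkb_transport[where W = "\<lambda>x. lam - v x" and ?W1.0 = "\<lambda>x. - v1 x" and ?W2.0 = "\<lambda>x. - v2 x" and S = S and y = y and ?y1.0 = y1 and p = p])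
        show "p \<le> m" "m - p \<le> m - a" using p xr by auto
        show "phase_near (Ct * h) (S p / h + airy_phase c h) (y p / wkb_amp (lam - v p))
          (h * (wkb_amp (lam - v p) * y1 p + - v1 p / 4 * wkb_amp (lam - v p) ^ 5 * y p))"
          using start by (simp add: Sp)
        fix x assume x: "x \<in> {p..m}"
        show "0 < lam - v x" using Wlow[OF x] w0 by linarith
        show "((\<lambda>x. lam - v x) has_real_derivative - v1 x) (at x)"
          using DERIV_diff[OF DERIV_const dv, of lam] by simp
        show "((\<lambda>x. - v1 x) has_real_derivative - v2 x) (at x)" by (rule DERIV_minus[OF dv1])
        show "(S has_real_derivative sqrt (lam - v x)) (at x)"
        proof -
          have "(S has_real_derivative sqrt (lam - v x)) (at x within {xr..m + 1})"
            unfolding S_def by (rule integral_has_real_derivative[OF csq]) (use x p in auto)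
          then show ?thesis using x p by (subst (asm) at_within_Icc_at) auto
        qed
        show "(y has_real_derivative y1 x) (at x)" by (rule dy)
        show "(y1 has_real_derivative - (lam - v x) / h\<^sup>2 * y x) (at x)" using dy1[of x] by simp
        have b: "\<bar>v1 x\<bar> \<le> M" "\<bar>v2 x\<bar> \<le> M" using M1 M2 M pa[OF x] by (auto intro: order_trans)
        have am: "0 \<le> wkb_amp (lam - v x)" "wkb_amp (lam - v x) \<le> wkb_amp w0"
          using wkb_amp_antimono[OF w0 Wlow[OF x]] less_imp_le[OF wkb_amp_pos] by blast+
        have "\<bar>- v2 x / 4 * wkb_amp (lam - v x) ^ 6\<bar> \<le> M / 4 * wkb_amp w0 ^ 6"
          unfolding abs_mult using b am M by (intro mult_mono) (auto intro: power_mono)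
        moreover have "\<bar>5 / 16 * (- v1 x)\<^sup>2 * wkb_amp (lam - v x) ^ 10\<bar> \<le> 5 / 16 * M\<^sup>2 * wkb_amp w0 ^ 10"
        proof -
          have "\<bar>v1 x\<bar>\<^sup>2 \<le> M\<^sup>2" using b by (intro power_mono) auto
          then have "5 / 16 * (- v1 x)\<^sup>2 * wkb_amp (lam - v x) ^ 10 \<le> 5 / 16 * M\<^sup>2 * wkb_amp w0 ^ 10"
            using am by (intro mult_mono) (auto intro: power_mono)
          then show ?thesis using am by simp
        qed
        ultimately show "\<bar>- v2 x / 4 * wkb_amp (lam - v x) ^ 6 - 5 / 16 * (- v1 x)\<^sup>2 * wkb_amp (lam - v x) ^ 10\<bar> \<le> KK"
          unfolding KK_def by linarith
      qed (use h h1 KK Ct in auto)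
      then show ?thesis by (simp add: C_def S_def wkb_s_def wkb_c_def)
    qed
    then have "half_well_estimate v v1 lam0 a m (airy_phase c) (e / 2) C h0"
      unfolding half_well_estimate_def by blast
    then show ?thesis using C h0 half_gt_zero[OF pos(3)] by blast
  qed
  ultimately show ?thesis by blast
qed

section \<open>The universal phase from the harmonic oscillator\<close>

text \<open>A negative flux at \<open>a\<close> stays below its value there on the whole half-line to the left, so that \<open>y\<^sup>2\<close>, whose
derivative is twice the flux, grows at least linearly.\<close>

lemma stationary_flux_grows:
  assumes st: "stationary v lam h y y1" and v: "\<And>x. x \<le> a \<Longrightarrow> lam \<le> v x"
    and neg: "y a * y1 a < 0" and x: "x \<le> a"
  shows "- 2 * (y a * y1 a) * (a - x) \<le> (y x)\<^sup>2"
proof -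
  define \<eta> where "\<eta> = y a * y1 a"
  have dy: "(y has_real_derivative y1 x) (at x)" and dy1: "(y1 has_real_derivative ((v x - lam) / h\<^sup>2 * y x)) (at x)" for x
    using st by (auto simp: stationary_def)
  have flux: "y t * y1 t \<le> \<eta>" if "t \<le> a" for t
    unfolding \<eta>_def by (rule barrier_flux_mono[where k = "\<lambda>x. (v x - lam) / h\<^sup>2", OF that dy dy1]) (use v in auto)
  have "- (y x)\<^sup>2 + 2 * \<eta> * x \<le> - (y a)\<^sup>2 + 2 * \<eta> * a"
  proof (rule nondecreasing_if_DERIV_nonneg[where f = "\<lambda>x. - (y x)\<^sup>2 + 2 * \<eta> * x" and f' = "\<lambda>x. - 2 * (y x * y1 x) + 2 * \<eta>"])
    fix t assume "x \<le> t" "t \<le> a"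
    then show "0 \<le> - 2 * (y t * y1 t) + 2 * \<eta>" using flux[of t] by simp
    show "((\<lambda>x. - (y x)\<^sup>2 + 2 * \<eta> * x) has_real_derivative - 2 * (y t * y1 t) + 2 * \<eta>) (at t)"
      by (auto intro!: derivative_eq_intros dy)
  qed fact
  then have "- 2 * \<eta> * (a - x) \<le> (y x)\<^sup>2 - (y a)\<^sup>2" by (simp add: algebra_simps)
  then show ?thesis unfolding \<eta>_def using zero_le_power2[of "y a"] by linarith
qed

text \<open>Hermite polynomials with Planck's constant \<open>h\<close>: \<open>y\<^sub>n = hermite_poly h n \<cdot> exp (- x\<^sup>2 / (2 h))\<close> arises from
\<open>y\<^sub>0\<close> by repeated application of \<open>x - h d/dx\<close>.\<close>

fun hermite_poly :: "real \<Rightarrow> nat \<Rightarrow> real poly" where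
  "hermite_poly h 0 = 1"
| "hermite_poly h (Suc n) = [:0, 2:] * hermite_poly h n - smult h (pderiv (hermite_poly h n))"

lemma pderiv_hermite_poly_Suc: "pderiv (hermite_poly h (Suc n)) = smult (2 * real (Suc n)) (hermite_poly h n)"
proof (induction n)
  case 0
  show ?case by (simp add: pderiv_pCons)
next
  case (Suc n)
  define q where "q = hermite_poly h n"
  define r where "r = hermite_poly h (Suc n)"
  have r: "r = [:0, 2:] * q - smult h (pderiv q)" by (simp add: r_def q_def)
  have dr: "pderiv r = smult (2 * real (Suc n)) q" using Suc by (simp add: r_def q_def)
  have "pderiv (hermite_poly h (Suc (Suc n))) = pderiv ([:0, 2:] * r - smult h (pderiv r))"
    by (simp add: r_def)
  also have "\<dots> = smult 2 r + [:0, 2:] * pderiv r - smult h (pderiv (pderiv r))"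
    by (simp add: pderiv_diff pderiv_mult pderiv_smult pderiv_pCons)
  also have "\<dots> = smult 2 r + smult (2 * real (Suc n)) ([:0, 2:] * q - smult h (pderiv q))"
    unfolding dr by (simp add: pderiv_smult smult_diff_right mult.commute[of h])
  also have "\<dots> = smult (2 * real (Suc (Suc n))) r"
    unfolding r[symmetric] by (simp add: smult_add_left[symmetric])
  finally show ?case by (simp add: r_def)
qed

lemma hermite_poly_ode:
  "h * poly (pderiv (pderiv (hermite_poly h n))) x = 2 * x * poly (pderiv (hermite_poly h n)) x - 2 * real n * poly (hermite_poly h n) x"
proof -
  define q where "q = hermite_poly h n"
  have "pderiv (hermite_poly h (Suc n)) = smult 2 q + [:0, 2:] * pderiv q - smult h (pderiv (pderiv q))"
    by (simp add: q_def pderiv_diff pderiv_mult pderiv_smult pderiv_pCons)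
  then have "poly (smult (2 * real (Suc n)) q) x = poly (smult 2 q + [:0, 2:] * pderiv q - smult h (pderiv (pderiv q))) x"
    unfolding q_def[symmetric] pderiv_hermite_poly_Suc[of h n, folded q_def] by simp
  then show ?thesis unfolding q_def by (simp add: algebra_simps)
qed

text \<open>Parity of the Hermite polynomials, as far as it is visible at the origin.\<close>

lemma hermite_poly_at_0:
  assumes "0 < h"
  shows "poly (hermite_poly h (2 * k)) 0 \<noteq> 0" "poly (hermite_poly h (Suc (2 * k))) 0 = 0"
proof -
  have rec: "poly (hermite_poly h (Suc (Suc n))) 0 = - h * (2 * real (Suc n)) * poly (hermite_poly h n) 0" for n
    using arg_cong[OF pderiv_hermite_poly_Suc[of h n], of "\<lambda>p. poly p 0"] by (simp del: hermite_poly.simps add: hermite_poly.simps(2)[of h "Suc n"])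
  show "poly (hermite_poly h (2 * k)) 0 \<noteq> 0"
  proof (induction k)
    case (Suc k)
    then show ?case using rec[of "2 * k"] assms by (simp del: hermite_poly.simps)
  qed simp
  show "poly (hermite_poly h (Suc (2 * k))) 0 = 0"
  proof (induction k)
    case (Suc k)
    then show ?case using rec[of "Suc (2 * k)"] by (simp del: hermite_poly.simps)
  qed (simp add: pderiv_pCons)
qed

lemma poly_times_gaussian_bounded:
  fixes p :: "real poly"
  assumes "0 < h"
  shows "\<exists>B. \<forall>x. \<bar>poly p x\<bar> * exp (- x\<^sup>2 / (2 * h)) \<le> B"
  using assms
proof (induction p arbitrary: h)
  case 0
  show ?case by (intro exI[of _ 0]) simp
next
  case (pCons a p)
  obtain B where B: "\<And>x. \<bar>poly p x\<bar> * exp (- x\<^sup>2 / (2 * (2 * h))) \<le> B"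
    using pCons.IH[of "2 * h"] pCons.prems by auto
  have "0 \<le> B" using B[of 0] by (smt (verit) abs_ge_zero exp_ge_zero mult_nonneg_nonneg)
  have x_le: "\<bar>x\<bar> * exp (- x\<^sup>2 / (4 * h)) \<le> 1 + 4 * h" for x
  proof -
    have "\<bar>x\<bar> \<le> 1 + x\<^sup>2"
      using sum_squares_bound[of "\<bar>x\<bar>" 1] by simp
    also have "\<dots> \<le> (1 + 4 * h) * (1 + x\<^sup>2 / (4 * h))"
      using pCons.prems by (simp add: field_simps)
    also have "\<dots> \<le> (1 + 4 * h) * exp (x\<^sup>2 / (4 * h))"
      using pCons.prems by (intro mult_left_mono exp_ge_add_one_self) auto
    finally have "\<bar>x\<bar> * exp (- x\<^sup>2 / (4 * h)) \<le> (1 + 4 * h) * exp (x\<^sup>2 / (4 * h)) * exp (- x\<^sup>2 / (4 * h))"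
      by (rule mult_right_mono) simp
    also have "\<dots> = 1 + 4 * h" by (simp add: mult.assoc exp_add[symmetric])
    finally show ?thesis .
  qed
  show ?case
  proof (intro exI allI)
    fix x
    have "\<bar>poly (pCons a p) x\<bar> * exp (- x\<^sup>2 / (2 * h)) \<le> (\<bar>a\<bar> + \<bar>x\<bar> * \<bar>poly p x\<bar>) * exp (- x\<^sup>2 / (2 * h))"
      using abs_triangle_ineq[of a "x * poly p x"] by (intro mult_right_mono) (auto simp: abs_mult)
    also have "\<dots> = \<bar>a\<bar> * exp (- x\<^sup>2 / (2 * h)) + (\<bar>x\<bar> * exp (- x\<^sup>2 / (4 * h))) * (\<bar>poly p x\<bar> * exp (- x\<^sup>2 / (2 * (2 * h))))"
    proof -
      have "exp (- x\<^sup>2 / (2 * h)) = exp (- x\<^sup>2 / (4 * h)) * exp (- x\<^sup>2 / (2 * (2 * h)))"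
        using pCons.prems by (simp add: exp_add[symmetric] field_simps)
      then show ?thesis by (simp add: algebra_simps)
    qed
    also have "\<dots> \<le> \<bar>a\<bar> * 1 + (1 + 4 * h) * B"
      using pCons.prems B x_le \<open>0 \<le> B\<close> by (intro add_mono mult_mono) auto
    finally show "\<bar>poly (pCons a p) x\<bar> * exp (- x\<^sup>2 / (2 * h)) \<le> \<bar>a\<bar> * 1 + (1 + 4 * h) * B" .
  qed
qed

lemma hermite_function_stationary:
  fixes h :: real and n :: nat
  assumes h: "0 < h"
  defines "y \<equiv> \<lambda>x. poly (hermite_poly h n) x * exp (- x\<^sup>2 / (2 * h))"
    and "y1 \<equiv> \<lambda>x. (poly (pderiv (hermite_poly h n)) x - x / h * poly (hermite_poly h n) x) * exp (- x\<^sup>2 / (2 * h))"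
  shows "stationary (\<lambda>x. x\<^sup>2) (h * (2 * real n + 1)) h y y1"
  unfolding stationary_def
proof (intro allI conjI)
  fix x
  define p where "p = hermite_poly h n"
  define g where "g = (\<lambda>x::real. exp (- x\<^sup>2 / (2 * h)))"
  have dg: "(g has_real_derivative (- x / h * g x)) (at x)"
    unfolding g_def using h by (auto intro!: derivative_eq_intros)
  have y: "y = (\<lambda>x. poly p x * g x)" "y1 = (\<lambda>x. (poly (pderiv p) x - x / h * poly p x) * g x)"
    by (simp_all add: y_def y1_def p_def g_def)
  have "(y has_real_derivative (poly (pderiv p) x * g x + (- x / h * g x) * poly p x)) (at x)"
    unfolding y by (rule DERIV_mult[OF poly_DERIV dg])
  then show "(y has_real_derivative y1 x) (at x)" unfolding y by (simp add: algebra_simps)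
  have "((\<lambda>x. poly (pderiv p) x - x / h * poly p x) has_real_derivative
      (poly (pderiv (pderiv p)) x - (1 / h * poly p x + poly (pderiv p) x * (x / h)))) (at x)"
    by (intro DERIV_diff DERIV_mult poly_DERIV DERIV_cdivide DERIV_ident)
  then have "(y1 has_real_derivative ((poly (pderiv (pderiv p)) x - (1 / h * poly p x + poly (pderiv p) x * (x / h))) * g x
      + (- x / h * g x) * (poly (pderiv p) x - x / h * poly p x))) (at x)"
    unfolding y by (rule DERIV_mult[OF _ dg])
  moreover have "(poly (pderiv (pderiv p)) x - (1 / h * poly p x + poly (pderiv p) x * (x / h))) * g x
      + (- x / h * g x) * (poly (pderiv p) x - x / h * poly p x) = (x\<^sup>2 - h * (2 * real n + 1)) / h\<^sup>2 * y x"
  proof -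
    have c: "poly (pderiv (pderiv p)) x = (2 * x * poly (pderiv p) x - 2 * real n * poly p x) / h"
      using hermite_poly_ode[of h n x] h by (simp add: p_def field_simps)
    show ?thesis unfolding y c using h by (simp add: field_simps power2_eq_square)
  qed
  ultimately show "(y1 has_real_derivative ((x\<^sup>2 - h * (2 * real n + 1)) / h\<^sup>2 * y x)) (at x)" by simp
qed

lemma integral_quarter_disc:
  assumes E: "0 < E"
  shows "integral {- sqrt E..0} (\<lambda>t. sqrt (E - t\<^sup>2)) = pi * E / 4"
proof -
  define F where "F = (\<lambda>t. (t * sqrt (E - t\<^sup>2) + E * arcsin (t / sqrt E)) / 2)"
  have sE: "0 < sqrt E" "sqrt E * sqrt E = E" using E by auto
  have "((\<lambda>t. sqrt (E - t\<^sup>2)) has_integral F 0 - F (- sqrt E)) {- sqrt E..0}"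
  proof (rule fundamental_theorem_of_calculus_interior)
    show "continuous_on {- sqrt E..0} F"
    proof -
      have "- 1 \<le> t / sqrt E \<and> t / sqrt E \<le> 1" if "t \<in> {- sqrt E..0}" for t
        using that sE(1) by (simp add: pos_le_divide_eq pos_divide_le_eq)
      then have c2: "continuous_on {- sqrt E..0} (\<lambda>t. arcsin (t / sqrt E))"
        using sE(1) by (intro continuous_on_arcsin continuous_intros) auto
      have c1: "continuous_on {- sqrt E..0} (\<lambda>t. t * sqrt (E - t\<^sup>2))"
        by (intro continuous_intros)
      show ?thesis
        unfolding F_def
        by (rule continuous_on_divide[OF continuous_on_add[OF c1 continuous_on_mult[OF continuous_on_const c2]]
              continuous_on_const]) simp
    qed
    fix t assume t: "t \<in> {- sqrt E<..<0}"
    then have "\<bar>t\<bar>\<^sup>2 < (sqrt E)\<^sup>2" by (intro power_strict_mono) auto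
    then have lt: "t\<^sup>2 < E" using E by simp
    define s where "s = sqrt (E - t\<^sup>2)"
    have s: "0 < s" "s * s = E - t\<^sup>2" using lt by (auto simp: s_def)
    have r: "-1 < t / sqrt E" "t / sqrt E < 1"
      using t sE(1) by (simp_all add: pos_less_divide_eq pos_divide_less_eq)
    have sq: "sqrt (1 - (t / sqrt E)\<^sup>2) = s / sqrt E"
    proof -
      have "1 - (t / sqrt E)\<^sup>2 = (E - t\<^sup>2) / E" using E by (simp add: power_divide diff_divide_distrib)
      then show ?thesis by (simp add: s_def real_sqrt_divide)
    qed
    have d1: "((\<lambda>t. sqrt (E - t\<^sup>2)) has_real_derivative (inverse s / 2 * (- (2 * t)))) (at t)"
      unfolding s_def using lt
      by (intro DERIV_chain2[OF DERIV_real_sqrt]) (auto intro!: derivative_eq_intros)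
    have d2: "((\<lambda>t. arcsin (t / sqrt E)) has_real_derivative (inverse (sqrt (1 - (t / sqrt E)\<^sup>2)) * (1 / sqrt E))) (at t)"
      by (rule DERIV_chain2[OF DERIV_arcsin[OF r] DERIV_cdivide[OF DERIV_ident]])
    have dF: "(F has_real_derivative ((1 * s + (inverse s / 2 * (- (2 * t))) * t
        + E * (inverse (sqrt (1 - (t / sqrt E)\<^sup>2)) * (1 / sqrt E))) / 2)) (at t)"
      unfolding F_def s_def
      by (intro DERIV_cdivide DERIV_add DERIV_mult DERIV_cmult DERIV_ident d1[unfolded s_def] d2)
    have F': "(1 * s + (inverse s / 2 * (- (2 * t))) * t
        + E * (inverse (sqrt (1 - (t / sqrt E)\<^sup>2)) * (1 / sqrt E))) / 2 = s"
    proof -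
      have e: "E * (inverse (s / sqrt E) * (1 / sqrt E)) = E * inverse s" using sE(1) by (simp add: divide_inverse)
      have alg: "(1 * s + (k / 2 * (- (2 * t))) * t + E * k) / 2 = (s + (E - t\<^sup>2) * k) / 2" for k
        by (simp add: left_diff_distrib power2_eq_square)
      have "(1 * s + (inverse s / 2 * (- (2 * t))) * t
        + E * (inverse (sqrt (1 - (t / sqrt E)\<^sup>2)) * (1 / sqrt E))) / 2 = (s + (E - t\<^sup>2) * inverse s) / 2"
        unfolding sq e by (rule alg)
      also have "\<dots> = (s + s * s * inverse s) / 2" by (simp only: s(2))
      also have "\<dots> = s" using s(1) by simp
      finally show ?thesis .
    qed
    show "(F has_vector_derivative sqrt (E - t\<^sup>2)) (at t)"
      using dF unfolding F' has_real_derivative_iff_has_vector_derivative s_def[symmetric] .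
  qed (use sE in auto)
  moreover have "F 0 - F (- sqrt E) = pi * E / 4"
  proof -
    have e1: "- sqrt E / sqrt E = - 1" using sE(1) by simp
    have e2: "(- sqrt E)\<^sup>2 = E" using E by simp
    have "F (- sqrt E) = - (pi * E / 4)" unfolding F_def e1 e2 arcsin_minus_1 by simp
    moreover have "F 0 = 0" by (simp add: F_def)
    ultimately show ?thesis by simp
  qed
  ultimately show ?thesis by (simp add: integral_unique)
qed

lemma abs_sin_add_npi: "\<bar>sin (x + real k * pi)\<bar> = \<bar>sin x\<bar>"
  by (simp add: sin_add abs_mult)

text \<open>The oscillator at energy \<open>E = h (2 n + 1)\<close> has a bounded solution whose value or derivative vanishes at 0,
according to the parity of \<open>n\<close>. The half-well estimate for it involves the action \<open>\<pi> E / 4\<close>, that is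
\<open>\<pi> (2 n + 1) / 4\<close> in units of \<open>h\<close>, and is an equation for the phase of the Airy solution.\<close>

lemma airy_phase_near_quarter_pi:
  "\<exists>c0>0. \<forall>c. 0 < c \<and> c \<le> c0 \<longrightarrow> (\<exists>C\<ge>0. \<exists>h0>0. \<forall>h. 0 < h \<and> h < h0 \<longrightarrow> \<bar>sin (airy_phase c h - pi / 4)\<bar> \<le> C * h)"
proof -
  have "\<exists>c0>0. \<forall>c. 0 < c \<and> c \<le> c0 \<longrightarrow> (\<exists>e>0. \<exists>C\<ge>0. \<exists>h0>0. half_well_estimate (\<lambda>x. x\<^sup>2) (\<lambda>x. 2 * x) 1 (-2) 0 (airy_phase c) e C h0)"
  proof (rule half_well_airy_phase[where ?v2.0 = "\<lambda>_. 2" and ?v3.0 = "\<lambda>_. 0" and z = "-1" and \<delta> = 1])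
    fix x :: real
    show "((\<lambda>x. x\<^sup>2) has_real_derivative 2 * x) (at x)" by (auto intro!: derivative_eq_intros)
    show "((\<lambda>x. 2 * x) has_real_derivative 2) (at x)" by (auto intro!: derivative_eq_intros)
    show "1 < x\<^sup>2" if "-2 \<le> x" "x < -1"
      using power_strict_mono[of 1 "- x" 2] that by simp
    show "x\<^sup>2 < 1" if "-1 < x" "x \<le> 0"
      using power_strict_mono[of "- x" 1 2] that by simp
  qed auto
  then obtain c0 where c0: "0 < c0" and H: "\<forall>c. 0 < c \<and> c \<le> c0 \<longrightarrow> (\<exists>e>0. \<exists>C\<ge>0. \<exists>h0>0. half_well_estimate (\<lambda>x. x\<^sup>2) (\<lambda>x. 2 * x) 1 (-2) 0 (airy_phase c) e C h0)" by (elim exE conjE)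
  have "\<exists>C\<ge>0. \<exists>h0>0. \<forall>h. 0 < h \<and> h < h0 \<longrightarrow> \<bar>sin (airy_phase c h - pi / 4)\<bar> \<le> C * h"
    if c: "0 < c" "c \<le> c0" for c
  proof -
    from H[rule_format, OF conjI[OF c]] obtain e C h0 where e: "0 < e" and C: "0 \<le> C" and h0: "0 < h0"
      and P: "half_well_estimate (\<lambda>x. x\<^sup>2) (\<lambda>x. 2 * x) 1 (-2) 0 (airy_phase c) e C h0"
      by (elim exE conjE)
    have "\<bar>sin (airy_phase c h - pi / 4)\<bar> \<le> C * h" if h: "0 < h" "h < Min {h0, e / 2, 1 / 4}" for h
    proof -
      have hb: "h < h0" "2 * h < e" "h < 1 / 4" using h by auto
      \<comment> \<open>The largest \<open>n\<close> with \<open>h (2 n + 1) \<le> 1\<close>, so that the energy differs from 1 by less than \<open>2 h\<close>.\<close>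
      define n where "n = nat \<lfloor>(1 / h - 1) / 2\<rfloor>"
      have "0 \<le> (1 / h - 1) / 2" using h hb by (simp add: field_simps)
      then have n: "real n \<le> (1 / h - 1) / 2" "(1 / h - 1) / 2 < real n + 1"
        unfolding n_def by linarith+
      define E where "E = h * (2 * real n + 1)"
      have E1: "E \<le> 1" "1 - 2 * h < E"
        using n h by (auto simp: E_def field_simps)
      have E0: "0 < E" using E1 hb by linarith
      define y where "y = (\<lambda>x. poly (hermite_poly h n) x * exp (- x\<^sup>2 / (2 * h)))"
      define y1 where "y1 = (\<lambda>x. (poly (pderiv (hermite_poly h n)) x - x / h * poly (hermite_poly h n) x) * exp (- x\<^sup>2 / (2 * h)))"
      have st: "stationary (\<lambda>x. x\<^sup>2) E h y y1"
        unfolding y_def y1_def E_def by (rule hermite_function_stationary[OF h(1)])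
      have flux: "0 \<le> y (-2) * y1 (-2)"
      proof (rule ccontr)
        assume "\<not> 0 \<le> y (-2) * y1 (-2)"
        then have neg: "y (-2) * y1 (-2) < 0" by simp
        define \<eta> where "\<eta> = - 2 * (y (-2) * y1 (-2))"
        have \<eta>: "0 < \<eta>" using neg unfolding \<eta>_def by linarith
        obtain B where B: "\<And>x. \<bar>y x\<bar> \<le> B"
          using poly_times_gaussian_bounded[OF h(1), of "hermite_poly h n"] by (auto simp: y_def abs_mult)
        have "\<eta> * (-2 - x) \<le> B\<^sup>2" if x: "x \<le> -2" for x
        proof -
          have "\<eta> * (-2 - x) \<le> (y x)\<^sup>2"
            unfolding \<eta>_def
          proof (rule stationary_flux_grows[OF st _ neg x])
            fix t :: real assume "t \<le> -2"
            then have "1\<^sup>2 \<le> (- t)\<^sup>2" by (intro power_mono) auto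
            then show "E \<le> t\<^sup>2" using E1 by simp
          qed
          also have "\<dots> \<le> B\<^sup>2" using power_mono[OF B[of x] abs_ge_zero, of 2] by simp
          finally show ?thesis .
        qed
        from this[of "-2 - (B\<^sup>2 + 1) / \<eta>"] \<eta> show False by (simp add: field_simps)
      qed
      have "sqrt E < 2" using E1 by (simp add: real_less_lsqrt)
      then have xr: "- sqrt E \<in> {-2<..<0}" "(- sqrt E)\<^sup>2 = E" using E0 by auto
      define \<alpha> where "\<alpha> = (2 * real n + 1) * pi / 4 + airy_phase c h"
      have near: "phase_near (C * h) \<alpha> (wkb_s (\<lambda>x. x\<^sup>2) E y 0) (wkb_c (\<lambda>x. x\<^sup>2) (\<lambda>x. 2 * x) E h y y1 0)"
      proof -
        have "\<bar>E - 1\<bar> < e" using E1 hb by linarith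
        from P[unfolded half_well_estimate_def, rule_format, OF conjI[OF this conjI[OF h(1) conjI[OF hb(1) conjI[OF st conjI[OF flux conjI[OF xr]]]]]]]
        have "phase_near (C * h) (pi * E / 4 / h + airy_phase c h)
          (wkb_s (\<lambda>x. x\<^sup>2) E y 0) (wkb_c (\<lambda>x. x\<^sup>2) (\<lambda>x. 2 * x) E h y y1 0)"
          unfolding integral_quarter_disc[OF E0] .
        moreover have "pi * E / 4 / h + airy_phase c h = \<alpha>"
          using h(1) by (simp add: \<alpha>_def E_def)
        ultimately show ?thesis by simp
      qed
      have s0: "wkb_s (\<lambda>x. x\<^sup>2) E y 0 = poly (hermite_poly h n) 0 / wkb_amp E" by (simp add: wkb_s_def y_def)
      have b0: "wkb_c (\<lambda>x. x\<^sup>2) (\<lambda>x. 2 * x) E h y y1 0 = h * wkb_amp E * poly (pderiv (hermite_poly h n)) 0"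
        by (simp add: wkb_c_def y1_def)
      show ?thesis
      proof (cases "even n")
        case True
        then obtain k where k: "n = 2 * k" by (rule evenE)
        have "poly (pderiv (hermite_poly h n)) 0 = 0"
        proof (cases k)
          case (Suc j)
          then show ?thesis using pderiv_hermite_poly_Suc[of h "Suc (2 * j)"] hermite_poly_at_0(2)[OF h(1), of j]
            by (simp add: k del: hermite_poly.simps)
        qed (simp add: k)
        then have b: "wkb_c (\<lambda>x. x\<^sup>2) (\<lambda>x. 2 * x) E h y y1 0 = 0" by (simp add: b0)
        have s: "wkb_s (\<lambda>x. x\<^sup>2) E y 0 \<noteq> 0"
          using hermite_poly_at_0(1)[OF h(1), of k] wkb_amp_pos[of E] by (simp add: s0 k less_imp_neq[THEN not_sym])
        have "\<bar>cos \<alpha>\<bar> \<le> C * h" using near s by (simp add: phase_near_def b abs_mult)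
        moreover have "\<alpha> = (airy_phase c h - pi / 4 + real k * pi) + pi / 2"
          by (simp add: \<alpha>_def k field_simps)
        then have "\<bar>cos \<alpha>\<bar> = \<bar>sin (airy_phase c h - pi / 4 + real k * pi)\<bar>"
          by (simp only: cos_add) simp
        ultimately show ?thesis by (simp only: abs_sin_add_npi)
      next
        case False
        then obtain k where k: "n = Suc (2 * k)" by (auto elim: oddE)
        have s: "wkb_s (\<lambda>x. x\<^sup>2) E y 0 = 0" using hermite_poly_at_0(2)[OF h(1), of k] by (simp add: s0 k del: hermite_poly.simps)
        have "poly (pderiv (hermite_poly h n)) 0 \<noteq> 0"
          using pderiv_hermite_poly_Suc[of h "2 * k"] hermite_poly_at_0(1)[OF h(1), of k]
          by (simp add: k del: hermite_poly.simps)
        then have b: "wkb_c (\<lambda>x. x\<^sup>2) (\<lambda>x. 2 * x) E h y y1 0 \<noteq> 0"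
          using wkb_amp_pos[of E] h(1) by (simp add: b0 less_imp_neq[THEN not_sym])
        have "\<bar>sin \<alpha>\<bar> \<le> C * h" using near b by (simp add: phase_near_def s abs_mult)
        moreover have "\<alpha> = airy_phase c h - pi / 4 + real (Suc k) * pi"
          by (simp add: \<alpha>_def k field_simps)
        ultimately show ?thesis by (simp only: abs_sin_add_npi)
      qed
    qed
    moreover have "0 < Min {h0, e / 2, 1 / 4}" using h0 e by simp
    ultimately show ?thesis using C by blast
  qed
  with c0 show ?thesis by blast
qed

section \<open>Quantization in a single well\<close>

text \<open>One value of \<open>c\<close> that is small enough for both the given potential and the oscillator turns the
universal phase into \<open>\<pi> / 4\<close>.\<close>

lemma half_well_phase:
  fixes v v1 v2 v3 :: "real \<Rightarrow> real"
  assumes dv: "\<And>x. (v has_real_derivative v1 x) (at x)"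
    and dv1: "\<And>x. (v1 has_real_derivative v2 x) (at x)"
    and cv2: "continuous_on UNIV v2"
    and \<delta>: "0 < \<delta>" and dv2: "\<And>x. \<bar>x - z\<bar> < \<delta> \<Longrightarrow> (v2 has_real_derivative v3 x) (at x)"
    and cv3: "continuous_on {z - \<delta><..<z + \<delta>} v3"
    and az: "a < z" "z < m" and vz: "v1 z < 0"
    and above: "\<And>x. a \<le> x \<Longrightarrow> x < z \<Longrightarrow> lam0 < v x" and below: "\<And>x. z < x \<Longrightarrow> x \<le> m \<Longrightarrow> v x < lam0"
  shows "\<exists>e>0. \<exists>C\<ge>0. \<exists>h0>0. half_well_estimate v v1 lam0 a m (\<lambda>_. pi / 4) e C h0"
proof -
  from airy_phase_near_quarter_pi obtain c1 where c1: "0 < c1"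
    and A: "\<forall>c. 0 < c \<and> c \<le> c1 \<longrightarrow> (\<exists>C\<ge>0. \<exists>h0>0. \<forall>h. 0 < h \<and> h < h0 \<longrightarrow> \<bar>sin (airy_phase c h - pi / 4)\<bar> \<le> C * h)"
    by (elim exE conjE)
  have "\<exists>c0>0. \<forall>c. 0 < c \<and> c \<le> c0 \<longrightarrow> (\<exists>e>0. \<exists>C\<ge>0. \<exists>h0>0. half_well_estimate v v1 lam0 a m (airy_phase c) e C h0)"
    by (rule half_well_airy_phase[OF dv dv1 cv2 \<delta> dv2 cv3 az vz above below]; assumption)
  then obtain c0 where c0: "0 < c0"
    and B: "\<forall>c. 0 < c \<and> c \<le> c0 \<longrightarrow> (\<exists>e>0. \<exists>C\<ge>0. \<exists>h0>0. half_well_estimate v v1 lam0 a m (airy_phase c) e C h0)"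
    by (elim exE conjE)
  define c where "c = min c0 c1"
  have c: "0 < c" "c \<le> c0" "c \<le> c1" using c0 c1 by (auto simp: c_def)
  from A[rule_format, OF conjI[OF c(1,3)]] obtain C1 h1 where C1: "0 \<le> C1" "0 < h1"
    and A': "\<forall>h. 0 < h \<and> h < h1 \<longrightarrow> \<bar>sin (airy_phase c h - pi / 4)\<bar> \<le> C1 * h"
    by (elim exE conjE)
  from B[rule_format, OF conjI[OF c(1,2)]] obtain e C0 h0 where e: "0 < e" and C0: "0 \<le> C0" "0 < h0"
    and B': "half_well_estimate v v1 lam0 a m (airy_phase c) e C0 h0"
    by (elim exE conjE)
  show ?thesis
  proof (rule exI[of _ e], rule conjI[OF e], rule exI[of _ "C0 + C1"], rule conjI,
      simp add: C0(1) C1(1), rule exI[of _ "min h0 h1"], rule conjI, simp add: C0(2) C1(2), unfold half_well_estimate_def, intro allI impI)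
    fix lam h y y1 xr
    assume H: "\<bar>lam - lam0\<bar> < e \<and> 0 < h \<and> h < min h0 h1 \<and> stationary v lam h y y1 \<and> 0 \<le> y a * y1 a \<and>
      xr \<in> {a<..<m} \<and> v xr = lam"
    let ?S = "integral {xr..m} (\<lambda>t. sqrt (lam - v t)) / h"
    have 1: "phase_near (C0 * h) (?S + airy_phase c h) (wkb_s v lam y m) (wkb_c v v1 lam h y y1 m)"
      by (rule B'[unfolded half_well_estimate_def, rule_format]) (use H in simp)
    have "\<bar>sin (?S + airy_phase c h - (?S + pi / 4))\<bar> \<le> C1 * h"
      using A'[rule_format, of h] H by simp
    from phase_near_shift[OF 1 this]
    show "phase_near ((C0 + C1) * h) (?S + pi / 4) (wkb_s v lam y m) (wkb_c v v1 lam h y y1 m)"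
      by (simp add: distrib_right)
  qed
qed

lemma stationary_reflect:
  assumes "stationary v lam h y y1"
  shows "stationary (\<lambda>x. v (- x)) lam h (\<lambda>x. y (- x)) (\<lambda>x. - y1 (- x))"
  unfolding stationary_def
proof (intro allI conjI)
  fix x
  have d: "(uminus has_real_derivative -1) (at x)" by (auto intro!: derivative_eq_intros)
  have "((\<lambda>x. y (- x)) has_real_derivative y1 (- x) * -1) (at x)"
    by (rule DERIV_chain2[OF _ d]) (use assms in \<open>simp add: stationary_def\<close>)
  then show "((\<lambda>x. y (- x)) has_real_derivative - y1 (- x)) (at x)" by simp
  have "((\<lambda>x. y1 (- x)) has_real_derivative ((v (- x) - lam) / h\<^sup>2 * y (- x)) * -1) (at x)"
    by (rule DERIV_chain2[OF _ d]) (use assms in \<open>simp add: stationary_def\<close>)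
  from DERIV_minus[OF this]
  show "((\<lambda>x. - y1 (- x)) has_real_derivative (v (- x) - lam) / h\<^sup>2 * y (- x)) (at x)" by simp
qed

text \<open>Uniqueness for the initial value problem: \<open>y\<^sup>2 + y'\<^sup>2\<close> grows at most exponentially.\<close>

lemma stationary_zero_forward:
  assumes st: "stationary v lam h y y1" and cv: "continuous_on UNIV v"
    and z: "y m = 0" "y1 m = 0" and x: "m \<le> x"
  shows "y x = 0"
proof -
  have dy: "(y has_real_derivative y1 t) (at t)" and dy1: "(y1 has_real_derivative ((v t - lam) / h\<^sup>2 * y t)) (at t)" for t
    using st by (auto simp: stationary_def)
  define Q where "Q = (\<lambda>t. (v t - lam) / h\<^sup>2)"
  have "continuous_on {m..x} Q"
    unfolding Q_def divide_inverse by (intro continuous_intros continuous_on_subset[OF cv]) auto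
  then obtain B where B: "\<forall>t\<in>{m..x}. \<bar>Q t\<bar> \<le> B" using continuous_on_interval_abs_bound by blast
  define K where "K = 1 + B"
  define E where "E = (\<lambda>t. (y t)\<^sup>2 + (y1 t)\<^sup>2)"
  have "- (E m * exp (- K * m)) \<le> - (E x * exp (- K * x))"
  proof (rule nondecreasing_if_DERIV_nonneg[where f = "\<lambda>t. - (E t * exp (- K * t))"
        and f' = "\<lambda>t. - ((2 * y t * y1 t * (1 + Q t) - K * E t) * exp (- K * t))", OF x])
    fix t assume t: "m \<le> t" "t \<le> x"
    show "((\<lambda>t. - (E t * exp (- K * t))) has_real_derivative - ((2 * y t * y1 t * (1 + Q t) - K * E t) * exp (- K * t))) (at t)"
      unfolding E_def Q_def
      by (auto intro!: derivative_eq_intros dy dy1 simp: algebra_simps power2_eq_square)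
    have "\<bar>2 * y t * y1 t * (1 + Q t)\<bar> = \<bar>2 * y t * y1 t\<bar> * \<bar>1 + Q t\<bar>" by (rule abs_mult)
    also have "\<dots> \<le> E t * K"
    proof (rule mult_mono)
      show "\<bar>2 * y t * y1 t\<bar> \<le> E t"
        using sum_squares_bound[of "\<bar>y t\<bar>" "\<bar>y1 t\<bar>"] by (simp add: E_def abs_mult)
      show "\<bar>1 + Q t\<bar> \<le> K" using B t by (force simp: K_def)
    qed (simp_all add: E_def)
    finally have "2 * y t * y1 t * (1 + Q t) - K * E t \<le> 0" by (simp add: mult.commute)
    then show "0 \<le> - ((2 * y t * y1 t * (1 + Q t) - K * E t) * exp (- K * t))"
      by (simp add: mult_nonpos_nonneg)
  qed
  then have "E x * exp (- K * x) \<le> 0" using z by (simp add: E_def)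
  then have "E x \<le> 0" by (simp add: mult_le_0_iff)
  then have "(y x)\<^sup>2 \<le> 0" unfolding E_def using zero_le_power2[of "y1 x"] by linarith
  then show ?thesis by simp
qed

lemma stationary_zero:
  assumes st: "stationary v lam h y y1" and cv: "continuous_on UNIV v"
    and z: "y m = 0" "y1 m = 0"
  shows "y x = 0"
proof (cases "m \<le> x")
  case True
  then show ?thesis by (rule stationary_zero_forward[OF st cv z])
next
  case False
  have "(\<lambda>x. y (- x)) (- x) = 0"
  proof (rule stationary_zero_forward[where m = "- m", OF stationary_reflect[OF st]])
    show "continuous_on UNIV (\<lambda>x. v (- x))"
      by (intro continuous_on_compose2[OF cv] continuous_intros) auto
  qed (use z False in auto)
  then show ?thesis by simp
qed

text \<open>The quantization condition for one well between the barrier points \<open>a\<close> and \<open>b\<close>, for all energies within \<open>e\<close> of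
\<open>lam0\<close>. The point \<open>m\<close> only tells the two turning points apart.\<close>

definition single_well_estimate ::
    "(real \<Rightarrow> real) \<Rightarrow> real \<Rightarrow> real \<Rightarrow> real \<Rightarrow> real \<Rightarrow> real \<Rightarrow> real \<Rightarrow> real \<Rightarrow> bool" where
  "single_well_estimate v lam0 a m b e C h0 \<longleftrightarrow> (\<forall>lam h y y1 xl xr.
      \<bar>lam - lam0\<bar> < e \<and> 0 < h \<and> h < h0 \<and> stationary v lam h y y1 \<and> (\<exists>x. y x \<noteq> 0) \<and>
      0 \<le> y a * y1 a \<and> y b * y1 b \<le> 0 \<and> xl \<in> {a<..<m} \<and> v xl = lam \<and> xr \<in> {m<..<b} \<and> v xr = lam \<longrightarrow>
      \<bar>cos (integral {xl..xr} (\<lambda>t. sqrt (lam - v t)) / h)\<bar> \<le> C * h)"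

lemma single_well_estimate_mono:
  assumes E: "single_well_estimate v lam0 a m b e C h0" and le: "e' \<le> e" "C \<le> C'" "h0' \<le> h0"
  shows "single_well_estimate v lam0 a m b e' C' h0'"
  unfolding single_well_estimate_def
proof (intro allI impI)
  fix lam h y y1 xl xr
  assume H: "\<bar>lam - lam0\<bar> < e' \<and> 0 < h \<and> h < h0' \<and> stationary v lam h y y1 \<and> (\<exists>x. y x \<noteq> 0) \<and>
      0 \<le> y a * y1 a \<and> y b * y1 b \<le> 0 \<and> xl \<in> {a<..<m} \<and> v xl = lam \<and> xr \<in> {m<..<b} \<and> v xr = lam"
  have "\<bar>cos (integral {xl..xr} (\<lambda>t. sqrt (lam - v t)) / h)\<bar> \<le> C * h"
    by (rule E[unfolded single_well_estimate_def, rule_format]) (use H le in auto)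
  also have "\<dots> \<le> C' * h" using le H by (intro mult_right_mono) auto
  finally show "\<bar>cos (integral {xl..xr} (\<lambda>t. sqrt (lam - v t)) / h)\<bar> \<le> C' * h" .
qed

text \<open>The left half determines the angle of the solution at \<open>m\<close>, the reflected right half determines it again, and
the two answers agree only if \<open>\<Phi> / h + \<pi> / 2\<close> is near a multiple of \<open>\<pi>\<close>.\<close>

lemma single_well_quantization:
  fixes v v1 v2 v3 :: "real \<Rightarrow> real"
  assumes dv: "\<And>x. (v has_real_derivative v1 x) (at x)"
    and dv1: "\<And>x. (v1 has_real_derivative v2 x) (at x)"
    and cv2: "continuous_on UNIV v2"
    and \<delta>: "0 < \<delta>" and dv2: "\<And>x. \<bar>x - zl\<bar> < \<delta> \<or> \<bar>x - zr\<bar> < \<delta> \<Longrightarrow> (v2 has_real_derivative v3 x) (at x)"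
    and cv3: "continuous_on {zl - \<delta><..<zl + \<delta>} v3" "continuous_on {zr - \<delta><..<zr + \<delta>} v3"
    and ord: "a < zl" "zl < m" "m < zr" "zr < b" and vz: "v1 zl < 0" "0 < v1 zr"
    and above: "\<And>x. a \<le> x \<Longrightarrow> x < zl \<Longrightarrow> lam0 < v x" "\<And>x. zr < x \<Longrightarrow> x \<le> b \<Longrightarrow> lam0 < v x"
    and below: "\<And>x. zl < x \<Longrightarrow> x < zr \<Longrightarrow> v x < lam0"
  shows "\<exists>e>0. \<exists>C\<ge>0. \<exists>h0>0. single_well_estimate v lam0 a m b e C h0"
proof -
  have cv: "continuous_on S v" for S
    by (intro continuous_at_imp_continuous_on ballI DERIV_isCont[OF dv])
  define w where "w = (\<lambda>x. v (- x))"
  define w1 where "w1 = (\<lambda>x. - v1 (- x))"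
  have refl: "((\<lambda>x. f (- x)) has_real_derivative - f' (- x)) (at x)"
    if "(f has_real_derivative f' (- x)) (at (- x))" for f f' :: "real \<Rightarrow> real" and x
  proof -
    have d: "(uminus has_real_derivative -1) (at x)" by (auto intro!: derivative_eq_intros)
    from DERIV_chain2[where f = f and g = uminus, OF that d] show ?thesis by simp
  qed
  have L: "\<exists>e>0. \<exists>C\<ge>0. \<exists>h0>0. half_well_estimate v v1 lam0 a m (\<lambda>_. pi / 4) e C h0"
  proof (rule half_well_phase[OF dv dv1 cv2 \<delta> _ cv3(1) ord(1,2) vz(1) above(1)])
    fix x assume "\<bar>x - zl\<bar> < \<delta>"
    then show "(v2 has_real_derivative v3 x) (at x)" by (intro dv2) simp
  next
    fix x assume "zl < x" "x \<le> m"
    then show "v x < lam0" using ord by (intro below) auto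
  qed
  have R: "\<exists>e>0. \<exists>C\<ge>0. \<exists>h0>0. half_well_estimate w w1 lam0 (- b) (- m) (\<lambda>_. pi / 4) e C h0"
  proof (rule half_well_phase[where ?v2.0 = "\<lambda>x. v2 (- x)" and ?v3.0 = "\<lambda>x. - v3 (- x)" and z = "- zr" and \<delta> = \<delta>])
    fix x
    show "(w has_real_derivative w1 x) (at x)"
      unfolding w_def w1_def by (rule refl[of v v1 x, OF dv])
    show "(w1 has_real_derivative v2 (- x)) (at x)"
      unfolding w1_def using DERIV_minus[OF refl[of v1 v2 x, OF dv1]] by simp
    show "((\<lambda>x. v2 (- x)) has_real_derivative - v3 (- x)) (at x)" if "\<bar>x - - zr\<bar> < \<delta>"
    proof (rule refl[of v2 v3 x, OF dv2])
      show "\<bar>- x - zl\<bar> < \<delta> \<or> \<bar>- x - zr\<bar> < \<delta>" using that by linarith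
    qed
  next
    show "continuous_on UNIV (\<lambda>x. v2 (- x))"
      by (intro continuous_on_compose2[OF cv2] continuous_intros) auto
    show "continuous_on {- zr - \<delta><..<- zr + \<delta>} (\<lambda>x. - v3 (- x))"
      by (intro continuous_on_minus continuous_on_compose2[OF cv3(2)] continuous_intros) auto
    show "w1 (- zr) < 0" using vz by (simp add: w1_def)
    show "lam0 < w x" if "- b \<le> x" "x < - zr" for x
      unfolding w_def by (rule above(2)) (use that in linarith)+
    show "w x < lam0" if "- zr < x" "x \<le> - m" for x
      unfolding w_def by (rule below) (use that ord in linarith)+
  qed (use \<delta> ord in auto)
  from L obtain e1 C1 h1 where e1: "0 < e1" and C1: "0 \<le> C1" and h1: "0 < h1" and L': "half_well_estimate v v1 lam0 a m (\<lambda>_. pi / 4) e1 C1 h1"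
    by (elim exE conjE)
  from R obtain e2 C2 h2 where e2: "0 < e2" and C2: "0 \<le> C2" and h2: "0 < h2" and R': "half_well_estimate w w1 lam0 (- b) (- m) (\<lambda>_. pi / 4) e2 C2 h2"
    by (elim exE conjE)
  have "\<bar>cos (integral {xl..xr} (\<lambda>t. sqrt (lam - v t)) / h)\<bar> \<le> (C1 + C2) * h"
    if lam: "\<bar>lam - lam0\<bar> < min e1 e2" and h: "0 < h" "h < min h1 h2" and st: "stationary v lam h y y1"
      and nz: "\<exists>x. y x \<noteq> 0" and fl: "0 \<le> y a * y1 a" "y b * y1 b \<le> 0"
      and xl: "xl \<in> {a<..<m}" "v xl = lam" and xr: "xr \<in> {m<..<b}" "v xr = lam" for lam h y y1 xl xr
  proof -
    let ?f = "\<lambda>t. sqrt (lam - v t)"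
    define SL where "SL = integral {xl..m} ?f / h"
    define SR where "SR = integral {m..xr} ?f / h"
    define s where "s = wkb_s v lam y m"
    define b' where "b' = wkb_c v v1 lam h y y1 m"
    have pL: "phase_near (C1 * h) (SL + pi / 4) s b'"
      unfolding SL_def s_def b'_def by (rule L'[unfolded half_well_estimate_def, rule_format]) (use lam h st fl xl in simp)
    have "phase_near (C2 * h) (integral {- xr..- m} (\<lambda>t. sqrt (lam - w t)) / h + pi / 4)
        (wkb_s w lam (\<lambda>x. y (- x)) (- m)) (wkb_c w w1 lam h (\<lambda>x. y (- x)) (\<lambda>x. - y1 (- x)) (- m))"
      by (rule R'[unfolded half_well_estimate_def, rule_format]) (use lam h stationary_reflect[OF st] fl xr in \<open>simp add: w_def\<close>)
    moreover have "integral {- xr..- m} (\<lambda>t. sqrt (lam - w t)) = integral {m..xr} ?f"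
      unfolding w_def using Henstock_Kurzweil_Integration.integral_reflect_real[where a = m and b = xr and f = ?f] by simp
    moreover have "wkb_s w lam (\<lambda>x. y (- x)) (- m) = s" by (simp add: wkb_s_def w_def s_def)
    moreover have "wkb_c w w1 lam h (\<lambda>x. y (- x)) (\<lambda>x. - y1 (- x)) (- m) = - b'"
      by (simp add: wkb_c_def w_def w1_def b'_def algebra_simps)
    ultimately have "phase_near (C2 * h) (SR + pi / 4) s (- b')" by (simp add: SR_def)
    then have pR: "phase_near (C2 * h) (- (SR + pi / 4)) s b'"
      unfolding phase_near_def cos_minus sin_minus by simp
    have sb: "s\<^sup>2 + b'\<^sup>2 \<noteq> 0"
    proof
      assume "s\<^sup>2 + b'\<^sup>2 = 0"
      then have "s = 0" "b' = 0" by (simp_all add: sum_power2_eq_zero_iff)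
      then have "y m = 0" "y1 m = 0"
        using wkb_amp_pos[of "lam - v m"] h(1) by (auto simp: s_def b'_def wkb_s_def wkb_c_def)
      then show False using stationary_zero[OF st cv] nz by blast
    qed
    have "\<bar>sin (SL + pi / 4 - - (SR + pi / 4))\<bar> \<le> C1 * h + C2 * h"
      by (rule phase_near_unique[OF pL pR sb])
    moreover have "SL + pi / 4 - - (SR + pi / 4) = integral {xl..xr} ?f / h + pi / 2"
    proof -
      have "integral {xl..m} ?f + integral {m..xr} ?f = integral {xl..xr} ?f"
        using xl xr by (intro Henstock_Kurzweil_Integration.integral_combine integrable_continuous_interval continuous_intros cv) auto
      then have "integral {xl..xr} ?f / h = SL + SR" by (simp add: SL_def SR_def add_divide_distrib[symmetric])
      then show ?thesis by simp
    qed
    ultimately show ?thesis by (simp add: sin_add distrib_right)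
  qed
  note main = this
  show ?thesis
  proof (rule exI[of _ "min e1 e2"], rule conjI, simp add: e1 e2, rule exI[of _ "C1 + C2"], rule conjI,
      simp add: C1 C2, rule exI[of _ "min h1 h2"], rule conjI, simp add: h1 h2, unfold single_well_estimate_def, intro allI impI, elim conjE)
  qed (rule main)
qed

section \<open>From eigenfunctions to real solutions\<close>

text \<open>The weak second derivative of an eigenfunction agrees almost everywhere with the continuous function
\<open>(v - lam) u / h\<^sup>2\<close>, so it is a classical derivative.\<close>

lemma eigenfunction_classical:
  assumes cv: "continuous_on UNIV v" and h: "0 < h"
    and T: "schrodinger_op v h u (\<lambda>x. of_real lam * u x)"
  shows "\<exists>u'. (\<forall>x. (u has_vector_derivative u' x) (at x)) \<and>
     (\<forall>x. (u' has_vector_derivative of_real ((v x - lam) / h\<^sup>2) * u x) (at x))"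
proof -
  obtain u' w where du: "\<And>x. (u has_vector_derivative u' x) (at x)"
    and w: "\<And>a b. a \<le> b \<Longrightarrow> (w has_integral u' b - u' a) {a..b}"
    and ae: "AE x in lebesgue. of_real lam * u x = - of_real (h\<^sup>2) * w x + of_real (v x) * u x"
    using T unfolding schrodinger_op_def by blast
  define g where "g = (\<lambda>x. of_real ((v x - lam) / h\<^sup>2) * u x)"
  have cu: "continuous_on UNIV u"
    by (intro continuous_at_imp_continuous_on ballI has_vector_derivative_continuous[OF du])
  have cg: "continuous_on S g" for S
  proof -
    have "continuous_on UNIV g"
      unfolding g_def divide_inverse by (intro continuous_intros cv cu)
    then show ?thesis by (rule continuous_on_subset) simp
  qed
  have "\<exists>N. negligible N \<and> (\<forall>x. x \<notin> N \<longrightarrow> w x = g x)"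
  proof -
    have "AE x in lebesgue. w x = g x"
      using ae
    proof (rule AE_mp, intro AE_I2 impI)
      fix x assume eq: "of_real lam * u x = - of_real (h\<^sup>2) * w x + of_real (v x) * u x"
      have hz: "complex_of_real (h\<^sup>2) \<noteq> 0" using h by simp
      have "of_real (h\<^sup>2) * w x = of_real (v x - lam) * u x"
        using eq by (simp add: algebra_simps)
      then show "w x = g x" unfolding g_def using hz by (simp add: field_simps)
    qed
    then obtain N where "{x \<in> space lebesgue. \<not> w x = g x} \<subseteq> N" "emeasure lebesgue N = 0" "N \<in> sets lebesgue"
      by (rule AE_E)
    then show ?thesis by (intro exI[of _ N]) (auto simp: negligible_iff_null_sets null_sets_def)
  qed
  then obtain N where N: "negligible N" "\<And>x. x \<notin> N \<Longrightarrow> w x = g x" by blast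
  have gint: "(g has_integral u' b - u' a) {a..b}" if "a \<le> b" for a b
    by (rule has_integral_spike[OF N(1) _ w[OF that]]) (use N(2) in auto)
  have "(u' has_vector_derivative g x) (at x)" for x
  proof -
    have "((\<lambda>t. integral {x - 1..t} g) has_vector_derivative g x) (at x within {x - 1..x + 1})"
      by (rule integral_has_vector_derivative[OF cg]) simp
    then have "((\<lambda>t. u' (x - 1) + integral {x - 1..t} g) has_vector_derivative g x) (at x within {x - 1..x + 1})"
      by (auto intro!: derivative_eq_intros)
    then have "(u' has_vector_derivative g x) (at x within {x - 1..x + 1})"
    proof (rule has_vector_derivative_transform[rotated 2])
      fix t assume "t \<in> {x - 1..x + 1}"
      then show "u' t = u' (x - 1) + integral {x - 1..t} g"
        using integral_unique[OF gint[of "x - 1" t]] by simp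
    qed simp
    then show ?thesis by (simp add: at_within_Icc_at)
  qed
  with du show ?thesis unfolding g_def by blast
qed

lemma eigenvalue_real_solution:
  assumes cv: "continuous_on UNIV v" and h: "0 < h"
    and ev: "eigenvalue_L2 (schrodinger_op v h) (of_real lam)"
  shows "\<exists>y y1. stationary v lam h y y1 \<and> (\<exists>x. y x \<noteq> 0) \<and> integrable lebesgue (\<lambda>x. (y x)\<^sup>2)"
proof -
  obtain u where T: "schrodinger_op v h u (\<lambda>x. of_real lam * u x)" and nz: "\<not> (AE x in lebesgue. u x = 0)"
    using ev unfolding eigenvalue_L2_def by blast
  obtain u' where u': "\<And>x. (u has_vector_derivative u' x) (at x)"
    "\<And>x. (u' has_vector_derivative of_real ((v x - lam) / h\<^sup>2) * u x) (at x)"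
    using eigenfunction_classical[OF cv h T] by blast
  have L2: "integrable lebesgue (\<lambda>x. (cmod (u x))\<^sup>2)" using T by (simp add: schrodinger_op_def in_L2_def)
  have part: "stationary v lam h (\<lambda>x. f (u x)) (\<lambda>x. f (u' x)) \<and> integrable lebesgue (\<lambda>x. (f (u x))\<^sup>2)"
    if f: "bounded_linear f" and fr: "\<And>r z. f (of_real r * z) = r * f z" and fb: "\<And>z. \<bar>f z\<bar> \<le> cmod z" for f :: "complex \<Rightarrow> real"
  proof
    show st: "stationary v lam h (\<lambda>x. f (u x)) (\<lambda>x. f (u' x))"
      unfolding stationary_def has_real_derivative_iff_has_vector_derivative
      using bounded_linear.has_vector_derivative[OF f u'(1)]
        bounded_linear.has_vector_derivative[OF f u'(2), unfolded fr] by blast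
    have "continuous_on UNIV (\<lambda>x. f (u x))"
      using st unfolding stationary_def
      by (intro continuous_at_imp_continuous_on ballI) (blast intro: DERIV_isCont)
    then have "continuous_on UNIV (\<lambda>x. (f (u x))\<^sup>2)" by (intro continuous_intros)
    then have "(\<lambda>x. (f (u x))\<^sup>2) \<in> borel_measurable borel"
      by (rule borel_measurable_continuous_onI)
    then have "(\<lambda>x. (f (u x))\<^sup>2) \<in> borel_measurable lebesgue"
      by (intro measurable_completion) simp
    moreover have "AE x in lebesgue. norm ((f (u x))\<^sup>2) \<le> norm ((cmod (u x))\<^sup>2)"
      using power_mono[OF fb abs_ge_zero, of _ 2] by (intro AE_I2) simp
    ultimately show "integrable lebesgue (\<lambda>x. (f (u x))\<^sup>2)"
      by (rule Bochner_Integration.integrable_bound[OF L2])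
  qed
  have "\<exists>x. u x \<noteq> 0"
  proof (rule ccontr)
    assume "\<not> (\<exists>x. u x \<noteq> 0)"
    then have "AE x in lebesgue. u x = 0" by (intro AE_I2) auto
    with nz show False by simp
  qed
  then obtain x where "u x \<noteq> 0" by blast
  then consider "Re (u x) \<noteq> 0" | "Im (u x) \<noteq> 0" by (auto simp: complex_eq_iff)
  then show ?thesis
  proof cases
    case 1
    moreover have "stationary v lam h (\<lambda>x. Re (u x)) (\<lambda>x. Re (u' x)) \<and> integrable lebesgue (\<lambda>x. (Re (u x))\<^sup>2)"
      by (rule part[OF bounded_linear_Re]) (simp_all add: abs_Re_le_cmod)
    ultimately show ?thesis by (intro exI[of _ "\<lambda>x. Re (u x)"] exI[of _ "\<lambda>x. Re (u' x)"]) auto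
  next
    case 2
    moreover have "stationary v lam h (\<lambda>x. Im (u x)) (\<lambda>x. Im (u' x)) \<and> integrable lebesgue (\<lambda>x. (Im (u x))\<^sup>2)"
      by (rule part[OF bounded_linear_Im]) (simp_all add: abs_Im_le_cmod)
    ultimately show ?thesis by (intro exI[of _ "\<lambda>x. Im (u x)"] exI[of _ "\<lambda>x. Im (u' x)"]) auto
  qed
qed

lemma not_integrable_if_bounded_below_on_intervals:
  fixes f :: "real \<Rightarrow> real"
  assumes k: "0 < k" and f0: "\<And>x. 0 \<le> f x" and low: "\<And>n::nat. \<exists>p. \<forall>x\<in>{p..p + real n}. k \<le> f x"
  shows "\<not> integrable lebesgue f"
proof
  assume f: "integrable lebesgue f"
  have le: "real n * k \<le> integral\<^sup>L lebesgue f" for n :: nat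
  proof -
    obtain p where p: "\<And>x. x \<in> {p..p + real n} \<Longrightarrow> k \<le> f x" using low by blast
    have "integral\<^sup>L lebesgue (\<lambda>x. indicator {p..p + real n} x * k) \<le> integral\<^sup>L lebesgue f"
    proof (rule integral_mono)
      show "integrable lebesgue (\<lambda>x. indicator {p..p + real n} x * k)"
        by (intro integrable_mult_left integrable_real_indicator) (auto simp: emeasure_lborel_Icc)
      fix x show "indicator {p..p + real n} x * k \<le> f x"
        using p f0 by (auto simp: indicator_def)
    qed fact
    then show ?thesis by simp
  qed
  obtain n :: nat where "integral\<^sup>L lebesgue f / k < real n" using reals_Archimedean2 by blast
  then have "integral\<^sup>L lebesgue f < real n * k" using k by (simp add: pos_divide_less_eq)
  with le[of n] show False by simp
qed

lemma L2_flux_nonneg_left: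
  assumes st: "stationary v lam h y y1" and v: "\<And>x. x \<le> a \<Longrightarrow> lam \<le> v x"
    and L2: "integrable lebesgue (\<lambda>x. (y x)\<^sup>2)"
  shows "0 \<le> y a * y1 a"
proof (rule ccontr)
  assume "\<not> 0 \<le> y a * y1 a"
  then have neg: "y a * y1 a < 0" by simp
  define k where "k = - 2 * (y a * y1 a)"
  have k: "0 < k" using neg unfolding k_def by linarith
  have "\<not> integrable lebesgue (\<lambda>x. (y x)\<^sup>2)"
  proof (rule not_integrable_if_bounded_below_on_intervals[OF k])
    fix n :: nat
    show "\<exists>p. \<forall>x\<in>{p..p + real n}. k \<le> (y x)\<^sup>2"
    proof (intro exI ballI)
      fix x assume x: "x \<in> {a - 1 - real n..a - 1 - real n + real n}"
      have "k * 1 \<le> k * (a - x)" using x k by (intro mult_left_mono) auto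
      also have "\<dots> \<le> (y x)\<^sup>2"
        unfolding k_def by (rule stationary_flux_grows[OF st v neg]) (use x in auto)
      finally show "k \<le> (y x)\<^sup>2" by simp
    qed
  qed simp
  with L2 show False by simp
qed

lemma L2_flux_nonpos_right:
  assumes st: "stationary v lam h y y1" and v: "\<And>x. b \<le> x \<Longrightarrow> lam \<le> v x"
    and L2: "integrable lebesgue (\<lambda>x. (y x)\<^sup>2)"
  shows "y b * y1 b \<le> 0"
proof (rule ccontr)
  assume "\<not> y b * y1 b \<le> 0"
  then have neg: "y (- (- b)) * (- y1 (- (- b))) < 0" by simp
  define k where "k = 2 * (y b * y1 b)"
  have k: "0 < k" using neg unfolding k_def by simp
  have "\<not> integrable lebesgue (\<lambda>x. (y x)\<^sup>2)"
  proof (rule not_integrable_if_bounded_below_on_intervals[OF k])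
    fix n :: nat
    show "\<exists>p. \<forall>x\<in>{p..p + real n}. k \<le> (y x)\<^sup>2"
    proof (intro exI ballI)
      fix x assume x: "x \<in> {b + 1..b + 1 + real n}"
      have "k * 1 \<le> k * (x - b)" using x k by (intro mult_left_mono) auto
      also have "\<dots> = - 2 * (y (- (- b)) * (- y1 (- (- b)))) * (- b - (- x))"
        by (simp add: k_def)
      also have "\<dots> \<le> (y (- (- x)))\<^sup>2"
        by (rule stationary_flux_grows[OF stationary_reflect[OF st] _ neg]) (use x v in auto)
      finally show "k \<le> (y x)\<^sup>2" by simp
    qed
  qed simp
  with L2 show False by simp
qed

section \<open>Enumeration of the wells\<close>

text \<open>Alternating points of barriers and wells: the barrier points \<open>a 0 < a 1 < \<dots> < a L\<close> separate the wells
\<open>(zl l, zr l)\<close>. Only the side to the right of \<open>a 0\<close> is described.\<close>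

definition well_chain :: "(real \<Rightarrow> real) \<Rightarrow> real \<Rightarrow> nat \<Rightarrow> (nat \<Rightarrow> real) \<Rightarrow> (nat \<Rightarrow> real) \<Rightarrow> (nat \<Rightarrow> real) \<Rightarrow> bool" where
  "well_chain v lam0 L a zl zr \<longleftrightarrow> (\<forall>x\<ge>a L. lam0 < v x) \<and>
     (\<forall>l<L. a l < zl l \<and> zl l < zr l \<and> zr l < a (Suc l) \<and> v (zl l) = lam0 \<and> v (zr l) = lam0 \<and>
       (\<forall>x\<in>{a l..<zl l}. lam0 < v x) \<and> (\<forall>x\<in>{zl l<..<zr l}. v x < lam0) \<and> (\<forall>x\<in>{zr l<..a (Suc l)}. lam0 < v x))"

lemma above_level_if_no_root:
  fixes v :: "real \<Rightarrow> real"
  assumes "\<And>x. isCont v x" "p \<le> q" "c < v p" "\<And>x. p \<le> x \<Longrightarrow> x \<le> q \<Longrightarrow> v x \<noteq> c"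
  shows "c < v q"
proof (rule ccontr)
  assume "\<not> c < v q"
  then have "\<exists>x\<ge>p. x \<le> q \<and> v x = c" using assms by (intro IVT2) auto
  then show False using assms(4) by blast
qed

lemma below_level_if_no_root:
  fixes v :: "real \<Rightarrow> real"
  assumes "\<And>x. isCont v x" "p \<le> q" "v p < c" "\<And>x. p \<le> x \<Longrightarrow> x \<le> q \<Longrightarrow> v x \<noteq> c"
  shows "v q < c"
  using above_level_if_no_root[of "\<lambda>x. - v x" p q "- c"] assms by simp

text \<open>Walk to the right from a point above the level. The next root is a downward crossing, the one after it
exists because \<open>v\<close> is above the level near \<open>\<infinity>\<close> and is an upward crossing, and two roots have been used up.
The sequences are extended at the front, hence \<open>case_nat\<close>.\<close>

lemma well_chain_exists:
  fixes v v1 :: "real \<Rightarrow> real"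
  assumes dv: "\<And>x. (v has_real_derivative v1 x) (at x)"
    and fin: "finite {x. v x = lam0}" and simple: "\<And>x. v x = lam0 \<Longrightarrow> v1 x \<noteq> 0"
    and far: "\<And>x. b \<le> x \<Longrightarrow> lam0 < v x"
  shows "lam0 < v t \<Longrightarrow> \<exists>L a zl zr. a 0 = t \<and> well_chain v lam0 L a zl zr"
proof (induction "card {x. v x = lam0 \<and> t < x}" arbitrary: t rule: less_induct)
  case (less t)
  have cv: "isCont v x" for x by (rule DERIV_isCont[OF dv])
  have finS: "finite {x. v x = lam0 \<and> s < x}" for s by (rule finite_subset[OF _ fin]) auto
  show ?case
  proof (cases "{x. v x = lam0 \<and> t < x} = {}")
    case True
    have "lam0 < v x" if "t \<le> x" for x
      by (rule above_level_if_no_root[OF cv that less.prems]) (use True less.prems in \<open>force simp: le_less\<close>)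
    then show ?thesis
      by (intro exI[of _ "0::nat"] exI[of _ "\<lambda>_. t"]) (simp add: well_chain_def)
  next
    case False
    define z1 where "z1 = Min {x. v x = lam0 \<and> t < x}"
    have z1: "v z1 = lam0" "t < z1" using Min_in[OF finS False] by (auto simp: z1_def)
    have z1_least: "z1 \<le> x" if "v x = lam0" "t < x" for x
      unfolding z1_def by (rule Min_le[OF finS]) (use that in simp)
    have left: "lam0 < v x" if "t \<le> x" "x < z1" for x
    proof (rule above_level_if_no_root[OF cv that(1) less.prems])
      fix s assume "t \<le> s" "s \<le> x"
      then show "v s \<noteq> lam0" using z1_least[of s] that less.prems by (cases "s = t") auto
    qed
    have v1z1: "v1 z1 < 0"
    proof (rule ccontr)
      assume "\<not> v1 z1 < 0"
      then have "0 < v1 z1" using simple[OF z1(1)] by simp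
      then obtain d where d: "0 < d" "\<And>h. 0 < h \<Longrightarrow> h < d \<Longrightarrow> v (z1 - h) < v z1"
        using DERIV_pos_inc_left[OF dv] by blast
      define h where "h = min (d / 2) (z1 - t)"
      have "0 < h" "h < d" "t \<le> z1 - h" using d(1) z1 by (auto simp: h_def)
      then show False using d(2)[of h] left[of "z1 - h"] z1 by simp
    qed
    obtain d where d: "0 < d" "\<And>h. 0 < h \<Longrightarrow> h < d \<Longrightarrow> v (z1 + h) < v z1"
      using DERIV_neg_dec_right[OF dv v1z1] by blast
    have below1: "v x < lam0" if "z1 < x" "x < z1 + d" for x
      using d(2)[of "x - z1"] that z1 by simp
    have ne2: "{x. v x = lam0 \<and> z1 < x} \<noteq> {}"
    proof
      assume e: "{x. v x = lam0 \<and> z1 < x} = {}"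
      define q where "q = max (z1 + d / 2) b"
      have "v q < lam0"
        by (rule below_level_if_no_root[OF cv, of "z1 + d / 2"]) (use below1[of "z1 + d / 2"] d(1) e in \<open>auto simp: q_def\<close>)
      moreover have "lam0 < v q" by (rule far) (simp add: q_def)
      ultimately show False by simp
    qed
    define z2 where "z2 = Min {x. v x = lam0 \<and> z1 < x}"
    have z2: "v z2 = lam0" "z1 < z2" using Min_in[OF finS ne2] by (auto simp: z2_def)
    have z2_least: "z2 \<le> x" if "v x = lam0" "z1 < x" for x
      unfolding z2_def by (rule Min_le[OF finS]) (use that in simp)
    have mid: "v x < lam0" if x: "z1 < x" "x < z2" for x
    proof -
      define p where "p = min x (z1 + d / 2)"
      have p: "z1 < p" "p \<le> x" "p < z1 + d" using x d(1) by (auto simp: p_def min_def)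
      show ?thesis
      proof (rule below_level_if_no_root[OF cv p(2) below1[OF p(1,3)]])
        fix s assume "p \<le> s" "s \<le> x"
        then show "v s \<noteq> lam0" using z2_least[of s] p x by auto
      qed
    qed
    have v1z2: "0 < v1 z2"
    proof (rule ccontr)
      assume "\<not> 0 < v1 z2"
      then have "v1 z2 < 0" using simple[OF z2(1)] by simp
      then obtain d' where d': "0 < d'" "\<And>h. 0 < h \<Longrightarrow> h < d' \<Longrightarrow> v z2 < v (z2 - h)"
        using DERIV_neg_dec_left[OF dv] by blast
      define h where "h = min (d' / 2) ((z2 - z1) / 2)"
      have h0: "0 < h" using d'(1) z2(2) by (simp add: h_def)
      have h1: "h \<le> d' / 2" unfolding h_def by (rule min.cobounded1)
      have h2: "h \<le> (z2 - z1) / 2" unfolding h_def by (rule min.cobounded2)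
      have "h < d'" using h1 d'(1) by linarith
      have "(z2 - z1) / 2 < z2 - z1" using z2(2) by simp
      then have "z1 < z2 - h" using h2 by linarith
      then show False using d'(2)[OF h0 \<open>h < d'\<close>] mid[of "z2 - h"] h0 z2(1) by simp
    qed
    obtain d2 where d2: "0 < d2" "\<And>h. 0 < h \<Longrightarrow> h < d2 \<Longrightarrow> v z2 < v (z2 + h)"
      using DERIV_pos_inc_right[OF dv v1z2] by blast
    define t' where "t' = z2 + d2 / 2"
    have t': "z2 < t'" using d2 by (simp add: t'_def)
    have right: "lam0 < v x" if "z2 < x" "x \<le> t'" for x
      using d2(2)[of "x - z2"] that z2 d2(1) by (simp add: t'_def)
    have "{x. v x = lam0 \<and> t' < x} \<subset> {x. v x = lam0 \<and> t < x}"
    proof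
      show "{x. v x = lam0 \<and> t' < x} \<subseteq> {x. v x = lam0 \<and> t < x}" using t' z1 z2 by auto
      have "z1 \<in> {x. v x = lam0 \<and> t < x}" "z1 \<notin> {x. v x = lam0 \<and> t' < x}" using t' z1 z2 by auto
      then show "{x. v x = lam0 \<and> t' < x} \<noteq> {x. v x = lam0 \<and> t < x}" by blast
    qed
    then have "card {x. v x = lam0 \<and> t' < x} < card {x. v x = lam0 \<and> t < x}"
      by (rule psubset_card_mono[OF finS])
    from less.hyps[OF this right[OF t' order_refl]]
    obtain L a zl zr where IH: "a 0 = t'" "well_chain v lam0 L a zl zr" by blast
    define a' where "a' = case_nat t a"
    define zl' where "zl' = case_nat z1 zl"
    define zr' where "zr' = case_nat z2 zr"
    have "well_chain v lam0 (Suc L) a' zl' zr'"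
      unfolding well_chain_def
    proof (intro conjI)
      show "\<forall>x\<ge>a' (Suc L). lam0 < v x" using IH(2) by (simp add: a'_def well_chain_def)
      show "\<forall>l<Suc L. a' l < zl' l \<and> zl' l < zr' l \<and> zr' l < a' (Suc l) \<and> v (zl' l) = lam0 \<and> v (zr' l) = lam0 \<and>
       (\<forall>x\<in>{a' l..<zl' l}. lam0 < v x) \<and> (\<forall>x\<in>{zl' l<..<zr' l}. v x < lam0) \<and> (\<forall>x\<in>{zr' l<..a' (Suc l)}. lam0 < v x)"
      proof (intro allI impI)
        fix l assume l: "l < Suc L"
        show "a' l < zl' l \<and> zl' l < zr' l \<and> zr' l < a' (Suc l) \<and> v (zl' l) = lam0 \<and> v (zr' l) = lam0 \<and>
         (\<forall>x\<in>{a' l..<zl' l}. lam0 < v x) \<and> (\<forall>x\<in>{zl' l<..<zr' l}. v x < lam0) \<and> (\<forall>x\<in>{zr' l<..a' (Suc l)}. lam0 < v x)"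
        proof (cases l)
          case 0
          then show ?thesis
            using z1 z2 t' left mid right IH(1) by (simp add: a'_def zl'_def zr'_def)
        next
          case (Suc k)
          then have "k < L" using l by simp
          with IH(2) show ?thesis unfolding well_chain_def Suc by (simp add: a'_def zl'_def zr'_def)
        qed
      qed
    qed
    moreover have "a' 0 = t" by (simp add: a'_def)
    ultimately show ?thesis by blast
  qed
qed

definition well_roots ::
    "(real \<Rightarrow> real) \<Rightarrow> (real \<Rightarrow> real) \<Rightarrow> real \<Rightarrow> real \<Rightarrow> real \<Rightarrow> real \<Rightarrow> real \<Rightarrow> bool" where
  "well_roots v v1 lam0 a m b e \<longleftrightarrow> (\<forall>x\<in>{a..b}. \<bar>v x - lam0\<bar> < e \<longrightarrow> v1 x \<noteq> 0) \<and>
    (\<forall>lam. \<bar>lam - lam0\<bar> < e \<longrightarrow> (\<exists>x\<in>{a<..<m}. v x = lam) \<and> (\<exists>x\<in>{m<..<b}. v x = lam) \<and>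
      (\<forall>xl\<in>{a<..<m}. \<forall>xr\<in>{m<..<b}. v xl = lam \<longrightarrow> v xr = lam \<longrightarrow>
        (\<forall>t\<in>{a..b}. (v t = lam \<longleftrightarrow> t = xl \<or> t = xr) \<and> (v t < lam \<longleftrightarrow> xl < t \<and> t < xr))))"

text \<open>The level sets of \<open>v\<close> between two barrier points keep their shape for all levels near \<open>lam0\<close>. The right
crossing is the reflection of a downward crossing.\<close>

lemma single_well_roots:
  fixes v v1 :: "real \<Rightarrow> real"
  assumes dv: "\<And>x. (v has_real_derivative v1 x) (at x)" and cv1: "\<And>x. isCont v1 x"
    and ord: "a < zl" "zl < m" "m < zr" "zr < b" and vz: "v1 zl < 0" "0 < v1 zr"
    and above: "\<And>x. a \<le> x \<Longrightarrow> x < zl \<Longrightarrow> lam0 < v x" "\<And>x. zr < x \<Longrightarrow> x \<le> b \<Longrightarrow> lam0 < v x"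
    and below: "\<And>x. zl < x \<Longrightarrow> x < zr \<Longrightarrow> v x < lam0"
  shows "\<exists>e>0. well_roots v v1 lam0 a m b e"
proof -
  define w where "w = (\<lambda>x. v (- x))"
  define w1 where "w1 = (\<lambda>x. - v1 (- x))"
  have dw: "(w has_real_derivative w1 x) (at x)" for x
  proof -
    have d: "(uminus has_real_derivative -1) (at x)" by (auto intro!: derivative_eq_intros)
    from DERIV_chain2[OF dv d] show ?thesis by (simp add: w_def w1_def)
  qed
  have cw1: "isCont w1 x" for x
    unfolding w1_def by (intro continuous_intros isCont_o2[OF _ cv1])
  have "\<exists>d m0 e. 2 * d < 1 \<and> crossing_window v v1 lam0 a zl m d m0 e"
    by (rule crossing_window_exists[OF dv cv1 ord(1,2) vz(1) above(1)]) (use below ord in auto)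
  then obtain d1 m1 e1 where L: "crossing_window v v1 lam0 a zl m d1 m1 e1" by blast
  have "\<exists>d m0 e. 2 * d < 1 \<and> crossing_window w w1 lam0 (- b) (- zr) (- m) d m0 e"
  proof (rule crossing_window_exists[OF dw cw1])
    show "lam0 < w x" if "- b \<le> x" "x < - zr" for x
      unfolding w_def by (rule above(2)) (use that in linarith)+
    show "w x < lam0" if "- zr < x" "x \<le> - m" for x
      unfolding w_def by (rule below) (use that ord in linarith)+
  qed (use ord vz in \<open>auto simp: w1_def\<close>)
  then obtain d2 m2 e2 where R: "crossing_window w w1 lam0 (- b) (- zr) (- m) d2 m2 e2" by blast
  note Ld = L[unfolded crossing_window_def] and Rd = R[unfolded crossing_window_def]
  define e where "e = min e1 e2"
  have e: "0 < e" "e \<le> e1" "e \<le> e2" using Ld Rd by (auto simp: e_def)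
  show ?thesis
  proof (rule exI[of _ e], unfold well_roots_def, intro conjI e(1) ballI allI impI)
    fix x assume x: "x \<in> {a..b}" and vx: "\<bar>v x - lam0\<bar> < e"
    show "v1 x \<noteq> 0"
    proof (cases "x \<le> m")
      case True
      have "\<bar>x - zl\<bar> < d1"
        by (rule crossing_window_root(1)[OF dv L, of "v x"]) (use vx e x True in auto)
      then have "v1 x \<le> - m1" "0 < m1" using Ld by auto
      then show ?thesis by linarith
    next
      case False
      have "\<bar>- x - - zr\<bar> < d2"
        by (rule crossing_window_root(1)[OF dw R, of "v x"]) (use vx e x False in \<open>auto simp: w_def\<close>)
      then have "w1 (- x) \<le> - m2" "0 < m2" using Rd by auto
      then show ?thesis by (auto simp: w1_def)
    qed
  next
    fix lam assume lam: "\<bar>lam - lam0\<bar> < e"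
    then have lam1: "\<bar>lam - lam0\<bar> < e1" and lam2: "\<bar>lam - lam0\<bar> < e2" using e by auto
    show "\<exists>x\<in>{a<..<m}. v x = lam" by (rule crossing_window_root_exists[OF dv L lam1])
    obtain x where "x \<in> {- b<..<- m}" "w x = lam"
      using crossing_window_root_exists[OF dw R lam2] by blast
    then show "\<exists>x\<in>{m<..<b}. v x = lam" by (intro bexI[of _ "- x"]) (auto simp: w_def)
    fix xl xr t assume xl: "xl \<in> {a<..<m}" "v xl = lam" and xr: "xr \<in> {m<..<b}" "v xr = lam" and t: "t \<in> {a..b}"
    have xl': "xl \<in> {a..m}" and xr': "- xr \<in> {- b..- m}" "w (- xr) = lam" using xl xr by (auto simp: w_def)
    note l = crossing_window_root(2,3)[OF dv L lam1 xl' xl(2)]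
    note r = crossing_window_root(2,3)[OF dw R lam2 xr', of "- t", unfolded w_def minus_minus]
    show "v t = lam \<longleftrightarrow> t = xl \<or> t = xr" "v t < lam \<longleftrightarrow> xl < t \<and> t < xr"
      using l[of t] r xl xr t by (cases "t \<le> m"; cases "t = xl"; cases "t = xr"; cases "t < xl"; cases "t < xr"; force)+
  qed
qed

lemma uniform_over_finite:
  fixes P :: "'i \<Rightarrow> real \<Rightarrow> bool"
  assumes "finite I" "\<And>i. i \<in> I \<Longrightarrow> \<exists>e>0. P i e"
    and mono: "\<And>i e e'. P i e \<Longrightarrow> 0 < e' \<Longrightarrow> e' \<le> e \<Longrightarrow> P i e'"
  shows "\<exists>e>0. \<forall>i\<in>I. P i e"
  using assms(1,2)
proof (induction I rule: finite_induct)
  case empty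
  show ?case by (intro exI[of _ 1]) simp
next
  case (insert i I)
  then obtain e e' where "0 < e" "\<forall>i\<in>I. P i e" "0 < e'" "P i e'" by (metis insertCI)
  then show ?case by (intro exI[of _ "min e e'"]) (auto intro: mono)
qed

text \<open>Near a zero of the cosine its modulus is at least half the distance to the zero.\<close>

lemma cos_small_imp_near_half_integer:
  fixes \<theta> :: real
  shows "\<exists>n::int. \<bar>\<theta> - pi * (of_int n + 1 / 2)\<bar> \<le> 2 * \<bar>cos \<theta>\<bar>"
proof -
  define n where "n = round (\<theta> / pi - 1 / 2)"
  define \<delta> where "\<delta> = \<theta> - pi * (of_int n + 1 / 2)"
  have "\<bar>of_int n - (\<theta> / pi - 1 / 2)\<bar> \<le> 1 / 2" unfolding n_def by (rule of_int_round_abs_le)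
  then have "pi * \<bar>of_int n - (\<theta> / pi - 1 / 2)\<bar> \<le> pi * (1 / 2)" by (intro mult_left_mono) auto
  moreover have "pi * \<bar>of_int n - (\<theta> / pi - 1 / 2)\<bar> = \<bar>\<delta>\<bar>"
  proof -
    have "pi * (of_int n - (\<theta> / pi - 1 / 2)) = - \<delta>" by (simp add: \<delta>_def algebra_simps)
    then have "\<bar>pi\<bar> * \<bar>of_int n - (\<theta> / pi - 1 / 2)\<bar> = \<bar>\<delta>\<bar>" by (metis abs_minus_cancel abs_mult)
    then show ?thesis by simp
  qed
  ultimately have \<delta>: "\<bar>\<delta>\<bar> \<le> pi / 2" by simp
  have half: "x / 2 \<le> sin x" if x: "0 \<le> x" "x \<le> pi / 2" for x :: real
  proof (cases "x \<le> pi / 3")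
    case True
    have "sin 0 - 0 / 2 \<le> sin x - x / 2"
    proof (rule nondecreasing_if_DERIV_nonneg[where f = "\<lambda>x. sin x - x / 2" and f' = "\<lambda>x. cos x - 1 / 2"])
      fix t assume t: "0 \<le> t" "t \<le> x"
      show "((\<lambda>x. sin x - x / 2) has_real_derivative cos t - 1 / 2) (at t)"
        by (auto intro!: derivative_eq_intros)
      have "cos (pi / 3) \<le> cos t" using t True by (intro cos_monotone_0_pi_le) auto
      then show "0 \<le> cos t - 1 / 2" by (simp add: cos_60)
    qed fact
    then show ?thesis by simp
  next
    case False
    have "sin (pi / 3) \<le> sin x" using False x by (intro sin_monotone_2pi_le) auto
    moreover have "x / 2 \<le> 4 / 5" using x pi_less_4 pi_approx by simp
    moreover have "8 / 5 \<le> sqrt 3" by (rule real_le_rsqrt) (simp add: power2_eq_square)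
    ultimately show ?thesis by (simp add: sin_60)
  qed
  have "\<bar>\<delta>\<bar> / 2 \<le> \<bar>sin \<delta>\<bar>"
    using half[of \<delta>] half[of "- \<delta>"] \<delta> by (cases "0 \<le> \<delta>") auto
  moreover have "\<bar>cos \<theta>\<bar> = \<bar>sin \<delta>\<bar>"
  proof -
    have "\<theta> = (\<delta> + pi / 2) + of_int n * pi" by (simp add: \<delta>_def algebra_simps)
    then have "cos \<theta> = cos (\<delta> + pi / 2) * cos (of_int n * pi) - sin (\<delta> + pi / 2) * sin (of_int n * pi)"
      by (simp only: cos_add)
    also have "\<dots> = - sin \<delta> * cos (of_int n * pi)" by (simp add: cos_add mult.commute[of _ pi] sin_zero_iff_int2)
    finally have "\<bar>cos \<theta>\<bar> = \<bar>sin \<delta>\<bar> * \<bar>cos (of_int n * pi)\<bar>" by (simp add: abs_mult)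
    moreover have "\<bar>cos (of_int n * pi)\<bar> = 1"
    proof -
      have "sin (of_int n * pi) = 0" by (simp add: sin_zero_iff_int2)
      then have "(cos (of_int n * pi))\<^sup>2 = 1\<^sup>2" using sin_cos_squared_add[of "of_int n * pi"] by simp
      then show ?thesis by (simp only: power2_eq_iff) auto
    qed
    ultimately show ?thesis by simp
  qed
  ultimately show ?thesis unfolding \<delta>_def by (intro exI[of _ n]) simp
qed

lemma well_action_eq_integral:
  assumes "continuous_on UNIV v" "a \<le> b"
  shows "well_action v lam a b = integral {a..b} (\<lambda>t. sqrt (lam - v t))"
proof -
  have "continuous_on {a..b} (\<lambda>t. sqrt (lam - v t))"
    by (intro continuous_intros continuous_on_subset[OF assms(1)]) auto
  then have "set_integrable lborel {a..b} (\<lambda>t. sqrt (lam - v t))"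
    by (rule borel_integrable_atLeastAtMost')
  then show ?thesis unfolding well_action_def using assms(2) by (intro interval_integral_eq_integral) auto
qed

section \<open>The quantization condition\<close>

lemma less_Liminf_imp_gap:
  fixes v :: "real \<Rightarrow> real"
  assumes "ereal c < Liminf F (\<lambda>x. ereal (v x))"
  shows "\<exists>e>0. ereal (c + e) < Liminf F (\<lambda>x. ereal (v x)) \<and> eventually (\<lambda>x. c + e < v x) F"
proof -
  obtain q where q: "c < q" "ereal q < Liminf F (\<lambda>x. ereal (v x))"
    using ereal_dense2[OF assms] by (metis ereal_less_ereal_Ex less_ereal.simps(1))
  then have "eventually (\<lambda>x. ereal q < ereal (v x)) F"
    by (intro less_LiminfD)
  then show ?thesis using q by (intro exI[of _ "q - c"]) simp
qed

lemma between_consecutive: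
  fixes a :: "nat \<Rightarrow> real"
  shows "a 0 \<le> x \<Longrightarrow> x < a L \<Longrightarrow> \<exists>l<L. a l \<le> x \<and> x \<le> a (Suc l)"
proof (induction L)
  case (Suc L)
  show ?case
  proof (cases "x < a L")
    case True
    then show ?thesis using Suc less_SucI by blast
  next
    case False
    then show ?thesis using Suc.prems by (intro exI[of _ L]) auto
  qed
qed simp

lemma sign_change_between:
  fixes f :: "nat \<Rightarrow> real"
  assumes "0 < L" "0 \<le> f 0" "f L \<le> 0"
  shows "\<exists>l<L. 0 \<le> f l \<and> f (Suc l) \<le> 0"
proof (rule ccontr)
  assume "\<not> ?thesis"
  then have no: "0 < f (Suc l)" if "l < L" "0 \<le> f l" for l using that by force
  have "0 \<le> f l \<and> (0 < l \<longrightarrow> 0 < f l)" if "l \<le> L" for l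
    using that
  proof (induction l)
    case (Suc l)
    then have "0 < f (Suc l)" by (intro no) auto
    then show ?case by simp
  qed (use assms in simp)
  from this[of L] assms show False by simp
qed

theorem theorem6p2:
  fixes v :: "real \<Rightarrow> real" and lam0 x0 \<rho>0 :: real
  assumes C2: "C_k_on 2 v UNIV"
    and finite_level: "finite {x. v x = lam0}"
    and noncritical: "\<And>x. v x = lam0 \<Longrightarrow> deriv v x \<noteq> 0"
    and C3: "\<And>x. v x = lam0 \<Longrightarrow> \<exists>U. open U \<and> x \<in> U \<and> C_k_on 3 v U"
    and liminf_top: "ereal lam0 < Liminf at_top (\<lambda>x. ereal (v x))"
    and liminf_bot: "ereal lam0 < Liminf at_bot (\<lambda>x. ereal (v x))"
    and rho: "\<rho>0 > 1"
    and x0: "v x0 = lam0"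
    and bounded_at_infinity:
      "Bfun (\<lambda>x. ((deriv v x)\<^sup>2 / \<bar>v x - lam0\<bar> ^ 3 + \<bar>deriv (deriv v) x\<bar> / \<bar>v x - lam0\<bar>\<^sup>2)
               * \<bar>LBINT y=x0..x. sqrt \<bar>v y - lam0\<bar>\<bar> powr \<rho>0) at_infinity"
  shows "\<exists>L xm xp. \<exists>\<epsilon>>0. \<forall>\<Lambda>1 \<Lambda>2. lam0 - \<epsilon> < \<Lambda>1 \<and> \<Lambda>1 < lam0 \<and> lam0 < \<Lambda>2 \<and> \<Lambda>2 < lam0 + \<epsilon> \<longrightarrow>
    well_neighborhood v \<Lambda>1 \<Lambda>2 L xm xp \<and>
    (\<exists>C>0. \<exists>h0>0. \<forall>h\<in>{0<..<h0}. \<forall>lam\<in>{\<Lambda>1<..<\<Lambda>2}.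
       eigenvalue_L2 (schrodinger_op v h) (of_real lam) \<longrightarrow>
       (\<exists>l\<in>{1..L}. \<exists>n::int.
          \<bar>cos (well_action v lam (xm l lam) (xp l lam) / h)\<bar> \<le> C * h \<and>
          \<bar>well_action v lam (xm l lam) (xp l lam) - pi * (of_int n + 1/2) * h\<bar> \<le> C * h\<^sup>2))"
proof -
  define v1 where "v1 = deriv v"
  define v2 where "v2 = deriv v1"
  define v3 where "v3 = deriv v2"
  have "v differentiable (at x)" "v1 differentiable (at x)" for x
    using C2 unfolding C_k_on_def v1_def by (auto simp: numeral_2_eq_2 less_Suc_eq)
  then have dv: "(v has_real_derivative v1 x) (at x)" and dv1: "(v1 has_real_derivative v2 x) (at x)" for x
    unfolding v1_def v2_def by (simp_all add: DERIV_deriv_iff_real_differentiable)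
  have cv2: "continuous_on UNIV v2" using C2 unfolding C_k_on_def v1_def v2_def by (simp add: numeral_2_eq_2)
  have cv: "isCont v x" for x by (rule DERIV_isCont[OF dv])
  have cvU: "continuous_on S v" for S by (intro continuous_at_imp_continuous_on ballI cv)
  have C3': "\<exists>\<delta>>0. (\<forall>x. \<bar>x - z\<bar> < \<delta> \<longrightarrow> (v2 has_real_derivative v3 x) (at x)) \<and> continuous_on {z - \<delta><..<z + \<delta>} v3"
    if z: "v z = lam0" for z
  proof -
    obtain U where U: "open U" "z \<in> U" "C_k_on 3 v U" using C3[OF z] by blast
    obtain \<delta> where \<delta>: "0 < \<delta>" "ball z \<delta> \<subseteq> U" using U openE by blast
    have "v2 differentiable (at x)" if "x \<in> U" for x
      using U(3) that unfolding C_k_on_def v1_def v2_def by (auto simp: numeral_3_eq_3 less_Suc_eq)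
    then have "(v2 has_real_derivative v3 x) (at x)" if "x \<in> U" for x
      using that unfolding v3_def by (simp add: DERIV_deriv_iff_real_differentiable)
    moreover have "continuous_on U v3"
      using U(3) unfolding C_k_on_def v1_def v2_def v3_def by (simp add: numeral_3_eq_3)
    moreover have "{z - \<delta><..<z + \<delta>} = ball z \<delta>" by (simp add: ball_eq_greaterThanLessThan)
    moreover have "x \<in> U" if "\<bar>x - z\<bar> < \<delta>" for x
      using that \<delta>(2) by (auto simp: subset_iff dist_real_def abs_minus_commute)
    ultimately show ?thesis using \<delta> by (intro exI[of _ \<delta>]) (auto intro: continuous_on_subset)
  qed
  obtain et where et: "0 < et" "ereal (lam0 + et) < Liminf at_top (\<lambda>x. ereal (v x))"
    "eventually (\<lambda>x. lam0 + et < v x) at_top" using less_Liminf_imp_gap[OF liminf_top] by blast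
  obtain eb where eb: "0 < eb" "ereal (lam0 + eb) < Liminf at_bot (\<lambda>x. ereal (v x))"
    "eventually (\<lambda>x. lam0 + eb < v x) at_bot" using less_Liminf_imp_gap[OF liminf_bot] by blast
  obtain B where B: "\<And>x. B \<le> x \<Longrightarrow> lam0 + et < v x" using et(3) by (auto simp: eventually_at_top_linorder)
  obtain A where A: "\<And>x. x \<le> A \<Longrightarrow> lam0 + eb < v x" using eb(3) by (auto simp: eventually_at_bot_linorder)
  have "lam0 < v A" using A[of A] eb(1) by simp
  have farB: "lam0 < v x" if "B \<le> x" for x using B[OF that] et(1) by simp
  obtain L a zl zr where a0: "a 0 = A" and chain: "well_chain v lam0 L a zl zr"
    using well_chain_exists[OF dv finite_level _ farB \<open>lam0 < v A\<close>] noncritical unfolding v1_def by blast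
  have aL: "lam0 < v x" if "a L \<le> x" for x using chain that unfolding well_chain_def by blast
  have ch: "a l < zl l" "zl l < zr l" "zr l < a (Suc l)" "v (zl l) = lam0" "v (zr l) = lam0"
    "\<And>x. a l \<le> x \<Longrightarrow> x < zl l \<Longrightarrow> lam0 < v x" "\<And>x. zl l < x \<Longrightarrow> x < zr l \<Longrightarrow> v x < lam0"
    "\<And>x. zr l < x \<Longrightarrow> x \<le> a (Suc l) \<Longrightarrow> lam0 < v x" if "l < L" for l
    using chain that unfolding well_chain_def by auto
  define mid where "mid = (\<lambda>l. (zl l + zr l) / 2)"
  have mid: "zl l < mid l" "mid l < zr l" if "l < L" for l using ch(2)[OF that] by (simp_all add: mid_def)
  have slope: "v1 (zl l) < 0" "0 < v1 (zr l)" if l: "l < L" for l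
  proof -
    have nz: "v1 (zl l) \<noteq> 0" "v1 (zr l) \<noteq> 0" using noncritical ch(4,5)[OF l] by (auto simp: v1_def)
    show "v1 (zl l) < 0"
    proof (rule ccontr)
      assume "\<not> v1 (zl l) < 0"
      then have "0 < v1 (zl l)" using nz by simp
      then obtain d where d: "0 < d" "\<And>h. 0 < h \<Longrightarrow> h < d \<Longrightarrow> v (zl l) < v (zl l + h)"
        using DERIV_pos_inc_right[OF dv] by blast
      define h where "h = min (d / 2) ((zr l - zl l) / 2)"
      have "h \<le> d / 2" "h \<le> (zr l - zl l) / 2" unfolding h_def by (rule min.cobounded1, rule min.cobounded2)
      moreover have "0 < h" using d(1) ch(2)[OF l] by (simp add: h_def)
      moreover have "d / 2 < d" "(zr l - zl l) / 2 < zr l - zl l" using d(1) ch(2)[OF l] by simp_all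
      ultimately show False using d(2)[of h] ch(7)[OF l, of "zl l + h"] ch(4)[OF l] by simp
    qed
    show "0 < v1 (zr l)"
    proof (rule ccontr)
      assume "\<not> 0 < v1 (zr l)"
      then have "v1 (zr l) < 0" using nz by simp
      then obtain d where d: "0 < d" "\<And>h. 0 < h \<Longrightarrow> h < d \<Longrightarrow> v (zr l + h) < v (zr l)"
        using DERIV_neg_dec_right[OF dv] by blast
      define h where "h = min (d / 2) (a (Suc l) - zr l)"
      have "h \<le> d / 2" "h \<le> a (Suc l) - zr l" unfolding h_def by (rule min.cobounded1, rule min.cobounded2)
      moreover have "0 < h" using d(1) ch(3)[OF l] by (simp add: h_def)
      moreover have "d / 2 < d" using d(1) by simp
      ultimately show False using d(2)[of h] ch(8)[OF l, of "zr l + h"] ch(5)[OF l] by simp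
    qed
  qed
  define Roots where "Roots = (\<lambda>l. well_roots v v1 lam0 (a l) (mid l) (a (Suc l)))"
  note Roots_eq = Roots_def[THEN fun_cong, THEN fun_cong, unfolded well_roots_def]
  \<comment> \<open>A single parameter \<open>e\<close> bounds the energy window and \<open>h\<close>, with constant \<open>1 / e\<close>, so that minima over the wells can be taken.\<close>
  define Quant where "Quant = (\<lambda>l e. single_well_estimate v lam0 (a l) (mid l) (a (Suc l)) e (1 / e) e)"
  have "\<exists>e>0. \<forall>l\<in>{..<L}. Roots l e"
  proof (rule uniform_over_finite)
    fix l assume "l \<in> {..<L}"
    then have l: "l < L" by simp
    show "\<exists>e>0. Roots l e"
      unfolding Roots_def
      by (rule single_well_roots[OF dv DERIV_isCont[OF dv1] ch(1)[OF l] mid[OF l] ch(3)[OF l] slope[OF l] ch(6)[OF l] ch(8)[OF l] ch(7)[OF l]])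
  next
    fix l e e' assume R: "Roots l e" and e': "0 < e'" "e' \<le> e"
    show "Roots l e'"
      unfolding Roots_eq
      by (rule conjI[OF _ allI[OF impI[OF mp[OF spec[OF conjunct2[OF R[unfolded Roots_eq]]]]]]])
        (use conjunct1[OF R[unfolded Roots_eq]] e' in auto)
  qed simp
  then obtain e1 where e1: "0 < e1" "\<And>l. l < L \<Longrightarrow> Roots l e1" by auto
  have "\<exists>e>0. \<forall>l\<in>{..<L}. Quant l e"
  proof (rule uniform_over_finite)
    fix l assume "l \<in> {..<L}"
    then have l: "l < L" by simp
    obtain d1 where d1: "0 < d1" "\<forall>x. \<bar>x - zl l\<bar> < d1 \<longrightarrow> (v2 has_real_derivative v3 x) (at x)"
      "continuous_on {zl l - d1<..<zl l + d1} v3" using C3'[OF ch(4)[OF l]] by blast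
    obtain d2 where d2: "0 < d2" "\<forall>x. \<bar>x - zr l\<bar> < d2 \<longrightarrow> (v2 has_real_derivative v3 x) (at x)"
      "continuous_on {zr l - d2<..<zr l + d2} v3" using C3'[OF ch(5)[OF l]] by blast
    define d where "d = min d1 d2"
    have d: "0 < d" "d \<le> d1" "d \<le> d2" using d1 d2 by (auto simp: d_def)
    have "\<exists>e>0. \<exists>C\<ge>0. \<exists>h0>0. single_well_estimate v lam0 (a l) (mid l) (a (Suc l)) e C h0"
    proof (rule single_well_quantization[OF dv dv1 cv2 d(1) _ _ _ ch(1)[OF l] mid[OF l] ch(3)[OF l] slope[OF l]
          ch(6)[OF l] ch(8)[OF l] ch(7)[OF l]])
      show "(v2 has_real_derivative v3 x) (at x)" if "\<bar>x - zl l\<bar> < d \<or> \<bar>x - zr l\<bar> < d" for x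
        using that d d1(2) d2(2) by (meson order_less_le_trans)
      show "continuous_on {zl l - d<..<zl l + d} v3"
        by (rule continuous_on_subset[OF d1(3)]) (use d in auto)
      show "continuous_on {zr l - d<..<zr l + d} v3"
        by (rule continuous_on_subset[OF d2(3)]) (use d in auto)
    qed
    then obtain e C h0 where e: "0 < e" and C: "0 \<le> C" and h0: "0 < h0" and Q: "single_well_estimate v lam0 (a l) (mid l) (a (Suc l)) e C h0"
      by (elim exE conjE)
    define e' where "e' = Min {e, h0, 1 / (C + 1)}"
    have e': "0 < e'" "e' \<le> e" "e' \<le> h0" "e' \<le> 1 / (C + 1)" using e C h0 by (auto simp: e'_def)
    have "C + 1 \<le> 1 / e'" using e'(1,4) C by (simp add: field_simps)
    then have Ce: "C \<le> 1 / e'" by simp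
    have "Quant l e'"
      unfolding Quant_def by (rule single_well_estimate_mono[OF Q e'(2) Ce e'(3)])
    with e'(1) show "\<exists>e>0. Quant l e" by blast
  next
    fix l e e' assume Q: "Quant l e" and e': "0 < e'" "e' \<le> e"
    have ee: "1 / e \<le> 1 / e'" using e' by (intro divide_left_mono) auto
    show "Quant l e'"
      using Q unfolding Quant_def by (rule single_well_estimate_mono[OF _ e'(2) ee e'(2)])
  qed simp
  then obtain e2 where e2: "0 < e2" "\<And>l. l < L \<Longrightarrow> Quant l e2" by auto
  have "\<exists>e>0. \<forall>x\<in>{a L..max (a L) B}. e \<le> v x - lam0"
    by (rule continuous_positive_gap) (use aL cvU in \<open>auto intro!: continuous_intros\<close>)
  then obtain e3 where e3: "0 < e3" "\<And>x. x \<in> {a L..max (a L) B} \<Longrightarrow> e3 \<le> v x - lam0" by blast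
  define \<epsilon> where "\<epsilon> = Min {e1, e2, e3, et, eb}"
  have \<epsilon>: "0 < \<epsilon>" "\<epsilon> \<le> e1" "\<epsilon> \<le> e2" "\<epsilon> \<le> e3" "\<epsilon> \<le> et" "\<epsilon> \<le> eb"
    using e1 e2 e3 et eb by (auto simp: \<epsilon>_def)
  have outL: "lam0 + \<epsilon> \<le> v x" if "x \<le> a 0" for x
    using A[of x] that \<epsilon> by (simp add: a0)
  have outR: "lam0 + \<epsilon> \<le> v x" if "a L \<le> x" for x
  proof (cases "B \<le> x")
    case True
    then show ?thesis using B[of x] \<epsilon> by simp
  next
    case False
    then show ?thesis using e3(2)[of x] that \<epsilon> by auto
  qed
  \<comment> \<open>Wells are numbered from 1 here and from 0 in the chain.\<close>
  define xm where "xm = (\<lambda>l lam. SOME x. x \<in> {a (l - 1)<..<mid (l - 1)} \<and> v x = lam)"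
  define xp where "xp = (\<lambda>l lam. SOME x. x \<in> {mid (l - 1)<..<a (Suc (l - 1))} \<and> v x = lam)"
  have xm: "xm l lam \<in> {a (l - 1)<..<mid (l - 1)} \<and> v (xm l lam) = lam"
    and xp: "xp l lam \<in> {mid (l - 1)<..<a (Suc (l - 1))} \<and> v (xp l lam) = lam"
    if l: "l \<in> {1..L}" and lam: "\<bar>lam - lam0\<bar> < \<epsilon>" for l lam
  proof -
    have "Roots (l - 1) e1" using l by (intro e1) auto
    then have "(\<exists>x\<in>{a (l - 1)<..<mid (l - 1)}. v x = lam) \<and> (\<exists>x\<in>{mid (l - 1)<..<a (Suc (l - 1))}. v x = lam)"
      unfolding Roots_eq using lam \<epsilon> by (meson order_less_le_trans)
    then have "\<exists>x. x \<in> {a (l - 1)<..<mid (l - 1)} \<and> v x = lam" "\<exists>x. x \<in> {mid (l - 1)<..<a (Suc (l - 1))} \<and> v x = lam"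
      by blast+
    from someI_ex[OF this(1)] someI_ex[OF this(2)]
    show "xm l lam \<in> {a (l - 1)<..<mid (l - 1)} \<and> v (xm l lam) = lam"
      "xp l lam \<in> {mid (l - 1)<..<a (Suc (l - 1))} \<and> v (xp l lam) = lam"
      unfolding xm_def xp_def by blast+
  qed
  have cover: "x < a 0 \<or> (\<exists>l<L. a l \<le> x \<and> x \<le> a (Suc l)) \<or> a L \<le> x" for x
    using between_consecutive[of a x L] not_less by blast
  have in_well_interval: "(v t = lam \<longleftrightarrow> t = xm (Suc l) lam \<or> t = xp (Suc l) lam) \<and>
      (v t < lam \<longleftrightarrow> xm (Suc l) lam < t \<and> t < xp (Suc l) lam)"
    if l: "l < L" and lam: "\<bar>lam - lam0\<bar> < \<epsilon>" and t: "t \<in> {a l..a (Suc l)}" for l lam t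
  proof -
    have R: "Roots l e1" by (rule e1(2)[OF l])
    have "\<bar>lam - lam0\<bar> < e1" using lam \<epsilon> by linarith
    with R have "\<forall>xl\<in>{a l<..<mid l}. \<forall>xr\<in>{mid l<..<a (Suc l)}. v xl = lam \<longrightarrow> v xr = lam \<longrightarrow>
        (\<forall>t\<in>{a l..a (Suc l)}. (v t = lam \<longleftrightarrow> t = xl \<or> t = xr) \<and> (v t < lam \<longleftrightarrow> xl < t \<and> t < xr))"
      unfolding Roots_eq by blast
    moreover have "xm (Suc l) lam \<in> {a l<..<mid l}" "v (xm (Suc l) lam) = lam"
      "xp (Suc l) lam \<in> {mid l<..<a (Suc l)}" "v (xp (Suc l) lam) = lam"
      using xm[of "Suc l" lam] xp[of "Suc l" lam] l lam by auto
    ultimately show ?thesis using t by blast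
  qed
  have enum: "enumerates_wells v lam L (\<lambda>l. xm l lam) (\<lambda>l. xp l lam)" if lam: "\<bar>lam - lam0\<bar> < \<epsilon>" for lam
  proof -
    have outside: "lam < v x" if "x < a 0 \<or> a L \<le> x" for x
      using that outL[of x] outR[of x] lam by linarith
    have in_well: "a (l - 1) < xm l lam" "xm l lam < xp l lam" "xp l lam < a l" if "l \<in> {1..L}" for l
      using xm[OF that lam] xp[OF that lam] that by auto
    show ?thesis
      unfolding enumerates_wells_def
    proof (intro conjI ballI)
      show "xm l lam < xp l lam" if "l \<in> {1..L}" for l by (rule in_well[OF that])
      show "xp l lam < xm (Suc l) lam" if "l \<in> {1..<L}" for l
        using in_well(3)[of l] in_well(1)[of "Suc l"] that by auto
      show "{x. v x = lam} = (\<lambda>l. xm l lam) ` {1..L} \<union> (\<lambda>l. xp l lam) ` {1..L}"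
      proof (intro subset_antisym subsetI)
        fix x assume "x \<in> {x. v x = lam}"
        then have vx: "v x = lam" by simp
        then have "\<not> (x < a 0 \<or> a L \<le> x)" using outside[of x] by auto
        then obtain l where l: "l < L" "x \<in> {a l..a (Suc l)}" using cover[of x] by auto
        then have "x = xm (Suc l) lam \<or> x = xp (Suc l) lam" using in_well_interval[OF l(1) lam l(2)] vx by blast
        moreover have "Suc l \<in> {1..L}" using l by auto
        ultimately show "x \<in> (\<lambda>l. xm l lam) ` {1..L} \<union> (\<lambda>l. xp l lam) ` {1..L}" by blast
      next
        fix x assume "x \<in> (\<lambda>l. xm l lam) ` {1..L} \<union> (\<lambda>l. xp l lam) ` {1..L}"
        then show "x \<in> {x. v x = lam}" using xm[OF _ lam] xp[OF _ lam] by auto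
      qed
      show "{x. v x < lam} = (\<Union>l\<in>{1..L}. {xm l lam<..<xp l lam})"
      proof (intro subset_antisym subsetI)
        fix x assume "x \<in> {x. v x < lam}"
        then have vx: "v x < lam" by simp
        then have "\<not> (x < a 0 \<or> a L \<le> x)" using outside[of x] by auto
        then obtain l where l: "l < L" "x \<in> {a l..a (Suc l)}" using cover[of x] by auto
        then have "x \<in> {xm (Suc l) lam<..<xp (Suc l) lam}" using in_well_interval[OF l(1) lam l(2)] vx by auto
        moreover have "Suc l \<in> {1..L}" using l by auto
        ultimately show "x \<in> (\<Union>l\<in>{1..L}. {xm l lam<..<xp l lam})" by blast
      next
        fix x assume "x \<in> (\<Union>l\<in>{1..L}. {xm l lam<..<xp l lam})"
        then obtain l where l: "l \<in> {1..L}" "xm l lam < x" "x < xp l lam" by auto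
        define k where "k = l - 1"
        have k: "l = Suc k" "k < L" using l(1) by (auto simp: k_def)
        have "x \<in> {a k..a (Suc k)}" using in_well[OF l(1)] l k by auto
        then show "x \<in> {x. v x < lam}" using in_well_interval[OF k(2) lam] l k by auto
      qed
    qed
  qed
  have Lpos: "0 < L"
  proof (rule ccontr)
    assume "\<not> 0 < L"
    then have "lam0 < v x0" using outL[of x0] outR[of x0] \<epsilon>(1) by (cases "x0 \<le> a 0") auto
    then show False using x0 by simp
  qed
  have main: "well_neighborhood v \<Lambda>1 \<Lambda>2 L xm xp \<and>
    (\<exists>C>0. \<exists>h0>0. \<forall>h\<in>{0<..<h0}. \<forall>lam\<in>{\<Lambda>1<..<\<Lambda>2}.
       eigenvalue_L2 (schrodinger_op v h) (of_real lam) \<longrightarrow>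
       (\<exists>l\<in>{1..L}. \<exists>n::int.
          \<bar>cos (well_action v lam (xm l lam) (xp l lam) / h)\<bar> \<le> C * h \<and>
          \<bar>well_action v lam (xm l lam) (xp l lam) - pi * (of_int n + 1/2) * h\<bar> \<le> C * h\<^sup>2))"
    if \<Lambda>: "lam0 - \<epsilon> < \<Lambda>1 \<and> \<Lambda>1 < lam0 \<and> lam0 < \<Lambda>2 \<and> \<Lambda>2 < lam0 + \<epsilon>" for \<Lambda>1 \<Lambda>2
  proof
    have near: "\<bar>lam - lam0\<bar> < \<epsilon>" if "lam \<in> {\<Lambda>1<..<\<Lambda>2}" for lam using that \<Lambda> by auto
    show "well_neighborhood v \<Lambda>1 \<Lambda>2 L xm xp"
      unfolding well_neighborhood_def
    proof (intro conjI allI impI ballI)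
      fix x assume "v x \<in> {\<Lambda>1<..<\<Lambda>2}"
      then have n: "\<bar>v x - lam0\<bar> < \<epsilon>" by (rule near)
      then have "\<not> (x < a 0 \<or> a L \<le> x)" using outL[of x] outR[of x] by auto
      then obtain l where l: "l < L" "x \<in> {a l..a (Suc l)}" using cover[of x] by auto
      then show "deriv v x \<noteq> 0" using e1(2)[OF l(1)] n \<epsilon>(2) unfolding Roots_eq v1_def[symmetric] by fastforce
    next
      have "ereal \<Lambda>2 < ereal (lam0 + et)" "ereal \<Lambda>2 < ereal (lam0 + eb)" using \<Lambda> \<epsilon> by auto
      then show "ereal \<Lambda>2 < Liminf at_top (\<lambda>x. ereal (v x))" "ereal \<Lambda>2 < Liminf at_bot (\<lambda>x. ereal (v x))"
        using et(2) eb(2) less_trans by blast+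
    next
      fix lam assume "lam \<in> {\<Lambda>1<..<\<Lambda>2}"
      then show "enumerates_wells v lam L (\<lambda>l. xm l lam) (\<lambda>l. xp l lam)" by (intro enum near)
    qed
    have "\<exists>l\<in>{1..L}. \<exists>n::int.
          \<bar>cos (well_action v lam (xm l lam) (xp l lam) / h)\<bar> \<le> 2 / e2 * h \<and>
          \<bar>well_action v lam (xm l lam) (xp l lam) - pi * (of_int n + 1/2) * h\<bar> \<le> 2 / e2 * h\<^sup>2"
      if h: "h \<in> {0<..<e2}" and lam: "lam \<in> {\<Lambda>1<..<\<Lambda>2}" and ev: "eigenvalue_L2 (schrodinger_op v h) (of_real lam)" for h lam
    proof -
      note lam' = near[OF lam]
      have hpos: "0 < h" "h < e2" using h by auto
      obtain y y1 where st: "stationary v lam h y y1" and nz: "\<exists>x. y x \<noteq> 0" and L2: "integrable lebesgue (\<lambda>x. (y x)\<^sup>2)"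
        using eigenvalue_real_solution[OF cvU hpos(1) ev] by blast
      have fluxL: "0 \<le> y (a 0) * y1 (a 0)"
        by (rule L2_flux_nonneg_left[OF st _ L2]) (use outL lam' in force)
      have fluxR: "y (a L) * y1 (a L) \<le> 0"
        by (rule L2_flux_nonpos_right[OF st _ L2]) (use outR lam' in force)
      obtain l where l: "l < L" "0 \<le> y (a l) * y1 (a l)" "y (a (Suc l)) * y1 (a (Suc l)) \<le> 0"
        using sign_change_between[OF Lpos, of "\<lambda>l. y (a l) * y1 (a l)"] fluxL fluxR by blast
      define xl where "xl = xm (Suc l) lam"
      define xr where "xr = xp (Suc l) lam"
      have Sl: "Suc l \<in> {1..L}" using l by auto
      have xl: "xl \<in> {a l<..<mid l}" "v xl = lam" and xr: "xr \<in> {mid l<..<a (Suc l)}" "v xr = lam"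
        using xm[OF Sl lam'] xp[OF Sl lam'] by (simp_all add: xl_def xr_def)
      have act: "well_action v lam xl xr = integral {xl..xr} (\<lambda>t. sqrt (lam - v t))"
        by (rule well_action_eq_integral[OF cvU]) (use xl xr in auto)
      define \<Phi> where "\<Phi> = well_action v lam xl xr"
      have cos: "\<bar>cos (\<Phi> / h)\<bar> \<le> 1 / e2 * h"
        unfolding \<Phi>_def act
        by (rule e2(2)[OF l(1), unfolded Quant_def single_well_estimate_def, rule_format])
          (use lam' \<epsilon> hpos st nz l xl xr in auto)
      obtain n :: int where n: "\<bar>\<Phi> / h - pi * (of_int n + 1 / 2)\<bar> \<le> 2 * \<bar>cos (\<Phi> / h)\<bar>"
        using cos_small_imp_near_half_integer by blast
      have "\<bar>\<Phi> - pi * (of_int n + 1 / 2) * h\<bar> = h * \<bar>\<Phi> / h - pi * (of_int n + 1 / 2)\<bar>"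
      proof -
        have "\<Phi> - pi * (of_int n + 1 / 2) * h = h * (\<Phi> / h - pi * (of_int n + 1 / 2))"
          using hpos(1) by (simp add: right_diff_distrib)
        then show ?thesis using hpos(1) by (simp only: abs_mult abs_of_pos)
      qed
      also have "\<dots> \<le> h * (2 * (1 / e2 * h))"
        using n cos hpos(1) by (intro mult_left_mono) auto
      also have "\<dots> = 2 / e2 * h\<^sup>2" by (simp add: power2_eq_square)
      finally have 2: "\<bar>\<Phi> - pi * (of_int n + 1 / 2) * h\<bar> \<le> 2 / e2 * h\<^sup>2" .
      have "1 / e2 * h \<le> 2 / e2 * h" using hpos e2(1) by (intro mult_right_mono divide_right_mono) auto
      with cos have 1: "\<bar>cos (\<Phi> / h)\<bar> \<le> 2 / e2 * h" by linarith
      from 1 2 Sl show ?thesis unfolding \<Phi>_def xl_def xr_def by blast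
    qed
    then show "\<exists>C>0. \<exists>h0>0. \<forall>h\<in>{0<..<h0}. \<forall>lam\<in>{\<Lambda>1<..<\<Lambda>2}.
       eigenvalue_L2 (schrodinger_op v h) (of_real lam) \<longrightarrow>
       (\<exists>l\<in>{1..L}. \<exists>n::int.
          \<bar>cos (well_action v lam (xm l lam) (xp l lam) / h)\<bar> \<le> C * h \<and>
          \<bar>well_action v lam (xm l lam) (xp l lam) - pi * (of_int n + 1/2) * h\<bar> \<le> C * h\<^sup>2)"
      using e2(1) by (intro exI[of _ "2 / e2"] conjI exI[of _ e2] ballI impI) auto
  qed
  show ?thesis
    by (rule exI[of _ L], rule exI[of _ xm], rule exI[of _ xp], rule exI[of _ \<epsilon>], rule conjI[OF \<epsilon>(1)],
        intro allI impI, rule main)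
qed

end
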